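(* Let $K$ be a field of characteristic two, and let $\lambda=(\lambda_1,\lambda_2)$ and $\mu=(\mu_1,\mu_2)$ be partitions of $r$ with at most two parts such that the Young module $Y^\mu$ is (isomorphic to) a direct summand of the permutation module $M^\lambda$ over $K\Sigma_r$. Let $m=\lambda_1-\lambda_2$ and $g=\lambda_2-\mu_2$, so that $\mu_1-\mu_2=m+2g$. Then the idempotent $e_{m,g}$ of $S_K(\lambda)\simeq\mathrm{End}_{K\Sigma_r}(M^\lambda)$ is the projection of $M^\lambda$ onto the direct summand $Y^\mu$.
   Context: Setting. Let $r$ be a natural number and $\lambda=(\lambda_1,\lambda_2)$, $\lambda_1\ge\lambda_2\ge 0$, a partition of $r$. Let $E_{\mathbb Q}$ be a 2-dimensional $\mathbb Q$-vector space; $S_{\mathbb Q}(2,r)=\mathrm{End}_{\mathbb Q\Sigma_r}(E_{\mathbb Q}^{\otimes r})$ is the Schur algebra. The Lie algebra $\mathfrak{gl}_2$ has basis the matrix units $e=e_{12}$, $f=e_{21}$, $H_1=e_{11}$, $H_2=e_{22}$; its action on $E_{\mathbb Q}^{\otimes r}$ gives a surjection $\mathfrak U(\mathfrak{gl}_2)\to S_{\mathbb Q}(2,r)$, and elements are identified with their images. Put $e^{(i)}=e^i/i!$, $f^{(i)}=f^i/i!$. Let $1_\lambda\in S_{\mathbb Q}(2,r)$ be the idempotent projecting onto the $\lambda$-weight space along the other weight spaces (it is the image of $\binom{H_1}{\lambda_1}\binom{H_2}{\lambda_2}$). Put $S_{\mathbb Q}(\lambda)=1_\lambda S_{\mathbb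 Q}(2,r)1_\lambda$ and $b(i)=1_\lambda f^{(i)}e^{(i)}1_\lambda$ for $i\ge 0$. Then $b(0)$ is the identity of $S_{\mathbb Q}(\lambda)$ and $b(i)=0$ for $i>\lambda_2$. Let $S_{\mathbb Z}(2,r)$ be the image of the Kostant $\mathbb Z$-form of $\mathfrak U(\mathfrak{gl}_2)$ and $S_{\mathbb Z}(\lambda)=S_{\mathbb Q}(\lambda)\cap S_{\mathbb Z}(2,r)$; it has $\mathbb Z$-basis $b(0),\dots,b(\lambda_2)$. For a field $K$, let $E$ be a 2-dimensional $K$-space and $S_K(2,r)=\mathrm{End}_{K\Sigma_r}(E^{\otimes r})$; the $\lambda$-weight space of $E^{\otimes r}$ is the permutation module $M^\lambda$ (induced from the trivial module of the Young subgroup $\Sigma_\lambda$), and $S_K(\lambda)=1_\lambda S_K(2,r)1_\lambda\simeq \mathrm{End}_{K\Sigma_r}(M^\lambda)$. One has $S_K(\lambda)\simeq S_{\mathbb Z}(\lambda)\otimes_{\mathbb Z}K$, and $b(i)$ also denotes $b(i)\otimes 1_K$. The algebra $S_K(\lambda)$ is commutative. Definition of $e_{m,g}$. For a nonnegative integer $a$ let $a_u$ denote its $u$-th binary digit. For $g\ge 0$ with $\binom{m+2g}{g}$ odd and $m+2g\le r$ put $$I_{m,g}=\{u: g_u=0,\ (m+2g)_u=1\},\qquad J_{m,g}=\{u: g_u=1,\ (m+2g)_u=1\},$$ $$e_{m,g}=\prod_{u\in J_{m,g}}b(2^u)\prod_{u\in I_{m,g}}(1-b(2^u))\in S_K(\lambda);$$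 in characteristic two these elements are idempotents. Young modules. $Y^\mu$ is the unique indecomposable direct summand of $M^\mu$ containing the Specht module $S^\mu$. For two-part partitions, $Y^\mu$ occurs as a direct summand of $M^\lambda$ at most once, and (known) it occurs if and only if $g=\lambda_2-\mu_2\ge 0$ and $\binom{m+2g}{g}\ne 0$ in $K$. *)

theory Defs
  imports
    Complex_Main
    "HOL-Library.Function_Algebras"
    "HOL-Library.FuncSet"
    "HOL-Combinatorics.Permutations"
    "HOL-Algebra.Ring"
begin

section \<open>Tensor space\<close>

text \<open>
  The basis tensor \<open>e\<^bsub>w 0\<^esub> \<otimes> \<dots> \<otimes> e\<^bsub>w (r-1)\<^esub>\<close> of the \<open>r\<close>-th tensor power of a space with basis
  \<open>e\<^sub>1, e\<^sub>2\<close> is indexed by the word \<open>w\<close>; tensor positions are numbered from \<open>0\<close>. A tensor is its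
  coordinate function, which vanishes off the words of length \<open>r\<close>.
\<close>

type_synonym word = "nat \<Rightarrow> nat"
type_synonym 'k tensor = "word \<Rightarrow> 'k"
type_synonym 'k operator = "'k tensor \<Rightarrow> 'k tensor"

definition words :: "nat \<Rightarrow> word set" where
  "words r = {..<r} \<rightarrow>\<^sub>E {1, 2}"

definition scl :: "'k::field \<Rightarrow> 'k tensor \<Rightarrow> 'k tensor" where
  "scl c v = (\<lambda>w. c * v w)"

definition bvec :: "word \<Rightarrow> 'k::field tensor" where
  "bvec w = (\<lambda>u. if u = w then 1 else 0)"

definition tensor_space :: "nat \<Rightarrow> 'k::field tensor set" where
  "tensor_space r = {v. \<forall>w. w \<notin> words r \<longrightarrow> v w = 0}"

interpretation tensor: vector_space "scl :: 'k::field \<Rightarrow> 'k tensor \<Rightarrow> 'k tensor"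
  by standard (auto simp: scl_def fun_eq_iff algebra_simps)

text \<open>
  Place permutation: \<open>p\<close> moves the letter in position \<open>i\<close> to position \<open>p i\<close>, that is,
  it sends \<open>bvec w\<close> to \<open>bvec (w \<circ> inv_into UNIV p)\<close>.
\<close>

definition perm_act :: "(nat \<Rightarrow> nat) \<Rightarrow> 'k::field operator" where
  "perm_act p v = (\<lambda>w. v (w \<circ> p))"

lemma perm_act_bvec:
  assumes "p permutes {..<r}"
  shows "perm_act p (bvec w) = bvec (w \<circ> inv_into UNIV p)"
proof -
  have "u \<circ> p = w \<longleftrightarrow> u = w \<circ> inv_into UNIV p" for u
    using permutes_inv_o[OF assms] by (auto simp: comp_assoc)
  then show ?thesis
    by (simp add: perm_act_def bvec_def fun_eq_iff)
qed

definition weight_words :: "nat \<Rightarrow> nat \<Rightarrow> nat \<Rightarrow> word set" where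
  "weight_words r l1 l2 =
     {w \<in> words r. card {p. p < r \<and> w p = 1} = l1 \<and> card {p. p < r \<and> w p = 2} = l2}"

definition perm_module :: "nat \<Rightarrow> nat \<Rightarrow> nat \<Rightarrow> 'k::field tensor set" where
  "perm_module r l1 l2 = {v. \<forall>w. w \<notin> weight_words r l1 l2 \<longrightarrow> v w = 0}"

definition weight_proj :: "nat \<Rightarrow> nat \<Rightarrow> nat \<Rightarrow> 'k::field operator" where
  "weight_proj r l1 l2 v = (\<lambda>w. if w \<in> weight_words r l1 l2 then v w else 0)"


section \<open>The Schur algebra and its corner \<open>S\<^sub>K(\<lambda>)\<close>\<close>

definition tensor_proj :: "nat \<Rightarrow> 'k::field operator" where
  "tensor_proj r v = (\<lambda>w. if w \<in> words r then v w else 0)"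

text \<open>
  An endomorphism of \<open>tensor_space r\<close> is represented by its extension by zero along
  \<open>tensor_proj r\<close>, which makes \<open>tensor_proj r\<close> the identity element.
\<close>

definition schur_algebra :: "nat \<Rightarrow> ('k::field operator) ring" where
  "schur_algebra r =
     \<lparr>carrier = {\<phi>. Vector_Spaces.linear scl scl \<phi> \<and>
                    tensor_proj r \<circ> \<phi> = \<phi> \<and> \<phi> \<circ> tensor_proj r = \<phi> \<and>
                    (\<forall>p. p permutes {..<r} \<longrightarrow> \<phi> \<circ> perm_act p = perm_act p \<circ> \<phi>)},
      mult = (\<circ>), one = tensor_proj r, zero = 0, add = (+)\<rparr>"

definition schur_corner :: "nat \<Rightarrow> nat \<Rightarrow> nat \<Rightarrow> ('k::field operator) ring" where
  "schur_corner r l1 l2 =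
     \<lparr>carrier = (\<lambda>\<phi>. weight_proj r l1 l2 \<circ> \<phi> \<circ> weight_proj r l1 l2) ` carrier (schur_algebra r),
      mult = (\<circ>), one = weight_proj r l1 l2, zero = 0, add = (+)\<rparr>"


section \<open>The elements \<open>b(i)\<close>\<close>

text \<open>
  The matrix unit \<open>e\<^bsub>ab\<^esub>\<close> of \<open>gl\<^sub>2\<close> sends \<open>e\<^sub>b\<close> to \<open>e\<^sub>a\<close>. On tensor space it acts as a derivation:
  it replaces one letter \<open>b\<close> at a time.
\<close>

definition gl_act :: "nat \<Rightarrow> nat \<Rightarrow> nat \<Rightarrow> 'k::field operator" where
  "gl_act r a b v =
     (\<Sum>w\<in>words r. \<Sum>p | p < r \<and> w p = b. scl (v w) (bvec (w(p := a))))"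

definition div_power :: "nat \<Rightarrow> nat \<Rightarrow> nat \<Rightarrow> nat \<Rightarrow> rat operator" where
  "div_power r a b i v = scl (1 / fact i) ((gl_act r a b ^^ i) v)"

definition b_rat :: "nat \<Rightarrow> nat \<Rightarrow> nat \<Rightarrow> nat \<Rightarrow> rat operator" where
  "b_rat r l1 l2 i =
     weight_proj r l1 l2 \<circ> div_power r 2 1 i \<circ> div_power r 1 2 i \<circ> weight_proj r l1 l2"

text \<open>
  The operator \<open>b(i)\<close> over \<open>\<rat>\<close> has an integral matrix in the basis of words (lemma
  \<open>b_rat_integral\<close> below), so the floor merely reads a rational integer as an element of type
  \<open>int\<close>. The operator over \<open>K\<close> is given by the image of this matrix in \<open>K\<close>; it is \<open>b(i) \<otimes> 1\<close>.
\<close>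

definition b_coeff :: "nat \<Rightarrow> nat \<Rightarrow> nat \<Rightarrow> nat \<Rightarrow> word \<Rightarrow> word \<Rightarrow> int" where
  "b_coeff r l1 l2 i u w = \<lfloor>b_rat r l1 l2 i (bvec w) u\<rfloor>"

definition b_elem :: "nat \<Rightarrow> nat \<Rightarrow> nat \<Rightarrow> nat \<Rightarrow> 'k::field operator" where
  "b_elem r l1 l2 i v =
     (\<Sum>w\<in>weight_words r l1 l2. scl (v w) (\<lambda>u. of_int (b_coeff r l1 l2 i u w)))"


section \<open>The idempotents \<open>e\<^bsub>m,g\<^esub>\<close>\<close>

definition I_set :: "nat \<Rightarrow> nat \<Rightarrow> nat set" where
  "I_set m g = {u. \<not> bit g u \<and> bit (m + 2 * g) u}"

definition J_set :: "nat \<Rightarrow> nat \<Rightarrow> nat set" where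
  "J_set m g = {u. bit g u \<and> bit (m + 2 * g) u}"

text \<open>The element \<open>e\<^bsub>m,g\<^esub>\<close> is only of interest when \<open>(m + 2 * g) choose g\<close> is odd.\<close>

definition e_elem :: "nat \<Rightarrow> nat \<Rightarrow> nat \<Rightarrow> nat \<Rightarrow> nat \<Rightarrow> 'k::field operator" where
  "e_elem r l1 l2 m g =
     (let S = schur_corner r l1 l2 in
      (\<Otimes>\<^bsub>S\<^esub>u\<in>J_set m g. b_elem r l1 l2 (2 ^ u)) \<otimes>\<^bsub>S\<^esub>
      (\<Otimes>\<^bsub>S\<^esub>u\<in>I_set m g. \<one>\<^bsub>S\<^esub> \<ominus>\<^bsub>S\<^esub> b_elem r l1 l2 (2 ^ u)))"


section \<open>Modules for the symmetric group\<close>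

definition sym_submodule :: "nat \<Rightarrow> 'k::field tensor set \<Rightarrow> bool" where
  "sym_submodule r A \<longleftrightarrow>
     A \<subseteq> tensor_space r \<and> tensor.subspace A \<and>
     (\<forall>p. p permutes {..<r} \<longrightarrow> perm_act p ` A \<subseteq> A)"

definition module_iso :: "nat \<Rightarrow> 'k::field tensor set \<Rightarrow> 'k tensor set \<Rightarrow> bool" where
  "module_iso r A B \<longleftrightarrow>
     (\<exists>\<phi>. bij_betw \<phi> A B \<and>
          (\<forall>v\<in>A. \<forall>w\<in>A. \<phi> (v + w) = \<phi> v + \<phi> w) \<and>
          (\<forall>c. \<forall>v\<in>A. \<phi> (scl c v) = scl c (\<phi> v)) \<and>
          (\<forall>p. p permutes {..<r} \<longrightarrow> (\<forall>v\<in>A. \<phi> (perm_act p v) = perm_act p (\<phi> v))))"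

definition direct_decomp ::
    "nat \<Rightarrow> 'k::field tensor set \<Rightarrow> 'k tensor set \<Rightarrow> 'k tensor set \<Rightarrow> bool" where
  "direct_decomp r M A B \<longleftrightarrow>
     sym_submodule r A \<and> sym_submodule r B \<and>
     M = {a + b | a b. a \<in> A \<and> b \<in> B} \<and> A \<inter> B = {0}"

definition direct_summand :: "nat \<Rightarrow> 'k::field tensor set \<Rightarrow> 'k tensor set \<Rightarrow> bool" where
  "direct_summand r A M \<longleftrightarrow> (\<exists>B. direct_decomp r M A B)"

definition indecomposable :: "nat \<Rightarrow> 'k::field tensor set \<Rightarrow> bool" where
  "indecomposable r M \<longleftrightarrow>
     sym_submodule r M \<and> M \<noteq> {0} \<and>
     (\<forall>A B. direct_decomp r M A B \<longrightarrow> A = {0} \<or> B = {0})"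


section \<open>Specht modules and Young modules\<close>

text \<open>
  Rows are numbered \<open>1, 2\<close> and columns from \<open>0\<close>. The tabloid of \<open>t\<close> is the word that records for each
  position the row in which \<open>t\<close> contains it.
\<close>

definition diagram :: "nat \<Rightarrow> nat \<Rightarrow> (nat \<times> nat) set" where
  "diagram m1 m2 = {1} \<times> {..<m1} \<union> {2} \<times> {..<m2}"

definition tableau :: "nat \<Rightarrow> nat \<Rightarrow> nat \<Rightarrow> (nat \<times> nat \<Rightarrow> nat) \<Rightarrow> bool" where
  "tableau r m1 m2 t \<longleftrightarrow> bij_betw t (diagram m1 m2) {..<r}"

definition tabloid :: "nat \<Rightarrow> nat \<Rightarrow> nat \<Rightarrow> (nat \<times> nat \<Rightarrow> nat) \<Rightarrow> word" where
  "tabloid r m1 m2 t = (\<lambda>p\<in>{..<r}. fst (the_inv_into (diagram m1 m2) t p))"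

definition column_stabilizer ::
    "nat \<Rightarrow> nat \<Rightarrow> nat \<Rightarrow> (nat \<times> nat \<Rightarrow> nat) \<Rightarrow> (nat \<Rightarrow> nat) set" where
  "column_stabilizer r m1 m2 t =
     {p. p permutes {..<r} \<and>
         (\<forall>(i, j)\<in>diagram m1 m2. \<exists>i'. (i', j) \<in> diagram m1 m2 \<and> p (t (i, j)) = t (i', j))}"

definition polytabloid ::
    "nat \<Rightarrow> nat \<Rightarrow> nat \<Rightarrow> (nat \<times> nat \<Rightarrow> nat) \<Rightarrow> 'k::field tensor" where
  "polytabloid r m1 m2 t =
     (\<Sum>p\<in>column_stabilizer r m1 m2 t.
        scl (of_int (sign p)) (perm_act p (bvec (tabloid r m1 m2 t))))"

definition specht_module :: "nat \<Rightarrow> nat \<Rightarrow> nat \<Rightarrow> 'k::field tensor set" where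
  "specht_module r m1 m2 = tensor.span {polytabloid r m1 m2 t | t. tableau r m1 m2 t}"

definition young_module :: "nat \<Rightarrow> nat \<Rightarrow> nat \<Rightarrow> 'k::field tensor set \<Rightarrow> bool" where
  "young_module r m1 m2 Y \<longleftrightarrow>
     direct_summand r Y (perm_module r m1 m2) \<and> indecomposable r Y \<and>
     specht_module r m1 m2 \<subseteq> Y"

section \<open>Well-definedness of the elements \<open>b(i)\<close>\<close>

lemma finite_words [simp]: "finite (words r)"
  unfolding words_def by (intro finite_PiE) auto

lemma finite_weight_words [simp]: "finite (weight_words r l1 l2)"
  by (rule finite_subset[OF _ finite_words[of r]]) (auto simp: weight_words_def)

lemma fun_sum_apply: "(\<Sum>x\<in>A. f x) u = (\<Sum>x\<in>A. f x u)"
  for f :: "'a \<Rightarrow> 'b \<Rightarrow> 'c::comm_monoid_add"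
  by (induction A rule: infinite_finite_induct) auto

lemma words_upd: "w \<in> words r \<Longrightarrow> p < r \<Longrightarrow> a \<in> {1, 2} \<Longrightarrow> w(p := a) \<in> words r"
  by (auto simp: words_def PiE_iff extensional_def)

lemma gl_act_outside:
  assumes "a \<in> {1, 2}" and "u \<notin> words r"
  shows "gl_act r a b v u = 0"
proof -
  have "scl (v w) (bvec (w(p := a))) u = 0" if "w \<in> words r" "p < r" for w p
    using words_upd[OF that assms(1)] assms(2) by (auto simp: scl_def bvec_def)
  then show ?thesis
    unfolding gl_act_def fun_sum_apply by (intro sum.neutral ballI) auto
qed

lemma gl_act_apply:
  assumes "a \<in> {1, 2}" "b \<in> {1, 2}" and u: "u \<in> words r"
  shows "gl_act r a b v u = (\<Sum>p | p < r \<and> u p = a. v (u(p := b)))"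
proof -
  have "gl_act r a b v u =
      (\<Sum>w\<in>words r. \<Sum>p | p < r \<and> w p = b. if u = w(p := a) then v w else 0)"
    by (auto simp: gl_act_def fun_sum_apply scl_def bvec_def intro!: sum.cong)
  also have "\<dots> = (\<Sum>w\<in>words r. \<Sum>p<r. if w p = b \<and> u = w(p := a) then v w else 0)"
    by (intro sum.cong sum.mono_neutral_cong_left) auto
  also have "\<dots> = (\<Sum>p<r. \<Sum>w\<in>words r. if w p = b \<and> u = w(p := a) then v w else 0)"
    by (rule sum.swap)
  also have "\<dots> = (\<Sum>p<r. if u p = a then v (u(p := b)) else 0)"
  proof (rule sum.cong[OF refl])
    fix p assume "p \<in> {..<r}"
    then have up: "u(p := b) \<in> words r"
      using words_upd u assms by auto
    have "(w p = b \<and> u = w(p := a)) \<longleftrightarrow> (w = u(p := b) \<and> u p = a)" for w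
      by (auto simp: fun_eq_iff)
    then have "(\<Sum>w\<in>words r. if w p = b \<and> u = w(p := a) then v w else 0)
        = (\<Sum>w\<in>words r. if w = u(p := b) then (if u p = a then v w else 0) else 0)"
      by (intro sum.cong) auto
    also have "\<dots> = (if u p = a then v (u(p := b)) else 0)"
      using up by (simp add: sum.delta)
    finally show "(\<Sum>w\<in>words r. if w p = b \<and> u = w(p := a) then v w else 0)
        = (if u p = a then v (u(p := b)) else 0)" .
  qed
  also have "\<dots> = (\<Sum>p | p < r \<and> u p = a. v (u(p := b)))"
    by (intro sum.mono_neutral_cong_right) auto
  finally show ?thesis .
qed

lemma gl_act_funpow:
  assumes "a \<in> {1, 2}" "b \<in> {1, 2}" "a \<noteq> b" "u \<in> words r"
  shows "(gl_act r a b ^^ i) v u =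
    fact i * (\<Sum>P | P \<subseteq> {p. p < r \<and> u p = a} \<and> card P = i. v (override_on u (\<lambda>_. b) P))"
  using \<open>u \<in> words r\<close>
proof (induction i arbitrary: u)
  case 0
  have "{P. P \<subseteq> {p. p < r \<and> u p = a} \<and> card P = 0} = {{}}"
    by (auto dest: finite_subset)
  then show ?case by simp
next
  case (Suc i)
  let ?U = "{p. p < r \<and> u p = a}"
  let ?F = "\<lambda>P. v (override_on u (\<lambda>_. b) P)"
  have fin: "finite ?U" by simp
  have inner: "(gl_act r a b ^^ i) v (u(p := b)) =
      fact i * (\<Sum>P | P \<subseteq> ?U \<and> card P = Suc i \<and> p \<in> P. ?F P)" if p: "p \<in> ?U" for p
  proof -
    have w: "u(p := b) \<in> words r" using p words_upd Suc.prems assms by auto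
    have U: "{q. q < r \<and> (u(p := b)) q = a} = ?U - {p}" using assms by auto
    have "(\<Sum>P | P \<subseteq> ?U - {p} \<and> card P = i. v (override_on (u(p := b)) (\<lambda>_. b) P))
        = (\<Sum>P | P \<subseteq> ?U \<and> card P = Suc i \<and> p \<in> P. ?F P)"
    proof (rule sum.reindex_bij_witness[where i = "\<lambda>P. P - {p}" and j = "insert p"])
      fix P assume P: "P \<in> {P. P \<subseteq> ?U - {p} \<and> card P = i}"
      then have "finite P" using fin finite_subset by blast
      with P show "insert p P \<in> {P. P \<subseteq> ?U \<and> card P = Suc i \<and> p \<in> P}"
        using p by (auto simp: subset_iff card_insert_if)
      show "insert p P - {p} = P" using P by auto
      show "?F (insert p P) = v (override_on (u(p := b)) (\<lambda>_. b) P)"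
        by (rule arg_cong[where f = v]) (auto simp: override_on_def)
    next
      fix P assume P: "P \<in> {P. P \<subseteq> ?U \<and> card P = Suc i \<and> p \<in> P}"
      then show "insert p (P - {p}) = P" by auto
      show "P - {p} \<in> {P. P \<subseteq> ?U - {p} \<and> card P = i}" using P by auto
    qed
    then show ?thesis using Suc.IH[OF w] by (simp only: U)
  qed
  have "(gl_act r a b ^^ Suc i) v u = (\<Sum>p\<in>?U. (gl_act r a b ^^ i) v (u(p := b)))"
    using assms Suc.prems by (simp add: gl_act_apply)
  also have "\<dots> = (\<Sum>p\<in>?U. fact i * (\<Sum>P | P \<subseteq> ?U \<and> card P = Suc i \<and> p \<in> P. ?F P))"
    by (intro sum.cong refl inner)
  also have "\<dots> = fact i * (\<Sum>p\<in>?U. \<Sum>P | P \<in> {P. P \<subseteq> ?U \<and> card P = Suc i} \<and> p \<in> P. ?F P)"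
    by (simp add: sum_distrib_left conj_assoc)
  also have "(\<Sum>p\<in>?U. \<Sum>P | P \<in> {P. P \<subseteq> ?U \<and> card P = Suc i} \<and> p \<in> P. ?F P)
      = (\<Sum>P | P \<subseteq> ?U \<and> card P = Suc i. \<Sum>p | p \<in> ?U \<and> p \<in> P. ?F P)"
    by (rule sum.swap_restrict) (use fin in auto)
  also have "\<dots> = (\<Sum>P | P \<subseteq> ?U \<and> card P = Suc i. of_nat (Suc i) * ?F P)"
  proof (rule sum.cong[OF refl])
    fix P assume P: "P \<in> {P. P \<subseteq> ?U \<and> card P = Suc i}"
    then have "{p. p \<in> ?U \<and> p \<in> P} = P" by auto
    with P show "(\<Sum>p | p \<in> ?U \<and> p \<in> P. ?F P) = of_nat (Suc i) * ?F P" by simp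
  qed
  finally show ?case
    by (simp only: sum_distrib_left[symmetric] fact_Suc of_nat_mult mult_ac)
qed

lemma div_power_integral:
  assumes "a \<in> {1, 2}" "b \<in> {1, 2}" "a \<noteq> b" and v: "\<And>w. v w \<in> \<int>"
  shows "div_power r a b i v u \<in> \<int>"
proof (cases "u \<in> words r")
  case True
  have "div_power r a b i v u =
      (\<Sum>P | P \<subseteq> {p. p < r \<and> u p = a} \<and> card P = i. v (override_on u (\<lambda>_. b) P))"
    unfolding div_power_def scl_def gl_act_funpow[OF assms(1-3) True] by simp
  then show ?thesis using v by (auto intro: Ints_sum)
next
  case False
  show ?thesis
  proof (cases i)
    case 0
    then show ?thesis using v by (simp add: div_power_def scl_def)
  next
    case (Suc j)
    then show ?thesis
      by (simp add: div_power_def scl_def gl_act_outside[OF assms(1) False])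
  qed
qed

lemma b_rat_integral: "b_rat r l1 l2 i (bvec w) u \<in> \<int>"
proof -
  have proj: "weight_proj r l1 l2 v u \<in> \<int>" if "\<And>w. v w \<in> \<int>" for v :: "rat tensor" and u
    using that by (simp add: weight_proj_def)
  have "bvec w u \<in> (\<int> :: rat set)" for u by (simp add: bvec_def)
  then show ?thesis
    unfolding b_rat_def comp_def by (intro proj div_power_integral) auto
qed


section \<open>\<open>S\<^sub>K(\<lambda>)\<close> is a commutative ring containing the elements \<open>b(i)\<close>\<close>

lemma linear_scl_iff:
  "Vector_Spaces.linear scl scl \<phi> \<longleftrightarrow>
     (\<forall>v w. \<phi> (v + w) = \<phi> v + \<phi> w) \<and> (\<forall>c v. \<phi> (scl c v) = scl c (\<phi> v))"
  for \<phi> :: "'k::field operator"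
  using tensor.vector_space_axioms tensor.module_axioms
  by (auto simp: Vector_Spaces.linear_def module_hom_def module_hom_axioms_def)

lemma words_comp: "p permutes {..<r} \<Longrightarrow> w \<circ> p \<in> words r" if "w \<in> words r"
  using that permutes_in_image[of p "{..<r}"] permutes_not_in[of p "{..<r}"]
  by (fastforce simp: words_def PiE_iff extensional_def)

lemma words_comp_iff:
  assumes p: "p permutes {..<r}"
  shows "w \<circ> p \<in> words r \<longleftrightarrow> w \<in> words r"
proof
  assume "w \<circ> p \<in> words r"
  from words_comp[OF this permutes_inv[OF p]] show "w \<in> words r"
    using permutes_inv_o[OF p] by (simp add: comp_assoc)
qed (use words_comp p in blast)

lemma card_letter_comp:
  assumes p: "p permutes {..<r}"
  shows "card {q. q < r \<and> (w \<circ> p) q = a} = card {q. q < r \<and> w q = a}"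
proof (rule bij_betw_same_card[of p], rule bij_betw_imageI)
  show "inj_on p {q. q < r \<and> (w \<circ> p) q = a}"
    using permutes_inj_on[OF p] by (rule inj_on_subset) auto
  have "q \<in> p ` {q. q < r \<and> (w \<circ> p) q = a}" if "q < r" "w q = a" for q
  proof (rule image_eqI)
    show "q = p (inv_into UNIV p q)" using permutes_inverses(1)[OF p] by simp
    then show "inv_into UNIV p q \<in> {q. q < r \<and> (w \<circ> p) q = a}"
      using that permutes_in_image[OF permutes_inv[OF p], of q] by auto
  qed
  then show "p ` {q. q < r \<and> (w \<circ> p) q = a} = {q. q < r \<and> w q = a}"
    using permutes_in_image[OF p] by auto
qed

lemma weight_words_comp_iff:
  "p permutes {..<r} \<Longrightarrow> w \<circ> p \<in> weight_words r l1 l2 \<longleftrightarrow> w \<in> weight_words r l1 l2"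
  using words_comp_iff[of p r w] card_letter_comp[of p r w]
  by (auto simp: weight_words_def)

lemma weight_proj_idem: "weight_proj r l1 l2 \<circ> weight_proj r l1 l2 = weight_proj r l1 l2"
  by (auto simp: weight_proj_def fun_eq_iff)

lemma weight_proj_perm_act:
  "p permutes {..<r} \<Longrightarrow>
     weight_proj r l1 l2 \<circ> perm_act p = perm_act p \<circ> weight_proj r l1 l2"
  using weight_words_comp_iff[of p r] by (auto simp: weight_proj_def perm_act_def fun_eq_iff)

lemma linear_weight_proj:
  "weight_proj r l1 l2 (v + w) = weight_proj r l1 l2 v + weight_proj r l1 l2 w"
  "weight_proj r l1 l2 (scl c v) = scl c (weight_proj r l1 l2 v)"
  by (auto simp: weight_proj_def scl_def fun_eq_iff)

lemma schur_corner_carrier: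
  "\<phi> \<in> carrier (schur_corner r l1 l2) \<longleftrightarrow>
     (\<forall>v w. \<phi> (v + w) = \<phi> v + \<phi> w) \<and> (\<forall>c v. \<phi> (scl c v) = scl c (\<phi> v)) \<and>
     weight_proj r l1 l2 \<circ> \<phi> = \<phi> \<and> \<phi> \<circ> weight_proj r l1 l2 = \<phi> \<and>
     (\<forall>p. p permutes {..<r} \<longrightarrow> \<phi> \<circ> perm_act p = perm_act p \<circ> \<phi>)"
  (is "?L \<longleftrightarrow> ?R")
proof
  let ?W = "weight_proj r l1 l2 :: 'a operator"
  assume ?L
  then obtain \<psi> where \<psi>: "\<psi> \<in> carrier (schur_algebra r)" and \<phi>: "\<phi> = ?W \<circ> \<psi> \<circ> ?W"
    by (auto simp: schur_corner_def)
  have "\<phi> \<circ> perm_act p = perm_act p \<circ> \<phi>" if p: "p permutes {..<r}" for p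
  proof -
    have "\<psi> \<circ> perm_act p = perm_act p \<circ> \<psi>"
      using \<psi> p by (simp add: schur_algebra_def)
    then have "\<psi> (perm_act p v) = perm_act p (\<psi> v)" for v
      by (metis comp_apply)
    moreover have "?W (perm_act p v) = perm_act p (?W v)" for v
      using weight_proj_perm_act[OF p] by (metis comp_apply)
    ultimately show ?thesis by (intro ext) (simp add: \<phi>)
  qed
  moreover have "?W \<circ> \<phi> = \<phi>" "\<phi> \<circ> ?W = \<phi>"
    unfolding \<phi> by (simp_all add: comp_assoc weight_proj_idem)
      (simp_all add: comp_assoc[symmetric] weight_proj_idem)
  ultimately show ?R
    using \<psi> unfolding schur_algebra_def linear_scl_iff
    by (auto simp: \<phi> linear_weight_proj)
next
  let ?W = "weight_proj r l1 l2 :: 'a operator"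
  let ?T = "tensor_proj r :: 'a operator"
  assume R: ?R
  have WT: "?T \<circ> ?W = ?W" "?W \<circ> ?T = ?W"
    by (auto simp: weight_proj_def tensor_proj_def fun_eq_iff weight_words_def)
  have "?T \<circ> \<phi> = \<phi>" "\<phi> \<circ> ?T = \<phi>"
    using WT R by (metis comp_assoc)+
  then have "\<phi> \<in> carrier (schur_algebra r)"
    using R by (simp add: schur_algebra_def linear_scl_iff)
  moreover have "\<phi> = ?W \<circ> \<phi> \<circ> ?W" using R by simp
  ultimately show ?L by (auto simp: schur_corner_def)
qed

lemma schur_corner_carrier_apply:
  "\<phi> \<in> carrier (schur_corner r l1 l2) \<longleftrightarrow>
     (\<forall>v w. \<phi> (v + w) = \<phi> v + \<phi> w) \<and> (\<forall>c v. \<phi> (scl c v) = scl c (\<phi> v)) \<and>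
     (\<forall>v. weight_proj r l1 l2 (\<phi> v) = \<phi> v) \<and> (\<forall>v. \<phi> (weight_proj r l1 l2 v) = \<phi> v) \<and>
     (\<forall>p v. p permutes {..<r} \<longrightarrow> \<phi> (perm_act p v) = perm_act p (\<phi> v))"
proof -
  have "f \<circ> g = h \<longleftrightarrow> (\<forall>v. f (g v) = h v)" for f g h :: "'a operator"
    by (metis comp_apply ext)
  then show ?thesis unfolding schur_corner_carrier by auto
qed

lemma schur_corner_apply:
  assumes "\<phi> \<in> carrier (schur_corner r l1 l2)"
  shows "\<phi> v u = (\<Sum>w\<in>weight_words r l1 l2. v w * \<phi> (bvec w) u)"
proof -
  let ?B = "weight_words r l1 l2"
  note R = assms[unfolded schur_corner_carrier_apply]
  have sum: "\<phi> (\<Sum>w\<in>A. scl (v w) (bvec w)) = (\<Sum>w\<in>A. scl (v w) (\<phi> (bvec w)))" for A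
  proof (induction A rule: infinite_finite_induct)
    case empty
    have "\<phi> (scl 0 0) = scl 0 (\<phi> 0)" using R by blast
    then show ?case by (simp add: scl_def zero_fun_def)
  next
    case (infinite A)
    have "\<phi> (scl 0 0) = scl 0 (\<phi> 0)" using R by blast
    then show ?case using infinite by (simp add: scl_def zero_fun_def)
  next
    case (insert x A)
    have "\<phi> (scl (v x) (bvec x) + (\<Sum>w\<in>A. scl (v w) (bvec w))) =
        scl (v x) (\<phi> (bvec x)) + \<phi> (\<Sum>w\<in>A. scl (v w) (bvec w))"
      using R by simp
    then show ?case
      by (simp only: sum.insert[OF insert.hyps] insert.IH)
  qed
  have "weight_proj r l1 l2 v = (\<Sum>w\<in>?B. scl (v w) (bvec w))"
    by (intro ext) (simp add: weight_proj_def fun_sum_apply scl_def bvec_def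
        if_distrib[of "(*) _"] cong: if_cong)
  moreover have "\<phi> v = \<phi> (weight_proj r l1 l2 v)"
    using R by simp
  ultimately have "\<phi> v = (\<Sum>w\<in>?B. scl (v w) (\<phi> (bvec w)))" by (simp only: sum)
  then show ?thesis by (simp add: fun_sum_apply scl_def)
qed

lemma weight_words_swap:
  assumes "w \<in> weight_words r l1 l2" "u \<in> weight_words r l1 l2"
  obtains p where "p permutes {..<r}" "u \<circ> p = w" "w \<circ> p = u"
proof -
  define A where "A = {q. q < r \<and> w q = 1 \<and> u q = 2}"
  define B where "B = {q. q < r \<and> w q = 2 \<and> u q = 1}"
  have val: "w q \<in> {1, 2} \<and> u q \<in> {1, 2}" if "q < r" for q
    using that assms by (auto simp: weight_words_def words_def PiE_iff)
  have out: "w q = undefined \<and> u q = undefined" if "\<not> q < r" for q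
    using that assms by (auto simp: weight_words_def words_def PiE_iff extensional_def)
  have fin: "finite A" "finite B" and dis: "A \<inter> B = {}" by (auto simp: A_def B_def)
  let ?C = "{q. q < r \<and> w q = 1 \<and> u q = 1}"
  have "{q. q < r \<and> w q = 1} = A \<union> ?C" "{q. q < r \<and> u q = 1} = B \<union> ?C"
    using val by (auto simp: A_def B_def)
  moreover have "card (A \<union> ?C) = card A + card ?C" "card (B \<union> ?C) = card B + card ?C"
    using fin by (auto intro!: card_Un_disjoint simp: A_def B_def)
  ultimately have "card A = card B"
    using assms by (simp add: weight_words_def)
  then obtain f where f: "bij_betw f A B"
    using fin finite_same_card_bij by blast
  define h where "h = the_inv_into A f"
  have h: "\<And>q. q \<in> B \<Longrightarrow> h q \<in> A" "\<And>q. q \<in> A \<Longrightarrow> f q \<in> B"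
    "\<And>q. q \<in> A \<Longrightarrow> h (f q) = q" "\<And>q. q \<in> B \<Longrightarrow> f (h q) = q"
    using f bij_betw_the_inv_into[OF f] unfolding h_def
    by (auto simp: bij_betw_def the_inv_into_f_f f_the_inv_into_f)
  define p where "p q = (if q \<in> A then f q else if q \<in> B then h q else q)" for q
  have pp: "p (p q) = q" for q
    using h dis by (auto simp: p_def)
  have "p permutes {..<r}"
    unfolding permutes_def
  proof (intro conjI allI impI)
    fix q :: nat assume "q \<notin> {..<r}"
    then show "p q = q" by (auto simp: p_def A_def B_def)
  next
    fix q show "\<exists>!x. p x = q" using pp by metis
  qed
  moreover have "u (p q) = w q \<and> w (p q) = u q" for q
  proof (cases "q \<in> A \<or> q \<in> B")
    case True
    then show ?thesis using h dis by (auto simp: p_def A_def B_def)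
  next
    case False
    then have "w q = u q"
      using val[of q] out[of q] by (cases "q < r") (auto simp: A_def B_def)
    then show ?thesis using False by (simp add: p_def)
  qed
  ultimately show thesis by (intro that) (auto simp: fun_eq_iff)
qed

lemma schur_corner_sym:
  assumes \<phi>: "\<phi> \<in> carrier (schur_corner r l1 l2)"
    and "w \<in> weight_words r l1 l2" "u \<in> weight_words r l1 l2"
  shows "\<phi> (bvec w) u = \<phi> (bvec u) w"
proof -
  obtain p where p: "p permutes {..<r}" "u \<circ> p = w" "w \<circ> p = u"
    using weight_words_swap assms(2,3) by blast
  have "u = w \<circ> inv_into UNIV p"
    using p(2) permutes_inv_o(1)[OF p(1)] by (auto simp: comp_assoc)
  then have "bvec u = perm_act p (bvec w :: 'a tensor)" by (simp add: perm_act_bvec[OF p(1)])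
  moreover have "\<phi> (perm_act p (bvec w)) = perm_act p (\<phi> (bvec w))"
    using \<phi> p(1) unfolding schur_corner_carrier_apply by blast
  ultimately have "\<phi> (bvec u) w = perm_act p (\<phi> (bvec w)) w" by (simp only:)
  also have "\<dots> = \<phi> (bvec w) u" using p(3) by (simp only: perm_act_def)
  finally show ?thesis by simp
qed

lemma schur_corner_comm:
  assumes \<phi>: "\<phi> \<in> carrier (schur_corner r l1 l2)" and \<psi>: "\<psi> \<in> carrier (schur_corner r l1 l2)"
  shows "\<phi> \<circ> \<psi> = \<psi> \<circ> \<phi>"
proof -
  let ?B = "weight_words r l1 l2"
  have comp: "\<psi> (\<phi> v) u = (\<Sum>w\<in>?B. v w * (\<Sum>x\<in>?B. \<phi> (bvec w) x * \<psi> (bvec x) u))"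
    if "\<phi> \<in> carrier (schur_corner r l1 l2)" "\<psi> \<in> carrier (schur_corner r l1 l2)" for \<phi> \<psi> v u
    unfolding schur_corner_apply[OF that(2), of "\<phi> v"] schur_corner_apply[OF that(1), of v]
    by (simp add: sum_distrib_left sum_distrib_right mult.assoc) (rule sum.swap)
  have "\<phi> (\<psi> v) u = \<psi> (\<phi> v) u" for v u
  proof (cases "u \<in> ?B")
    case True
    have "(\<Sum>x\<in>?B. \<psi> (bvec w) x * \<phi> (bvec x) u) = (\<Sum>x\<in>?B. \<phi> (bvec w) x * \<psi> (bvec x) u)"
      if w: "w \<in> ?B" for w
    proof -
      obtain p where p: "p permutes {..<r}" "u \<circ> p = w" "w \<circ> p = u"
        using weight_words_swap w True by blast
      have \<psi>p: "\<chi> (bvec x) (y \<circ> p) = \<chi> (bvec (x \<circ> inv_into UNIV p)) y"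
        if "\<chi> \<in> carrier (schur_corner r l1 l2)" for \<chi> :: "'a operator" and x y
      proof -
        have "\<chi> (perm_act p (bvec x)) = perm_act p (\<chi> (bvec x))"
          using that p(1) unfolding schur_corner_carrier_apply by blast
        then have "\<chi> (bvec (x \<circ> inv_into UNIV p)) y = perm_act p (\<chi> (bvec x)) y"
          by (simp only: perm_act_bvec[OF p(1)])
        then show ?thesis by (simp only: perm_act_def)
      qed
      have inv: "(x \<circ> p) \<circ> inv_into UNIV p = x" for x :: word
        using permutes_inv_o(1)[OF p(1)] by (simp add: comp_assoc)
      have inv': "(x \<circ> inv_into UNIV p) \<circ> p = x" for x :: word
        using permutes_inv_o(2)[OF p(1)] by (simp add: comp_assoc)
      show ?thesis
      proof (rule sum.reindex_bij_witness[where i = "\<lambda>x. x \<circ> p" and j = "\<lambda>x. x \<circ> inv_into UNIV p"])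
        fix x assume x: "x \<in> ?B"
        have x': "x \<circ> inv_into UNIV p \<in> ?B"
          using x weight_words_comp_iff[OF permutes_inv[OF p(1)]] by blast
        show "x \<circ> inv_into UNIV p \<circ> p = x" by (rule inv')
        show "x \<circ> inv_into UNIV p \<in> ?B" by (rule x')
        have "\<phi> (bvec w) (x \<circ> inv_into UNIV p) = \<phi> (bvec (x \<circ> inv_into UNIV p)) w"
          using schur_corner_sym[OF \<phi> w x'] .
        also have "\<dots> = \<phi> (bvec x) u" using \<psi>p[OF \<phi>, of x w] by (simp only: p)
        finally have 1: "\<phi> (bvec w) (x \<circ> inv_into UNIV p) = \<phi> (bvec x) u" .
        have "\<psi> (bvec (x \<circ> inv_into UNIV p)) u = \<psi> (bvec x) w"
          using \<psi>p[OF \<psi>, of x u] by (simp only: p)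
        also have "\<dots> = \<psi> (bvec w) x" using schur_corner_sym[OF \<psi> x w] .
        finally show "\<phi> (bvec w) (x \<circ> inv_into UNIV p) * \<psi> (bvec (x \<circ> inv_into UNIV p)) u
            = \<psi> (bvec w) x * \<phi> (bvec x) u"
          using 1 by (simp add: mult.commute)
      next
        fix x assume x: "x \<in> ?B"
        show "x \<circ> p \<circ> inv_into UNIV p = x" by (rule inv)
        show "x \<circ> p \<in> ?B" using x weight_words_comp_iff[OF p(1)] by blast
      qed
    qed
    then show ?thesis
      unfolding comp[OF \<phi> \<psi>] comp[OF \<psi> \<phi>] by (intro sum.cong) auto
  next
    case False
    have "\<chi> v' u = 0" if "\<chi> \<in> carrier (schur_corner r l1 l2)" for \<chi> :: "'a operator" and v'
    proof -
      have "\<chi> v' = weight_proj r l1 l2 (\<chi> v')"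
        using that unfolding schur_corner_carrier_apply by simp
      then have "\<chi> v' u = weight_proj r l1 l2 (\<chi> v') u" by (rule fun_cong)
      then show ?thesis using False by (simp add: weight_proj_def)
    qed
    from this[OF \<phi>, of "\<psi> v"] this[OF \<psi>, of "\<phi> v"] show ?thesis by (simp only:)
  qed
  then show ?thesis by (simp add: fun_eq_iff)
qed

lemma cring_schur_corner: "cring (schur_corner r l1 l2 :: ('k::field operator) ring)"
proof -
  let ?S = "schur_corner r l1 l2 :: ('k operator) ring"
  have ops: "mult ?S = (\<circ>)" "one ?S = weight_proj r l1 l2" "zero ?S = 0" "add ?S = (+)"
    by (simp_all add: schur_corner_def)
  have zero: "0 \<in> carrier ?S"
    unfolding schur_corner_carrier_apply
    by (auto simp: scl_def weight_proj_def perm_act_def zero_fun_def)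
  have add: "\<phi> + \<psi> \<in> carrier ?S" if "\<phi> \<in> carrier ?S" "\<psi> \<in> carrier ?S" for \<phi> \<psi>
  proof -
    have "perm_act p (v + w) = perm_act p v + perm_act p w" for p and v w :: "'k tensor"
      by (simp add: perm_act_def fun_eq_iff)
    then show ?thesis
      using that unfolding schur_corner_carrier_apply
      by (simp add: linear_weight_proj tensor.scale_right_distrib)
  qed
  have neg: "- \<phi> \<in> carrier ?S" if "\<phi> \<in> carrier ?S" for \<phi>
  proof -
    have "perm_act p (- v) = - perm_act p v" "weight_proj r l1 l2 (- v) = - weight_proj r l1 l2 v"
      for p and v :: "'k tensor"
      by (simp_all add: perm_act_def weight_proj_def fun_eq_iff)
    then show ?thesis
      using that unfolding schur_corner_carrier_apply by simp
  qed
  have one: "weight_proj r l1 l2 \<in> carrier ?S"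
    unfolding schur_corner_carrier
    using weight_proj_idem weight_proj_perm_act linear_weight_proj by blast
  have comp: "\<phi> \<circ> \<psi> \<in> carrier ?S" if "\<phi> \<in> carrier ?S" "\<psi> \<in> carrier ?S" for \<phi> \<psi>
    using that unfolding schur_corner_carrier_apply by simp
  show ?thesis
  proof (rule cringI)
    show "abelian_group ?S"
    proof (rule abelian_groupI)
      fix \<phi> assume "\<phi> \<in> carrier ?S"
      then have "- \<phi> \<in> carrier ?S" "- \<phi> + \<phi> = 0" using neg by auto
      then show "\<exists>y\<in>carrier ?S. y \<oplus>\<^bsub>?S\<^esub> \<phi> = \<zero>\<^bsub>?S\<^esub>" unfolding ops by blast
    qed (auto simp: ops add zero algebra_simps)
    show "comm_monoid ?S"
    proof (rule comm_monoidI)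
      fix \<phi> assume "\<phi> \<in> carrier ?S"
      then show "\<one>\<^bsub>?S\<^esub> \<otimes>\<^bsub>?S\<^esub> \<phi> = \<phi>" unfolding ops schur_corner_carrier by blast
    qed (auto simp: ops comp one comp_assoc intro: schur_corner_comm)
    show "(x \<oplus>\<^bsub>?S\<^esub> y) \<otimes>\<^bsub>?S\<^esub> z = x \<otimes>\<^bsub>?S\<^esub> z \<oplus>\<^bsub>?S\<^esub> y \<otimes>\<^bsub>?S\<^esub> z" for x y z
      by (simp add: ops fun_eq_iff)
  qed
qed

lemma gl_act_perm_act:
  assumes p: "p permutes {..<r}" and ab: "a \<in> {1, 2}" "b \<in> {1, 2}"
  shows "gl_act r a b (perm_act p v) = perm_act p (gl_act r a b v)"
proof
  fix u
  show "gl_act r a b (perm_act p v) u = perm_act p (gl_act r a b v) u"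
  proof (cases "u \<in> words r")
    case True
    then have up: "u \<circ> p \<in> words r" using words_comp_iff[OF p] by blast
    have "(\<Sum>q | q < r \<and> u q = a. v (u(q := b) \<circ> p)) =
        (\<Sum>q | q < r \<and> (u \<circ> p) q = a. v ((u \<circ> p)(q := b)))"
    proof (rule sum.reindex_bij_witness[where i = p and j = "inv_into UNIV p"])
      fix q assume q: "q \<in> {q. q < r \<and> u q = a}"
      show "p (inv_into UNIV p q) = q" using permutes_inverses(1)[OF p] by simp
      then show "inv_into UNIV p q \<in> {q. q < r \<and> (u \<circ> p) q = a}"
        using q permutes_in_image[OF permutes_inv[OF p], of q] by auto
      have "(u \<circ> p)(inv_into UNIV p q := b) = u(q := b) \<circ> p"
        using permutes_inverses[OF p] by (auto simp: fun_eq_iff)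
      then show "v ((u \<circ> p)(inv_into UNIV p q := b)) = v (u(q := b) \<circ> p)" by simp
    next
      fix q assume q: "q \<in> {q. q < r \<and> (u \<circ> p) q = a}"
      show "inv_into UNIV p (p q) = q" using permutes_inverses(2)[OF p] by simp
      show "p q \<in> {q. q < r \<and> u q = a}" using q permutes_in_image[OF p, of q] by auto
    qed
    then show ?thesis
      using True up ab by (simp add: gl_act_apply perm_act_def)
  next
    case False
    then have "u \<circ> p \<notin> words r" using words_comp_iff[OF p] by blast
    then show ?thesis using False ab by (simp add: gl_act_outside perm_act_def)
  qed
qed

lemma b_rat_perm_act:
  assumes p: "p permutes {..<r}"
  shows "b_rat r l1 l2 i (perm_act p v) = perm_act p (b_rat r l1 l2 i v)"
proof -
  have pow: "(gl_act r a b ^^ i) (perm_act p v) = perm_act p ((gl_act r a b ^^ i) v)"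
    if "a \<in> {1, 2}" "b \<in> {1, 2}" for a b i and v :: "rat tensor"
    by (induction i) (use gl_act_perm_act[OF p that] in simp_all)
  have "div_power r a b i (perm_act p v) = perm_act p (div_power r a b i v)"
    if "a \<in> {1, 2}" "b \<in> {1, 2}" for a b and v :: "rat tensor"
    by (simp add: div_power_def pow[OF that]) (simp add: scl_def perm_act_def)
  moreover have "weight_proj r l1 l2 (perm_act p v) = perm_act p (weight_proj r l1 l2 v)"
    for v :: "rat tensor"
    using weight_proj_perm_act[OF p] by (metis comp_apply)
  ultimately show ?thesis by (simp add: b_rat_def)
qed

lemma b_elem_apply:
  "b_elem r l1 l2 i v u = (\<Sum>w\<in>weight_words r l1 l2. v w * of_int (b_coeff r l1 l2 i u w))"
  by (simp add: b_elem_def fun_sum_apply scl_def)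

lemma b_elem_closed: "b_elem r l1 l2 i \<in> carrier (schur_corner r l1 l2)"
  unfolding schur_corner_carrier
proof (intro conjI allI impI)
  let ?B = "weight_words r l1 l2"
  show "b_elem r l1 l2 i (v + w) = b_elem r l1 l2 i v + b_elem r l1 l2 i w" for v w :: "'a tensor"
    by (simp add: fun_eq_iff b_elem_apply sum.distrib distrib_right)
  show "b_elem r l1 l2 i (scl c v) = scl c (b_elem r l1 l2 i v)" for c and v :: "'a tensor"
    by (simp add: fun_eq_iff b_elem_apply scl_def sum_distrib_left mult.assoc)
  have "b_coeff r l1 l2 i u w = 0" if "u \<notin> ?B" for u w
    using that by (simp add: b_coeff_def b_rat_def weight_proj_def)
  then show "weight_proj r l1 l2 \<circ> b_elem r l1 l2 i = (b_elem r l1 l2 i :: 'a operator)"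
    by (auto simp: fun_eq_iff b_elem_apply weight_proj_def)
  show "b_elem r l1 l2 i \<circ> weight_proj r l1 l2 = (b_elem r l1 l2 i :: 'a operator)"
    by (simp add: fun_eq_iff b_elem_apply weight_proj_def)
  fix p assume p: "p permutes {..<r}"
  have coeff: "b_coeff r l1 l2 i u (w \<circ> inv_into UNIV p) = b_coeff r l1 l2 i (u \<circ> p) w" for u w
    unfolding b_coeff_def perm_act_bvec[OF p, symmetric] b_rat_perm_act[OF p]
    by (simp add: perm_act_def)
  have "(\<Sum>w\<in>?B. v (w \<circ> p) * of_int (b_coeff r l1 l2 i u w)) =
      (\<Sum>w\<in>?B. v w * of_int (b_coeff r l1 l2 i (u \<circ> p) w))" for u and v :: "'a tensor"
  proof (rule sum.reindex_bij_witness[where i = "\<lambda>w. w \<circ> inv_into UNIV p" and j = "\<lambda>w. w \<circ> p"])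
    fix w assume w: "w \<in> ?B"
    show eq: "w \<circ> p \<circ> inv_into UNIV p = w"
      using permutes_inv_o(1)[OF p] by (simp add: comp_assoc)
    show "w \<circ> p \<in> ?B" using w weight_words_comp_iff[OF p] by blast
    show "v (w \<circ> p) * of_int (b_coeff r l1 l2 i (u \<circ> p) (w \<circ> p)) =
        v (w \<circ> p) * of_int (b_coeff r l1 l2 i u w)"
      using coeff[of u "w \<circ> p"] eq by simp
  next
    fix w assume w: "w \<in> ?B"
    show "w \<circ> inv_into UNIV p \<circ> p = w"
      using permutes_inv_o(2)[OF p] by (simp add: comp_assoc)
    show "w \<circ> inv_into UNIV p \<in> ?B"
      using w weight_words_comp_iff[OF permutes_inv[OF p]] by blast
  qed
  then show "b_elem r l1 l2 i \<circ> perm_act p = perm_act p \<circ> (b_elem r l1 l2 i :: 'a operator)"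
    by (simp add: fun_eq_iff b_elem_apply perm_act_def)
qed

end

theory Submission
  imports Defs
begin

text \<open>
  Index words of weight \<open>\<lambda>\<close> by the set of positions of the letter \<open>2\<close>. The entry of \<open>b(i)\<close> at \<open>(U, W)\<close>
  counts the subsets of \<open>U \<inter> W\<close> with \<open>\<lambda>\<^sub>2 - i\<close> elements, and double counting gives
  \<open>b(i) b(j) = \<Sum>\<^sub>k ((m + i + j) choose (i + j - k)) (k choose i) (k choose j) b(k)\<close>. By Lucas' theorem,
  modulo two \<open>b(i)\<close> is the product of the \<open>b(2\<^sup>u)\<close> over the binary digits \<open>u\<close> of \<open>i\<close>, and
  \<open>b(2\<^sup>u)\<^sup>2 = b(2\<^sup>u) (m\<^sub>u + D\<^sub>u)\<close>, where \<open>D\<^sub>u\<close> obeys the recursion of a binary carry. On the product of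
  the factors of \<open>e\<^bsub>m,g\<^esub>\<close> for digits below \<open>u\<close>, \<open>D\<^sub>u\<close> acts as the carry into place \<open>u\<close> of \<open>m + g\<close>, which
  makes \<open>e = e\<^bsub>m,g\<^esub>\<close> idempotent and each \<open>e b(i)\<close> either equal to \<open>e\<close> or of square zero. Since the \<open>b(i)\<close>
  span \<open>S\<^sub>K(\<lambda>)\<close>, squaring shows that \<open>e \<pi>\<close> is a scalar multiple of \<open>e\<close> for every idempotent \<open>\<pi>\<close>.

  Let \<open>\<pi>\<close> be a projection onto a copy of \<open>Y\<^sup>\<mu>\<close>. An equivariant map sends a polytabloid of shape \<open>\<mu>\<close> to a
  multiple of a vector \<open>z\<close>, the indicator of the words with exactly one \<open>2\<close> in every column of length two.
  As \<open>Y\<^sup>\<mu>\<close> contains the polytabloid, \<open>z\<close> lies in the image of \<open>\<pi>\<close>, and going forth and back multiplies the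
  polytabloid by a multiple of \<open>(m + 2 g) choose g\<close>, which is therefore odd. Finally
  \<open>b(i) z = (g choose i) ((m + g + i) choose i) z\<close> yields \<open>e z = z\<close>, so \<open>e \<pi> = e \<noteq> 0\<close>, and \<open>e = \<pi>\<close> because
  \<open>Y\<^sup>\<mu>\<close> is indecomposable.
\<close>

section \<open>Binomial coefficients modulo two\<close>

text \<open>Modulo two, \<open>(1 + x)^(2 n)\<close> is \<open>(1 + x^2)^n\<close>. In the
  induction, Pascal's rule applied twice produces a middle term with the factor two, which drops
  out.\<close>

lemma odd_choose_even_row:
  "odd ((2 * n) choose k) \<longleftrightarrow> even k \<and> odd (n choose (k div 2))"
proof (induction n arbitrary: k)
  case 0
  show ?case
    proof (cases "k < 2")
    case True
    then have "k = 0 \<or> k = 1" by auto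
    then show ?thesis by auto
  qed (simp add: binomial_eq_0)
next
  case (Suc n)
  show ?case
  proof (cases "k < 2")
    case True
    then have "k = 0 \<or> k = 1" by auto
    then show ?thesis by auto
  next
    case False
    then obtain j where j: "k = Suc (Suc j)" by (metis add_2_eq_Suc le_Suc_ex not_less)
    have "(2 * Suc n) choose k = (2 * n choose k) + 2 * (2 * n choose Suc j) + (2 * n choose j)"
      by (simp add: j)
    then have "odd ((2 * Suc n) choose k) \<longleftrightarrow> odd (2 * n choose k) \<noteq> odd (2 * n choose j)" by simp
    then show ?thesis by (auto simp: Suc.IH j)
  qed
qed

lemma odd_choose_div_2:
  "odd (n choose k) \<longleftrightarrow> (odd k \<longrightarrow> odd n) \<and> odd ((n div 2) choose (k div 2))"
proof (cases "even n")
  case True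
  then show ?thesis using odd_choose_even_row[of "n div 2" k] by auto
next
  case False
  then obtain a where a: "n = Suc (2 * a)" by (metis oddE Suc_eq_plus1)
  show ?thesis
  proof (cases k)
    case (Suc j)
    then have "odd (n choose k) \<longleftrightarrow> odd (2 * a choose k) \<noteq> odd (2 * a choose j)"
      by (simp add: a) blast
    then show ?thesis unfolding odd_choose_even_row using Suc a by auto
  qed (simp add: a)
qed

text \<open>Lucas' theorem for the prime two, obtained by removing the lowest binary digit of both
  arguments.\<close>

lemma odd_choose_iff_bit:
  "odd (n choose k) \<longleftrightarrow> (\<forall>u. bit k u \<longrightarrow> bit n u)"
proof (induction k arbitrary: n rule: less_induct)
  case (less k)
  show ?case
  proof (cases "k = 0")
    case False
    then have "odd (n choose k) \<longleftrightarrow>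
        (bit k 0 \<longrightarrow> bit n 0) \<and> (\<forall>u. bit k (Suc u) \<longrightarrow> bit n (Suc u))"
      unfolding odd_choose_div_2[of n k] using less.IH[of "k div 2" "n div 2"]
      by (simp add: bit_0 bit_Suc)
    also have "\<dots> \<longleftrightarrow> (\<forall>u. bit k u \<longrightarrow> bit n u)"
      by (metis not0_implies_Suc)
    finally show ?thesis .
  qed simp
qed

lemma odd_choose_power_2: "odd (n choose (2 ^ u)) \<longleftrightarrow> bit n u"
  by (auto simp: odd_choose_iff_bit bit_exp_iff)

lemma bit_add_power_2_nat:
  fixes j :: nat assumes "j < 2 ^ u"
  shows "bit (2 ^ u + j) v \<longleftrightarrow> v = u \<or> bit j v"
proof -
  have z: "\<not> bit j u"  using assms by (simp add: bit_iff_odd)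
  have "2 ^ u + j = or (2 ^ u) j"
  proof (rule disjunctive_add_eq_or)
    show "and (2 ^ u) j = 0" using z by (intro bit_eqI) (auto simp: bit_and_iff bit_exp_iff)
  qed
  then show ?thesis by (auto simp: bit_or_iff bit_exp_iff)
qed

section \<open>Binary carries\<close>

definition carry :: "nat \<Rightarrow> nat \<Rightarrow> nat \<Rightarrow> bool" where
  "carry a b u \<longleftrightarrow> a mod 2 ^ u + b mod 2 ^ u \<ge> 2 ^ u"

lemma carry_0 [simp]: "\<not> carry a b 0"
  by (simp add: carry_def)

lemma mod_power_2_Suc: "(a::nat) mod 2 ^ Suc u = of_bool (bit a u) * 2 ^ u + a mod 2 ^ u"
  by (simp add: bit_iff_odd mod2_eq_if mod_mult2_eq power_Suc2 del: power_Suc)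

text \<open>Two equal digits decide the outgoing carry whatever comes in; two different digits pass
  the incoming carry on. The ring elements \<open>D u\<close> below obey a recursion of the same
  shape.\<close>

lemma carry_Suc:
  "carry a b (Suc u) \<longleftrightarrow>
     (if bit a u = bit b u then bit a u else carry a b u)"
proof -
  have "2 * p \<le> of_bool A * p + x + (of_bool B * p + y) \<longleftrightarrow> (if A = B then A else p \<le> x + y)"
    if "x < p" "y < p" for A B and x y p :: nat
    using that by (cases A; cases B) auto
  from this[of "a mod 2 ^ u" "2 ^ u" "b mod 2 ^ u" "bit a u" "bit b u"] show ?thesis
    unfolding carry_def mod_power_2_Suc unfolding power_Suc by simp
qed

lemma bit_add_carry: "bit (a + b) u \<longleftrightarrow> ((bit a u \<noteq> bit b u) \<noteq> carry a b u)" for a b :: nat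
proof -
  have "(x + y) div p = of_bool (p \<le> x + y)" if "x < p" "y < p" for x y p :: nat
    using that by (cases "p \<le> x + y") (simp_all add: le_div_geq)
  then have "(a mod 2 ^ u + b mod 2 ^ u) div 2 ^ u = of_bool (carry a b u)"
    unfolding carry_def by simp
  then have "(a + b) div 2 ^ u = a div 2 ^ u + b div 2 ^ u + of_bool (carry a b u)"
    by (simp add: div_add1_eq[of a b])
  then show ?thesis by (auto simp: bit_iff_odd)
qed

lemma bit_add_disjoint:
  fixes a b :: nat assumes "\<And>u. \<not> (bit a u \<and> bit b u)"
  shows "bit (a + b) u \<longleftrightarrow> bit a u \<or> bit b u"
proof -
  have "\<not> carry a b u" for u using assms by (induction u) (auto simp: carry_Suc)
  then show ?thesis using assms by (auto simp: bit_add_carry)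
qed

text \<open>One direction of Kummer's theorem. As long as no carry has arrived at place
  \<open>v\<close>, two digits one there would give the sum the digit zero, although
  \<open>b\<close> has a one. So no carry ever starts.\<close>

lemma odd_choose_disjoint:
  assumes "odd ((a + b) choose b)"
  shows "\<not> (bit a u \<and> bit b u)"
proof -
  have sub: "bit b v \<Longrightarrow> bit (a + b) v" for v using assms by (simp add: odd_choose_iff_bit)
  have "\<not> carry a b v" for v
  proof (induction v)
    case (Suc v)
    then show ?case using sub[of v] by (auto simp: carry_Suc bit_add_carry)
  qed simp
  then show ?thesis using sub[of u] by (auto simp: bit_add_carry)
qed

section \<open>Counting subsets\<close>

lemma card_subsets_between:
  assumes "finite B" "A \<subseteq> B"
  shows "card {X. A \<subseteq> X \<and> X \<subseteq> B \<and> card X = l} =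
    (if card A \<le> l then (card B - card A) choose (l - card A) else 0)"
proof (cases "card A \<le> l")
  case True
  have fin: "finite A" using assms finite_subset by blast
  have "card {X. A \<subseteq> X \<and> X \<subseteq> B \<and> card X = l} = card {P. P \<subseteq> B - A \<and> card P = l - card A}"
  proof (rule bij_betw_same_card[of "\<lambda>X. X - A"], rule bij_betwI[where g = "\<lambda>P. P \<union> A"])
    show "(\<lambda>X. X - A) \<in> {X. A \<subseteq> X \<and> X \<subseteq> B \<and> card X = l} \<rightarrow> {P. P \<subseteq> B - A \<and> card P = l - card A}"
      using fin by (auto simp: card_Diff_subset)
    have "card (P \<union> A) = l" if "P \<subseteq> B - A" "card P = l - card A" for P
      using that True fin finite_subset[of P "B - A"] assms by (subst card_Un_disjoint) auto
    then show "(\<lambda>P. P \<union> A) \<in> {P. P \<subseteq> B - A \<and> card P = l - card A} \<rightarrow> {X. A \<subseteq> X \<and> X \<subseteq> B \<and> card X = l}"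
      using assms by auto
  qed auto
  also have "\<dots> = (card B - card A) choose (l - card A)"
    using assms fin by (subst n_subsets) (auto simp: card_Diff_subset)
  finally show ?thesis using True by simp
next
  case False
  have "card A \<le> card X" if "A \<subseteq> X" "X \<subseteq> B" for X
    using that assms finite_subset by (intro card_mono) auto
  then have "{X. A \<subseteq> X \<and> X \<subseteq> B \<and> card X = l} = {}" using False by blast
  then have "card {X. A \<subseteq> X \<and> X \<subseteq> B \<and> card X = l} = 0" by (simp only: card.empty)
  then show ?thesis using False by simp
qed

text \<open>The equation \<open>card Z + i = l\<close>, rather than \<open>card Z = l - i\<close>,
  makes the count zero for \<open>i > l\<close>, in agreement with \<open>b(i) = 0\<close>
  there.\<close>

definition meet_count :: "nat \<Rightarrow> nat \<Rightarrow> 'a set \<Rightarrow> 'a set \<Rightarrow> nat" where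
  "meet_count l i U W = card {Z. Z \<subseteq> U \<inter> W \<and> card Z + i = l}"

lemma meet_count_choose:
  assumes "finite U"
  shows "meet_count l i U W = (if i \<le> l then card (U \<inter> W) choose (l - i) else 0)"
proof (cases "i \<le> l")
  case True
  then have "{Z. Z \<subseteq> U \<inter> W \<and> card Z + i = l} = {Z. Z \<subseteq> U \<inter> W \<and> card Z = l - i}" by auto
  then show ?thesis using True assms n_subsets[of "U \<inter> W" "l - i"] by (simp add: meet_count_def)
next
  case False
  then show ?thesis by (simp add: meet_count_def)
qed

lemma meet_count_0:
  assumes "finite U" "card U = l" "finite W" "card W = l"
  shows "meet_count l 0 U W = of_bool (U = W)"
proof -
  have le: "card (U \<inter> W) \<le> l" using assms card_mono[of U "U \<inter> W"] by auto
  show ?thesis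
  proof (cases "U = W")
    case False
    have "card (U \<inter> W) \<noteq> l"
      using False assms card_subset_eq[of U "U \<inter> W"] card_subset_eq[of W "U \<inter> W"] by auto
    then show ?thesis using False le assms by (simp add: meet_count_choose binomial_eq_0)
  qed (simp add: meet_count_choose assms)
qed

text \<open>The index set on the right depends on \<open>U\<close> alone, which permits exchanging
  this sum with a sum over the second set.\<close>

lemma meet_count_sum:
  assumes "finite U" "finite W"
  shows "meet_count l i U W = (\<Sum>P | P \<subseteq> U \<and> card P + i = l. of_bool (P \<subseteq> W))"
proof -
  have "{P. P \<subseteq> U \<and> card P + i = l} \<inter> {P. P \<subseteq> W} = {Z. Z \<subseteq> U \<inter> W \<and> card Z + i = l}" by auto
  moreover have "finite {P. P \<subseteq> U \<and> card P + i = l}" using assms by simp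
  ultimately show ?thesis by (simp add: meet_count_def of_bool_def sum.If_cases)
qed

text \<open>With \<open>x = card (P \<inter> Q)\<close>, a superset adds
  \<open>x + i + j - l\<close> elements, chosen from the \<open>x + (m + i + j)\<close> elements
  outside \<open>P \<union> Q\<close>. Vandermonde's identity splits this binomial coefficient, and
  the factors in \<open>x\<close> are the values of \<open>meet_count\<close>.\<close>

lemma card_supersets_Un:
  assumes fin: "finite S" and S: "card S = 2 * l + m" and PQ: "P \<subseteq> S" "Q \<subseteq> S"
    and i: "card P + i = l" and j: "card Q + j = l"
  shows "card {X. P \<union> Q \<subseteq> X \<and> X \<subseteq> S \<and> card X = l} =
    (\<Sum>k\<le>i + j. ((m + i + j) choose (i + j - k)) * meet_count l k P Q)"
proof -
  define x where "x = card (P \<inter> Q)"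
  have finP: "finite P" "finite Q" using PQ fin finite_subset by auto
  have un: "card (P \<union> Q) + x = card P + card Q"
    unfolding x_def using card_Un_Int[OF finP] by simp
  have x: "x \<le> card P" "x \<le> card Q" unfolding x_def using finP by (auto intro: card_mono)
  have rhs: "(\<Sum>k\<le>i + j. ((m + i + j) choose (i + j - k)) * meet_count l k P Q) =
      (\<Sum>k\<le>i + j. if k \<le> l then ((m + i + j) choose (i + j - k)) * (x choose (l - k)) else 0)"
    by (intro sum.cong refl) (simp add: meet_count_choose finP x_def)
  show ?thesis
  proof (cases "l \<le> x + i + j")
    case True
    have "card (P \<union> Q) \<le> l" using True un i j by linarith
    then have "card {X. P \<union> Q \<subseteq> X \<and> X \<subseteq> S \<and> card X = l} =
        (card S - card (P \<union> Q)) choose (l - card (P \<union> Q))"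
      using card_subsets_between[OF fin, of "P \<union> Q" l] PQ by simp
    also have "card S - card (P \<union> Q) = x + (m + i + j)" using un i j S by linarith
    also have "l - card (P \<union> Q) = x + i + j - l" using un i j True by linarith
    also have "(x + (m + i + j)) choose (x + i + j - l) =
        (\<Sum>k\<le>x + i + j - l. (x choose k) * ((m + i + j) choose (x + i + j - l - k)))"
      by (rule vandermonde[symmetric])
    also have "\<dots> = (\<Sum>k\<in>{k. k \<le> x + i + j - l \<and> k \<le> x}. (x choose k) * ((m + i + j) choose (x + i + j - l - k)))"
      by (rule sum.mono_neutral_right) auto
    also have "\<dots> = (\<Sum>k\<in>{k. k \<le> i + j \<and> l \<le> k + x \<and> k \<le> l}. ((m + i + j) choose (i + j - k)) * (x choose (l - k)))"
    \<comment> \<open>The index \<open>k\<close> of Vandermonde's sum becomes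
      \<open>k + l - x\<close>, after \<open>x choose k\<close> is replaced by
      \<open>x choose (x - k)\<close>.\<close>
    proof (rule sum.reindex_bij_witness[where i = "\<lambda>k. k + x - l" and j = "\<lambda>k. k + l - x"])
      fix k assume "k \<in> {k. k \<le> x + i + j - l \<and> k \<le> x}"
      then have k: "k \<le> x + i + j - l" "k \<le> x" by auto
      have e: "i + j - (k + l - x) = x + i + j - l - k" "l - (k + l - x) = x - k"
        using k True x i by linarith+
      show "((m + i + j) choose (i + j - (k + l - x))) * (x choose (l - (k + l - x))) =
          (x choose k) * ((m + i + j) choose (x + i + j - l - k))"
        unfolding e using binomial_symmetric[OF k(2)] by simp
      show "k + l - x + x - l = k" using k x i by linarith
      show "k + l - x \<in> {k. k \<le> i + j \<and> l \<le> k + x \<and> k \<le> l}"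
        using k x i True by auto
    next
      fix k assume "k \<in> {k. k \<le> i + j \<and> l \<le> k + x \<and> k \<le> l}"
      then show "k + x - l + l - x = k" "k + x - l \<in> {k. k \<le> x + i + j - l \<and> k \<le> x}"
        using x i by auto
    qed
    also have "\<dots> = (\<Sum>k\<le>i + j. ((m + i + j) choose (i + j - k)) * meet_count l k P Q)"
      unfolding rhs by (rule sum.mono_neutral_cong_left) (auto simp: not_le binomial_eq_0)
    finally show ?thesis .
  next
    case False
    then have "\<not> card (P \<union> Q) \<le> l" using un i j by linarith
    then have "card {X. P \<union> Q \<subseteq> X \<and> X \<subseteq> S \<and> card X = l} = 0"
      using card_subsets_between[OF fin, of "P \<union> Q" l] PQ by simp
    moreover have "(\<Sum>k\<le>i + j. if k \<le> l then ((m + i + j) choose (i + j - k)) * (x choose (l - k)) else 0) = 0"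
      using False by (intro sum.neutral ballI) (auto simp: binomial_eq_0)
    ultimately show ?thesis unfolding rhs by simp
  qed
qed

text \<open>Expand the two entries over subsets \<open>P\<close> of \<open>U\<close> and
  \<open>Q\<close> of \<open>W\<close>. Summing over \<open>X\<close> counts the common supersets of
  \<open>P\<close> and \<open>Q\<close>, and \<open>card_supersets_Un\<close> turns this into counts
  of sets \<open>Z \<subseteq> P \<inter> Q\<close>. Summing over \<open>P\<close> and
  \<open>Q\<close> before \<open>Z\<close> gives the two remaining binomial coefficients.\<close>

lemma meet_count_mult:
  assumes fin: "finite S" and S: "card S = 2 * l + m"
    and U: "U \<subseteq> S" "card U = l" and W: "W \<subseteq> S" "card W = l"
  shows "(\<Sum>X | X \<subseteq> S \<and> card X = l. meet_count l i U X * meet_count l j X W) =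
    (\<Sum>k\<le>i + j. ((m + i + j) choose (i + j - k)) * (k choose i) * (k choose j) * meet_count l k U W)"
    (is "?L = ?R")
proof -
  have finU: "finite U" "finite W" using U W fin finite_subset by auto
  define \<P> where "\<P> = {P. P \<subseteq> U \<and> card P + i = l}"
  define \<Q> where "\<Q> = {P. P \<subseteq> W \<and> card P + j = l}"
  have finP: "finite \<P>" "finite \<Q>" using finU by (auto simp: \<P>_def \<Q>_def)
  have [simp]: "finite X" if "X \<subseteq> S" for X using that fin finite_subset by auto
  have comm: "meet_count l j X W = meet_count l j W X" for X by (simp add: meet_count_def Int_commute)
  have "?L = (\<Sum>X | X \<subseteq> S \<and> card X = l. \<Sum>P\<in>\<P>. \<Sum>Q\<in>\<Q>. of_bool (P \<union> Q \<subseteq> X))"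
    unfolding comm
    by (intro sum.cong refl)
      (simp add: meet_count_sum finU sum_product \<P>_def \<Q>_def of_bool_conj del: sum_of_bool_eq)
  also have "\<dots> = (\<Sum>P\<in>\<P>. \<Sum>X | X \<subseteq> S \<and> card X = l. \<Sum>Q\<in>\<Q>. of_bool (P \<union> Q \<subseteq> X))"
    by (rule sum.swap)
  also have "\<dots> = (\<Sum>P\<in>\<P>. \<Sum>Q\<in>\<Q>. \<Sum>X | X \<subseteq> S \<and> card X = l. of_bool (P \<union> Q \<subseteq> X))"
    by (intro sum.cong refl sum.swap)
  also have "\<dots> = (\<Sum>P\<in>\<P>. \<Sum>Q\<in>\<Q>. \<Sum>k\<le>i + j. ((m + i + j) choose (i + j - k)) * meet_count l k P Q)"
  proof (intro sum.cong refl)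
    fix P Q assume PQ: "P \<in> \<P>" "Q \<in> \<Q>"
    have "(\<Sum>X | X \<subseteq> S \<and> card X = l. of_bool (P \<union> Q \<subseteq> X)) =
        card ({X. X \<subseteq> S \<and> card X = l} \<inter> {X. P \<union> Q \<subseteq> X})"
      using fin by (simp add: of_bool_def sum.If_cases del: Un_subset_iff)
    also have "{X. X \<subseteq> S \<and> card X = l} \<inter> {X. P \<union> Q \<subseteq> X} = {X. P \<union> Q \<subseteq> X \<and> X \<subseteq> S \<and> card X = l}"
      by auto
    finally show "(\<Sum>X | X \<subseteq> S \<and> card X = l. of_bool (P \<union> Q \<subseteq> X)) =
        (\<Sum>k\<le>i + j. ((m + i + j) choose (i + j - k)) * meet_count l k P Q)"
      using PQ U W card_supersets_Un[OF fin S, of P Q i j]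
      by (simp add: \<P>_def \<Q>_def del: Un_subset_iff) blast
  qed
  also have "\<dots> = (\<Sum>P\<in>\<P>. \<Sum>k\<le>i + j. \<Sum>Q\<in>\<Q>. ((m + i + j) choose (i + j - k)) * meet_count l k P Q)"
    by (intro sum.cong refl sum.swap)
  also have "\<dots> = (\<Sum>k\<le>i + j. \<Sum>P\<in>\<P>. \<Sum>Q\<in>\<Q>. ((m + i + j) choose (i + j - k)) * meet_count l k P Q)"
    by (rule sum.swap)
  also have "\<dots> = ?R"
  proof (intro sum.cong refl)
    fix k assume "k \<in> {..i + j}"
    define \<Z> where "\<Z> = {Z. Z \<subseteq> U \<inter> W \<and> card Z + k = l}"
    have finZ: "finite \<Z>" using finU by (simp add: \<Z>_def)
    \<comment> \<open>Such a \<open>P\<close> omits \<open>a\<close> elements of \<open>V\<close>,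
      all of them among the \<open>k\<close> elements of \<open>V - Z\<close>.\<close>
    have between: "(\<Sum>P | P \<subseteq> V \<and> card P + a = l. of_bool (Z \<subseteq> P)) = k choose a"
      if "Z \<in> \<Z>" "V = U \<or> V = W" for Z a V
    proof -
      have Z: "Z \<subseteq> V" "card Z + k = l" "finite V" "card V = l"
        using that finU U W by (auto simp: \<Z>_def)
      show ?thesis
      proof (cases "a \<le> l")
        case True
        have "(\<Sum>P | P \<subseteq> V \<and> card P + a = l. of_bool (Z \<subseteq> P)) =
            card ({P. P \<subseteq> V \<and> card P + a = l} \<inter> {P. Z \<subseteq> P})"
          using Z by (simp add: of_bool_def sum.If_cases)
        also have "{P. P \<subseteq> V \<and> card P + a = l} \<inter> {P. Z \<subseteq> P} = {P. Z \<subseteq> P \<and> P \<subseteq> V \<and> card P = l - a}"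
          using True by auto
        also have "card \<dots> = (if l - k \<le> l - a then k choose (k - a) else 0)"
        proof -
          have "card Z = l - k" "card V - card Z = k" "l - a - card Z = k - a" using Z True by linarith+
          then show ?thesis using card_subsets_between[of V Z "l - a"] Z by simp
        qed
        also have "\<dots> = k choose a"
          using Z True binomial_symmetric[of a k] by (cases "a \<le> k") auto
        finally show ?thesis .
      next
        case False
        then have "{P. P \<subseteq> V \<and> card P + a = l} = {}" by auto
        then show ?thesis using False Z by (simp add: binomial_eq_0)
      qed
    qed
    have "(\<Sum>P\<in>\<P>. \<Sum>Q\<in>\<Q>. meet_count l k P Q) = (\<Sum>P\<in>\<P>. \<Sum>Q\<in>\<Q>. \<Sum>Z\<in>\<Z>. of_bool (Z \<subseteq> P) * of_bool (Z \<subseteq> Q))"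
    proof (intro sum.cong refl)
      fix P Q assume PQ: "P \<in> \<P>" "Q \<in> \<Q>"
      have "(\<Sum>Z\<in>\<Z>. of_bool (Z \<subseteq> P) * of_bool (Z \<subseteq> Q)) = (\<Sum>Z\<in>\<Z>. of_bool (Z \<subseteq> P \<and> Z \<subseteq> Q) :: nat)"
        by (simp only: of_bool_conj)
      also have "\<dots> = card (\<Z> \<inter> {Z. Z \<subseteq> P \<and> Z \<subseteq> Q})"
        using finZ by simp
      also have "\<Z> \<inter> {Z. Z \<subseteq> P \<and> Z \<subseteq> Q} = {Z. Z \<subseteq> P \<inter> Q \<and> card Z + k = l}"
        using PQ by (auto simp: \<Z>_def \<P>_def \<Q>_def)
      finally show "meet_count l k P Q = (\<Sum>Z\<in>\<Z>. of_bool (Z \<subseteq> P) * of_bool (Z \<subseteq> Q))"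
        by (simp add: meet_count_def)
    qed
    also have "\<dots> = (\<Sum>P\<in>\<P>. \<Sum>Z\<in>\<Z>. \<Sum>Q\<in>\<Q>. of_bool (Z \<subseteq> P) * of_bool (Z \<subseteq> Q))"
      by (intro sum.cong refl sum.swap)
    also have "\<dots> = (\<Sum>Z\<in>\<Z>. \<Sum>P\<in>\<P>. \<Sum>Q\<in>\<Q>. of_bool (Z \<subseteq> P) * of_bool (Z \<subseteq> Q))"
      by (rule sum.swap)
    also have "\<dots> = (\<Sum>Z\<in>\<Z>. (k choose i) * (k choose j))"
      using between[of _ U i] between[of _ W j]
      by (intro sum.cong refl) (simp add: \<P>_def \<Q>_def flip: sum_product)
    also have "\<dots> = (k choose i) * (k choose j) * meet_count l k U W"
      by (simp add: \<Z>_def meet_count_def)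
    finally show "(\<Sum>P\<in>\<P>. \<Sum>Q\<in>\<Q>. ((m + i + j) choose (i + j - k)) * meet_count l k P Q) =
        ((m + i + j) choose (i + j - k)) * (k choose i) * (k choose j) * meet_count l k U W"
      by (simp flip: sum_distrib_left)
  qed
  finally show ?thesis .
qed

section \<open>Multiplication of the elements \<open>b(i)\<close>\<close>

definition twos :: "nat \<Rightarrow> word \<Rightarrow> nat set" where
  "twos r u = {p. p < r \<and> u p = 2}"

lemma finite_twos [simp]: "finite (twos r u)"
  by (simp add: twos_def)

lemma twos_subset: "twos r u \<subseteq> {..<r}"
  by (auto simp: twos_def)

lemma words_eq_iff:
  assumes "u \<in> words r" "w \<in> words r"
  shows "u = w \<longleftrightarrow> twos r u = twos r w"
proof
  assume eq: "twos r u = twos r w"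
  show "u = w"
  proof
    fix p show "u p = w p"
    proof (cases "p < r")
      case True
      then have "u p \<in> {1, 2}" "w p \<in> {1, 2}" using assms by (auto simp: words_def PiE_iff)
      moreover have "u p = 2 \<longleftrightarrow> w p = 2" using eq True by (auto simp: twos_def)
      ultimately show ?thesis by auto
    qed (use assms in \<open>auto simp: words_def PiE_iff extensional_def\<close>)
  qed
qed simp

lemma weight_words_iff:
  assumes "l1 + l2 = r"
  shows "u \<in> weight_words r l1 l2 \<longleftrightarrow> u \<in> words r \<and> card (twos r u) = l2"
proof -
  have "card {p. p < r \<and> u p = 1} + card (twos r u) = r" if "u \<in> words r"
  proof -
    have "{p. p < r \<and> u p = 1} \<union> twos r u = {..<r}"
      using that by (auto simp: words_def PiE_iff twos_def)
    moreover have "{p. p < r \<and> u p = 1} \<inter> twos r u = {}" by (auto simp: twos_def)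
    ultimately show ?thesis
      using card_Un_disjoint[of "{p. p < r \<and> u p = 1}" "twos r u"] by simp
  qed
  then show ?thesis
    using assms unfolding weight_words_def twos_def[symmetric] by auto
qed

definition word_of :: "nat \<Rightarrow> nat set \<Rightarrow> word" where
  "word_of r X = (\<lambda>p\<in>{..<r}. if p \<in> X then 2 else 1)"

lemma word_of_words [simp]: "word_of r X \<in> words r"
  by (auto simp: word_of_def words_def)

lemma twos_word_of: "X \<subseteq> {..<r} \<Longrightarrow> twos r (word_of r X) = X"
  by (auto simp: word_of_def twos_def)

lemma word_of_twos: "u \<in> words r \<Longrightarrow> word_of r (twos r u) = u"
  using words_eq_iff[of "word_of r (twos r u)" r u] twos_word_of[OF twos_subset] by simp

lemma bij_betw_twos:
  assumes "l1 + l2 = r"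
  shows "bij_betw (twos r) (weight_words r l1 l2) {X. X \<subseteq> {..<r} \<and> card X = l2}"
  by (rule bij_betwI[where g = "word_of r"])
    (auto simp: weight_words_iff[OF assms] twos_word_of word_of_twos dest: subsetD[OF twos_subset])

section \<open>Matrix entries of the elements \<open>b(i)\<close>\<close>

lemma div_power_apply:
  assumes "a \<in> {1, 2}" "b \<in> {1, 2}" "a \<noteq> b" "u \<in> words r"
  shows "div_power r a b i v u =
    (\<Sum>P | P \<subseteq> {p. p < r \<and> u p = a} \<and> card P = i. v (override_on u (\<lambda>_. b) P))"
  unfolding div_power_def scl_def gl_act_funpow[OF assms] by simp

lemma override_on_words:
  assumes "u \<in> words r" "P \<subseteq> {..<r}" "b \<in> {1, 2}"
  shows "override_on u (\<lambda>_. b) P \<in> words r"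
  using assms by (auto simp: words_def PiE_iff extensional_def override_on_def)

text \<open>The operator turns \<open>i\<close> letters 2 into 1, so the set of twos loses
  \<open>i\<close> elements. Read backwards from \<open>u\<close>, the only contributing set
  \<open>P\<close> is \<open>twos r w - twos r u\<close>.\<close>

lemma div_power_1_2_bvec:
  assumes u: "u \<in> words r" and w: "w \<in> words r"
  shows "div_power r 1 2 i (bvec w) u =
    of_bool (twos r u \<subseteq> twos r w \<and> card (twos r u) + i = card (twos r w))"
proof -
  let ?A = "{P. P \<subseteq> {p. p < r \<and> u p = 1} \<and> card P = i}"
  have "(override_on u (\<lambda>_. 2) P = w) \<longleftrightarrow> twos r u \<union> P = twos r w" if "P \<in> ?A" for P
  proof -
    have "twos r (override_on u (\<lambda>_. 2) P) = twos r u \<union> P"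
      using that by (auto simp: twos_def override_on_def)
    then show ?thesis
      using words_eq_iff[OF override_on_words[OF u, of P 2] w] that by auto
  qed
  then have "(\<Sum>P\<in>?A. bvec w (override_on u (\<lambda>_. 2) P)) = (\<Sum>P\<in>?A. of_bool (twos r u \<union> P = twos r w) :: rat)"
    by (intro sum.cong) (auto simp: bvec_def)
  moreover have "div_power r 1 2 i (bvec w) u = (\<Sum>P\<in>?A. bvec w (override_on u (\<lambda>_. 2) P))"
    by (rule div_power_apply) (use u in auto)
  ultimately have "div_power r 1 2 i (bvec w) u = (\<Sum>P\<in>?A. of_bool (twos r u \<union> P = twos r w))"
    by simp
  also have "\<dots> = of_nat (card (?A \<inter> {P. twos r u \<union> P = twos r w}))"
    by simp
  also have "?A \<inter> {P. twos r u \<union> P = twos r w} =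
      (if twos r u \<subseteq> twos r w \<and> card (twos r u) + i = card (twos r w) then {twos r w - twos r u} else {})"
  proof -
    have dis: "P \<inter> twos r u = {}" if "P \<in> ?A" for P using that by (auto simp: twos_def)
    have c: "card (twos r u) + i = card (twos r w)"
      if "P \<in> ?A" "twos r u \<union> P = twos r w" for P
    proof -
      have "finite P" by (rule finite_subset[of _ "twos r w"]) (use that in auto)
      then have "card (twos r u \<union> P) = card (twos r u) + card P"
        using dis[OF that(1)] by (intro card_Un_disjoint) auto
      then show ?thesis using that by simp
    qed
    have "twos r w - twos r u \<in> ?A"
      if "twos r u \<subseteq> twos r w" "card (twos r u) + i = card (twos r w)"
    proof -
      have "twos r w - twos r u \<subseteq> {p. p < r \<and> u p = 1}"
        using u by (auto simp: twos_def words_def PiE_iff)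
      then show ?thesis using that by (auto simp: card_Diff_subset)
    qed
    then show ?thesis using c dis by auto
  qed
  finally show ?thesis by (auto simp: of_bool_def)
qed

text \<open>A path from \<open>w\<close> to \<open>u\<close> passes through a word whose set of twos
  \<open>Z\<close> has \<open>l2 - i\<close> elements: \<open>e^(i)\<close> shrinks the twos of
  \<open>w\<close> to \<open>Z\<close>, and \<open>f^(i)\<close> enlarges \<open>Z\<close> to those
  of \<open>u\<close>.\<close>

lemma b_coeff_meet_count:
  assumes r: "l1 + l2 = r" and u: "u \<in> weight_words r l1 l2" and w: "w \<in> weight_words r l1 l2"
  shows "b_coeff r l1 l2 i u w = int (meet_count l2 i (twos r u) (twos r w))"
proof -
  have uw: "u \<in> words r" "w \<in> words r" "card (twos r u) = l2" "card (twos r w) = l2"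
    using u w by (auto simp: weight_words_iff[OF r])
  let ?A = "{P. P \<subseteq> twos r u \<and> card P = i}"
  have "weight_proj r l1 l2 (bvec w) = (bvec w :: rat tensor)"
    using w by (auto simp: weight_proj_def bvec_def)
  then have "b_rat r l1 l2 i (bvec w) u = div_power r 2 1 i (div_power r 1 2 i (bvec w)) u"
    using u by (simp add: b_rat_def weight_proj_def)
  also have "\<dots> = (\<Sum>P\<in>?A. div_power r 1 2 i (bvec w) (override_on u (\<lambda>_. 1) P))"
    unfolding twos_def by (rule div_power_apply) (use uw in auto)
  also have "\<dots> = (\<Sum>P\<in>?A. of_bool (twos r u - P \<subseteq> twos r w \<and> card (twos r u - P) + i = l2))"
  proof (intro sum.cong refl)
    fix P assume P: "P \<in> ?A"
    then have "twos r (override_on u (\<lambda>_. 1) P) = twos r u - P"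
      by (auto simp: twos_def override_on_def)
    moreover have "override_on u (\<lambda>_. 1) P \<in> words r"
      using P twos_subset[of r u] by (intro override_on_words uw) auto
    ultimately show "div_power r 1 2 i (bvec w) (override_on u (\<lambda>_. 1) P) =
        of_bool (twos r u - P \<subseteq> twos r w \<and> card (twos r u - P) + i = l2)"
      using div_power_1_2_bvec[OF _ uw(2), of _ i] uw by simp
  qed
  \<comment> \<open>The intermediate set \<open>Z = twos r u - P\<close> becomes the index; its size
    is right automatically.\<close>
  also have "\<dots> = (\<Sum>Z | Z \<subseteq> twos r u \<inter> twos r w \<and> card Z + i = l2. 1)"
  proof (rule sum.mono_neutral_cong_right[of _ "{P\<in>?A. twos r u - P \<subseteq> twos r w}", THEN trans])
    show "(\<Sum>P | P \<in> ?A \<and> twos r u - P \<subseteq> twos r w. 1) =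
        (\<Sum>Z | Z \<subseteq> twos r u \<inter> twos r w \<and> card Z + i = l2. 1)"
    proof (rule sum.reindex_bij_witness[where i = "\<lambda>Z. twos r u - Z" and j = "\<lambda>P. twos r u - P"])
      fix P assume P: "P \<in> {P \<in> ?A. twos r u - P \<subseteq> twos r w}"
      then show "twos r u - (twos r u - P) = P" by auto
      have "card P \<le> card (twos r u)" using P by (intro card_mono) auto
      then show "twos r u - P \<in> {Z. Z \<subseteq> twos r u \<inter> twos r w \<and> card Z + i = l2}"
        using P uw finite_subset[of P "twos r u"] by (auto simp: card_Diff_subset)
    next
      fix Z assume Z: "Z \<in> {Z. Z \<subseteq> twos r u \<inter> twos r w \<and> card Z + i = l2}"
      then show "twos r u - (twos r u - Z) = Z" by auto
      show "twos r u - Z \<in> {P \<in> ?A. twos r u - P \<subseteq> twos r w}"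
        using Z uw finite_subset[of Z "twos r u"] by (auto simp: card_Diff_subset)
    qed simp
    have "card (twos r u - P) + i = l2" if "P \<in> ?A" for P
      using that uw finite_subset[of P "twos r u"] card_mono[of "twos r u" P]
      by (auto simp: card_Diff_subset)
    then show "of_bool (twos r u - P \<subseteq> twos r w \<and> card (twos r u - P) + i = l2) = 1"
      if "P \<in> {P \<in> ?A. twos r u - P \<subseteq> twos r w}" for P
      using that by auto
  qed auto
  finally have "b_rat r l1 l2 i (bvec w) u = rat_of_nat (meet_count l2 i (twos r u) (twos r w))"
    by (simp add: meet_count_def)
  then show ?thesis by (simp add: b_coeff_def floor_of_nat)
qed

lemma b_elem_meet_count:
  assumes r: "l1 + l2 = r"
  shows "b_elem r l1 l2 i v u = (if u \<in> weight_words r l1 l2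
    then \<Sum>w\<in>weight_words r l1 l2. v w * of_nat (meet_count l2 i (twos r u) (twos r w)) else 0)"
proof -
  have "b_coeff r l1 l2 i u w = 0" if "u \<notin> weight_words r l1 l2" for w
    using that by (simp add: b_coeff_def b_rat_def weight_proj_def)
  then show ?thesis by (simp add: b_elem_apply b_coeff_meet_count[OF r])
qed

section \<open>The multiplication rule, over a field and modulo two\<close>

lemma b_elem_mult:
  fixes v :: "'k::field tensor"
  assumes r: "2 * l2 + m = r" "l1 = l2 + m"
  shows "b_elem r l1 l2 i (b_elem r l1 l2 j v) u =
    (\<Sum>k\<le>i + j. of_nat (((m + i + j) choose (i + j - k)) * (k choose i) * (k choose j)) * b_elem r l1 l2 k v u)"
proof (cases "u \<in> weight_words r l1 l2")
  case True
  let ?B = "weight_words r l1 l2"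
  have r': "l1 + l2 = r" using r by simp
  have B: "twos r w \<subseteq> {..<r}" "card (twos r w) = l2" if "w \<in> ?B" for w
    using that twos_subset by (auto simp: weight_words_iff[OF r'])
  let ?c = "\<lambda>k. ((m + i + j) choose (i + j - k)) * (k choose i) * (k choose j)"
  let ?n = "\<lambda>i u w. meet_count l2 i (twos r u) (twos r w)"
  have mult: "(\<Sum>x\<in>?B. ?n i u x * ?n j x w) = (\<Sum>k\<le>i + j. ?c k * ?n k u w)" if w: "w \<in> ?B" for w
  proof -
    have "(\<Sum>x\<in>?B. ?n i u x * ?n j x w) =
        (\<Sum>X | X \<subseteq> {..<r} \<and> card X = l2. meet_count l2 i (twos r u) X * meet_count l2 j X (twos r w))"
      by (rule sum.reindex_bij_betw[OF bij_betw_twos[OF r']])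
    also have "\<dots> = (\<Sum>k\<le>i + j. ?c k * ?n k u w)"
      by (rule meet_count_mult) (use B True w r in auto)
    finally show ?thesis .
  qed
  have "b_elem r l1 l2 i (b_elem r l1 l2 j v) u =
      (\<Sum>x\<in>?B. \<Sum>w\<in>?B. v w * (of_nat (?n i u x * ?n j x w)))"
    using True by (simp add: b_elem_meet_count[OF r'] sum_distrib_left mult_ac)
  also have "\<dots> = (\<Sum>w\<in>?B. v w * of_nat (\<Sum>x\<in>?B. ?n i u x * ?n j x w))"
    by (subst sum.swap) (simp add: sum_distrib_left)
  also have "\<dots> = (\<Sum>w\<in>?B. \<Sum>k\<le>i + j. v w * of_nat (?c k * ?n k u w))"
    using mult by (simp add: sum_distrib_left)
  also have "\<dots> = (\<Sum>k\<le>i + j. of_nat (?c k) * b_elem r l1 l2 k v u)"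
    using True by (subst sum.swap) (simp add: b_elem_meet_count[OF r'] sum_distrib_left mult_ac)
  finally show ?thesis .
qed (use r in \<open>simp add: b_elem_meet_count\<close>)

lemma b_elem_0:
  assumes r: "l1 + l2 = r"
  shows "b_elem r l1 l2 0 = weight_proj r l1 l2"
proof (intro ext)
  fix v :: "'k::field tensor" and u
  have "meet_count l2 0 (twos r u) (twos r w) = of_bool (u = w)"
    if "u \<in> weight_words r l1 l2" "w \<in> weight_words r l1 l2" for w
    using that words_eq_iff[of u r w] by (simp add: weight_words_iff[OF r] meet_count_0)
  then have "(\<Sum>w\<in>weight_words r l1 l2. v w * of_nat (meet_count l2 0 (twos r u) (twos r w))) =
      (\<Sum>w\<in>weight_words r l1 l2. if w = u then v w else 0)" if "u \<in> weight_words r l1 l2"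
    using that by (intro sum.cong) auto
  then show "b_elem r l1 l2 0 v u = weight_proj r l1 l2 v u"
    by (simp add: b_elem_meet_count[OF r] weight_proj_def)
qed

lemma of_nat_char_2:
  assumes "CHAR('k::field) = 2"
  shows "(of_nat n :: 'k) = of_bool (odd n)"
proof -
  have "(2::'k) = 0" using of_nat_CHAR[where 'a = 'k] assms by simp
  then show ?thesis by (cases "even n") (auto elim!: evenE oddE)
qed

lemma b_elem_mult_char_2:
  assumes char: "CHAR('k::field) = 2" and r: "2 * l2 + m = r" "l1 = l2 + m"
  shows "(b_elem r l1 l2 i \<circ> b_elem r l1 l2 j :: 'k operator) =
    (\<Sum>k | k \<le> i + j \<and> odd ((m + i + j) choose (i + j - k)) \<and> odd (k choose i) \<and> odd (k choose j).
       b_elem r l1 l2 k)"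
proof (intro ext)
  fix v :: "'k tensor" and u
  let ?c = "\<lambda>k. ((m + i + j) choose (i + j - k)) * (k choose i) * (k choose j)"
  have "(b_elem r l1 l2 i \<circ> b_elem r l1 l2 j) v u = (\<Sum>k\<le>i + j. of_bool (odd (?c k)) * b_elem r l1 l2 k v u)"
    by (simp only: comp_apply b_elem_mult[OF r] of_nat_char_2[OF char])
  also have "\<dots> = (\<Sum>k | k \<le> i + j \<and> odd ((m + i + j) choose (i + j - k)) \<and> odd (k choose i) \<and> odd (k choose j).
       b_elem r l1 l2 k v u)"
    by (rule sum.mono_neutral_cong_right) auto
  finally show "(b_elem r l1 l2 i \<circ> b_elem r l1 l2 j) v u = (\<Sum>k | k \<le> i + j \<and>
      odd ((m + i + j) choose (i + j - k)) \<and> odd (k choose i) \<and> odd (k choose j). b_elem r l1 l2 k) v u"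
    by (simp add: fun_sum_apply)
qed

text \<open>As all digits of \<open>j\<close> lie below \<open>u\<close>, Lucas' theorem merges the
  last two conditions on \<open>k\<close> into \<open>odd (k choose (2 ^ u + j))\<close>. This
  forces \<open>k \<ge> 2 ^ u + j\<close>, while the sum stops at that value.\<close>

lemma b_elem_power_2_mult:
  assumes char: "CHAR('k::field) = 2" and r: "2 * l2 + m = r" "l1 = l2 + m" and j: "j < 2 ^ u"
  shows "(b_elem r l1 l2 (2 ^ u) \<circ> b_elem r l1 l2 j :: 'k operator) = b_elem r l1 l2 (2 ^ u + j)"
proof -
  have "odd (k choose (2 ^ u)) \<and> odd (k choose j) \<longleftrightarrow> odd (k choose (2 ^ u + j))" for k
    by (auto simp: odd_choose_iff_bit bit_add_power_2_nat[OF j] bit_exp_iff)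
  moreover have "2 ^ u + j \<le> k" if "odd (k choose (2 ^ u + j))" for k
    using that by (metis binomial_eq_0 even_zero not_le)
  ultimately have "{k. k \<le> 2 ^ u + j \<and> odd ((m + 2 ^ u + j) choose (2 ^ u + j - k)) \<and>
      odd (k choose (2 ^ u)) \<and> odd (k choose j)} = {2 ^ u + j}"
    by (auto intro: antisym)
  then show ?thesis unfolding b_elem_mult_char_2[OF char r] by simp
qed

text \<open>The index is replaced by \<open>s = 2 ^ Suc u - k\<close>. For
  \<open>k \<le> 2 ^ Suc u\<close>, the coefficient \<open>k choose 2 ^ u\<close> is odd if and only
  if \<open>2 ^ u \<le> k < 2 ^ Suc u\<close>. In the other coefficient the added
  \<open>2 ^ Suc u\<close> lies above every digit of an \<open>s \<le> 2 ^ u\<close>, so only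
  \<open>m choose s\<close> remains.\<close>

lemma b_elem_power_2_square:
  assumes char: "CHAR('k::field) = 2" and r: "2 * l2 + m = r" "l1 = l2 + m"
  shows "(b_elem r l1 l2 (2 ^ u) \<circ> b_elem r l1 l2 (2 ^ u) :: 'k operator) =
    (\<Sum>s | 1 \<le> s \<and> s \<le> 2 ^ u \<and> odd (m choose s). b_elem r l1 l2 (2 ^ Suc u - s))"
proof -
  have low: "bit (m + 2 ^ Suc u) v = bit m v" if "v \<le> u" for v
  proof -
    have "\<not> carry m (2 ^ Suc u) w" if "w \<le> Suc u" for w
      using that by (induction w) (auto simp: carry_Suc bit_exp_iff simp del: power_Suc)
    then show ?thesis using that by (simp add: bit_add_carry bit_exp_iff del: power_Suc)
  qed
  have bits: "v \<le> u" if "s \<le> 2 ^ u" "bit s v" for s v :: nat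
  proof (rule ccontr)
    assume "\<not> v \<le> u"
    then have "2 ^ u < (2::nat) ^ v" by simp
    then have "s < 2 ^ v" using that(1) by linarith
    then show False using that(2) by (simp add: bit_iff_odd)
  qed
  have C: "odd ((m + 2 ^ u + 2 ^ u) choose s) \<longleftrightarrow> odd (m choose s)" if "s \<le> 2 ^ u" for s
  proof -
    have "m + 2 ^ u + 2 ^ u = m + 2 ^ Suc u" by simp
    then show ?thesis using low bits[OF that] unfolding odd_choose_iff_bit by metis
  qed
  have k: "odd (k choose (2 ^ u)) \<longleftrightarrow> 2 ^ u \<le> k \<and> k < 2 ^ Suc u" if "k \<le> 2 ^ Suc u" for k
  proof -
    have "odd (k div 2 ^ u) \<longleftrightarrow> 2 ^ u \<le> k \<and> k < 2 * 2 ^ u"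
    proof (cases "k < 2 ^ u")
      case False
      then have "k div 2 ^ u = Suc ((k - 2 ^ u) div 2 ^ u)" by (simp add: le_div_geq)
      then show ?thesis using False that by (cases "k = 2 * 2 ^ u") auto
    qed simp
    then show ?thesis by (simp add: odd_choose_power_2 bit_iff_odd)
  qed
  have "(\<Sum>k | k \<le> 2 ^ u + 2 ^ u \<and> odd ((m + 2 ^ u + 2 ^ u) choose (2 ^ u + 2 ^ u - k)) \<and> odd (k choose 2 ^ u) \<and>
       odd (k choose 2 ^ u). b_elem r l1 l2 k :: 'k operator) =
    (\<Sum>s | 1 \<le> s \<and> s \<le> 2 ^ u \<and> odd (m choose s). b_elem r l1 l2 (2 ^ Suc u - s))"
    by (rule sum.reindex_bij_witness[where i = "\<lambda>s. 2 ^ Suc u - s" and j = "\<lambda>k. 2 ^ Suc u - k"])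
      (use C k in \<open>auto simp flip: mult_2\<close>)
  then show ?thesis unfolding b_elem_mult_char_2[OF char r] .
qed

section \<open>Idempotents from carries\<close>

context cring
begin

text \<open>In the application, \<open>a u\<close> is \<open>b(2^u)\<close> and \<open>D u\<close>
  is \<open>carry_elem u\<close>; \<open>disjoint\<close> comes from the odd binomial
  coefficient.\<close>

context
  fixes a D :: "nat \<Rightarrow> 'a" and m g :: nat
  assumes char_2: "\<And>x. x \<in> carrier R \<Longrightarrow> x \<oplus> x = \<zero>"
    and a: "\<And>u. a u \<in> carrier R" and D: "\<And>u. D u \<in> carrier R"
    and D_0: "D 0 = \<zero>"
    and D_Suc: "\<And>u. D (Suc u) = a u \<otimes> a u \<oplus> (if bit m u then D u else \<zero>)"
    and square: "\<And>u. a u \<otimes> a u = a u \<otimes> (D u \<oplus> (if bit m u then \<one> else \<zero>))"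
    and disjoint: "\<And>u. \<not> (bit (m + g) u \<and> bit g u)"
begin

text \<open>Since \<open>g\<close> and \<open>m + g\<close> share no digit, \<open>m + 2 * g\<close>
  has exactly their digits together. So this is the factor of \<open>e_elem\<close> for the place
  \<open>u\<close>, with membership in \<open>I_set\<close> read off from
  \<open>m + g\<close>.\<close>

definition carry_factor :: "nat \<Rightarrow> 'a" where
  "carry_factor u = (if bit g u then a u else if bit (m + g) u then \<one> \<ominus> a u else \<one>)"

definition carry_prod :: "nat \<Rightarrow> 'a" where
  "carry_prod n = (\<Otimes>u\<in>{..<n}. carry_factor u)"

lemma carry_factor_closed [simp]: "carry_factor u \<in> carrier R"
  by (simp add: carry_factor_def a)

lemma carry_prod_closed [simp]: "carry_prod n \<in> carrier R"
  by (simp add: carry_prod_def)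

lemma carry_prod_Suc: "carry_prod (Suc n) = carry_prod n \<otimes> carry_factor n"
proof -
  have "(\<Otimes>u\<in>insert n {..<n}. carry_factor u) = carry_factor n \<otimes> carry_prod n"
    unfolding carry_prod_def by (rule finprod_insert) auto
  then show ?thesis by (simp add: carry_prod_def lessThan_Suc m_comm)
qed

text \<open>
  The element \<open>D n\<close> acts on \<open>carry_prod n\<close> as the carry into the \<open>n\<close>-th binary place of \<open>m + g\<close>. As
  \<open>g\<close> and \<open>m + g\<close> have no common binary digit, the element \<open>a n\<close> acts as an idempotent
  whenever \<open>n\<close> is a digit of one of them, and squares to zero otherwise.
\<close>

lemma carry_prod_D_add:
  assumes "carry_prod n \<otimes> D n = (if carry m g n then carry_prod n else \<zero>)"
  shows "carry_prod n \<otimes> (a n \<otimes> a n) = (if carry m g n \<noteq> bit m n then carry_prod n \<otimes> a n else \<zero>)"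
proof -
  have "carry_prod n \<otimes> (D n \<oplus> (if bit m n then \<one> else \<zero>)) =
      (if carry m g n \<noteq> bit m n then carry_prod n else \<zero>)"
    using assms D[of n] by (simp add: r_distr char_2)
  moreover have "carry_prod n \<otimes> (a n \<otimes> a n) = a n \<otimes> (carry_prod n \<otimes> (D n \<oplus> (if bit m n then \<one> else \<zero>)))"
    using a[of n] D[of n] by (simp only: square) (simp add: m_ac)
  ultimately show ?thesis using a[of n] by (simp add: m_comm)
qed

text \<open>Idempotency at the next place needs the claim on \<open>D n\<close>, which decides how
  \<open>a n\<close> squares on the product; hence the joint induction.\<close>

lemma carry_prod_idem:
  "carry_prod n \<otimes> carry_prod n = carry_prod n \<and>
   carry_prod n \<otimes> D n = (if carry m g n then carry_prod n else \<zero>)"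
proof (induction n)
  case 0
  show ?case by (simp add: carry_prod_def D_0)
next
  case (Suc n)
  define E where "E = carry_prod n"
  define A where "A = a n"
  note [simp] = a[of n, folded A_def] D[of n]
  have E [simp]: "E \<in> carrier R" by (simp add: E_def)
  have EE: "E \<otimes> E = E" and ED: "E \<otimes> D n = (if carry m g n then E else \<zero>)"
    using Suc.IH by (simp_all add: E_def)
  have EE': "E \<otimes> (E \<otimes> x) = E \<otimes> x" if "x \<in> carrier R" for x
    using that EE by (simp flip: m_assoc)
  have EAA: "E \<otimes> (A \<otimes> A) = (if carry m g n \<noteq> bit m n then E \<otimes> A else \<zero>)"
    using carry_prod_D_add Suc.IH by (simp add: E_def A_def)
  have E': "carry_prod (Suc n) = E \<otimes> carry_factor n"
    by (simp add: carry_prod_Suc E_def)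
  have D': "D (Suc n) = A \<otimes> A \<oplus> (if bit m n then D n else \<zero>)"
    by (simp add: D_Suc A_def)
  have bit: "bit (m + g) n \<longleftrightarrow> ((bit m n \<noteq> bit g n) \<noteq> carry m g n)"
    by (rule bit_add_carry)
  consider (g) "bit g n" "\<not> bit (m + g) n" | (mg) "\<not> bit g n" "bit (m + g) n"
    | (none) "\<not> bit g n" "\<not> bit (m + g) n"
    using disjoint by blast
  then show ?case
  proof cases
    \<comment> \<open>The carry out is one: \<open>A\<close> is idempotent on \<open>E\<close>, so
      the square in \<open>D (Suc n)\<close> fixes \<open>E \<otimes> A\<close>, and the other
      summand vanishes.\<close>
    case g
    then have c: "carry m g n \<noteq> bit m n" using bit by auto
    have F: "carry_prod (Suc n) = E \<otimes> A" using g by (simp add: E' carry_factor_def A_def)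
    have EAA: "E \<otimes> (A \<otimes> A) = E \<otimes> A" using EAA c by simp
    have "(E \<otimes> A) \<otimes> (E \<otimes> A) = E \<otimes> (E \<otimes> (A \<otimes> A))" by (simp add: m_ac)
    then have 1: "(E \<otimes> A) \<otimes> (E \<otimes> A) = E \<otimes> A" by (simp add: EE' EAA)
    have "(E \<otimes> A) \<otimes> (A \<otimes> A) = (E \<otimes> (A \<otimes> A)) \<otimes> A" by (simp add: m_ac)
    then have 2: "(E \<otimes> A) \<otimes> (A \<otimes> A) = E \<otimes> A" by (simp add: EAA) (simp add: m_assoc EAA)
    have "(E \<otimes> A) \<otimes> D n = (E \<otimes> D n) \<otimes> A" by (simp add: m_ac)
    \<comment> \<open>If \<open>m\<close> has the digit \<open>n\<close>, then by \<open>c\<close>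
      no carry comes in, so \<open>E\<close> annihilates \<open>D n\<close>.\<close>
    then have 3: "(E \<otimes> A) \<otimes> (if bit m n then D n else \<zero>) = \<zero>" using c by (auto simp: ED)
    have "(E \<otimes> A) \<otimes> D (Suc n) = E \<otimes> A"
      unfolding D' using 2 3 by (subst r_distr) auto
    then show ?thesis using 1 c g unfolding F by (auto simp: carry_Suc)
  next
    \<comment> \<open>The carry out is zero, because the factor \<open>\<one> \<ominus> A\<close>
      annihilates \<open>A\<close> on \<open>E\<close>.\<close>
    case mg
    then have c: "carry m g n \<noteq> bit m n" using bit by auto
    have F: "carry_prod (Suc n) = E \<otimes> (\<one> \<ominus> A)" using mg by (simp add: E' carry_factor_def A_def)
    have EAA: "E \<otimes> (A \<otimes> A) = E \<otimes> A" using EAA c by simp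
    have 0: "(E \<otimes> (\<one> \<ominus> A)) \<otimes> A = \<zero>"
    proof -
      have "(E \<otimes> (\<one> \<ominus> A)) \<otimes> A = E \<otimes> A \<ominus> E \<otimes> (A \<otimes> A)"
        by (simp add: minus_eq r_distr l_distr r_minus l_minus m_assoc)
      then show ?thesis by (simp add: EAA minus_eq r_neg)
    qed
    have 1: "(E \<otimes> (\<one> \<ominus> A)) \<otimes> (E \<otimes> (\<one> \<ominus> A)) = E \<otimes> (\<one> \<ominus> A)"
    proof -
      have "(E \<otimes> (\<one> \<ominus> A)) \<otimes> (E \<otimes> (\<one> \<ominus> A)) = E \<otimes> (E \<otimes> (\<one> \<ominus> A)) \<otimes> (\<one> \<ominus> A)"
        by (simp add: m_ac)
      also have "\<dots> = (E \<otimes> (\<one> \<ominus> A)) \<otimes> (\<one> \<ominus> A)" by (simp add: EE')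
      also have "\<dots> = E \<otimes> (\<one> \<ominus> A) \<ominus> (E \<otimes> (\<one> \<ominus> A)) \<otimes> A"
        by (subst (2) minus_eq) (simp_all add: r_distr r_minus minus_eq)
      finally show ?thesis using 0 by (simp add: minus_eq)
    qed
    have "(E \<otimes> (\<one> \<ominus> A)) \<otimes> (A \<otimes> A) = ((E \<otimes> (\<one> \<ominus> A)) \<otimes> A) \<otimes> A"
      by (simp add: m_assoc)
    then have 2: "(E \<otimes> (\<one> \<ominus> A)) \<otimes> (A \<otimes> A) = \<zero>" by (simp add: 0)
    have "(E \<otimes> (\<one> \<ominus> A)) \<otimes> D n = (E \<otimes> D n) \<otimes> (\<one> \<ominus> A)" by (simp add: m_ac)
    then have 3: "(E \<otimes> (\<one> \<ominus> A)) \<otimes> (if bit m n then D n else \<zero>) = \<zero>"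
      using c by (auto simp: ED)
    have "(E \<otimes> (\<one> \<ominus> A)) \<otimes> D (Suc n) = \<zero>"
      unfolding D' using 2 3 by (subst r_distr) auto
    then show ?thesis using 1 c mg unfolding F by (auto simp: carry_Suc)
  next
    \<comment> \<open>Here \<open>A\<close> squares to zero on \<open>E\<close>; the carry in equals
      the digit of \<open>m\<close> and is passed on.\<close>
    case none
    then have c: "carry m g n = bit m n" using bit by auto
    have F: "carry_prod (Suc n) = E" using none by (simp add: E' carry_factor_def)
    have "E \<otimes> D (Suc n) = E \<otimes> (if bit m n then D n else \<zero>)"
      unfolding D' using EAA c by (subst r_distr) auto
    then show ?thesis using EE ED c none unfolding F by (auto simp: carry_Suc)
  qed
qed

lemma carry_prod_absorb:
  assumes "n \<le> N"
  shows "\<exists>x\<in>carrier R. carry_prod N = carry_prod n \<otimes> x"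
  using assms
proof (induction N rule: dec_induct)
  case base
  then show ?case by (intro bexI[of _ \<one>]) auto
next
  case (step k)
  then obtain x where "x \<in> carrier R" "carry_prod k = carry_prod n \<otimes> x" by blast
  then show ?case
    by (intro bexI[of _ "x \<otimes> carry_factor k"]) (auto simp: carry_prod_Suc m_assoc)
qed

text \<open>The behaviour of \<open>a u\<close> is already decided by
  \<open>carry_prod (Suc u)\<close>; the later factors enter only as a common multiplier
  \<open>x\<close>.\<close>

lemma carry_prod_mult:
  assumes "u < N"
  shows "if bit g u then carry_prod N \<otimes> a u = carry_prod N
    else if bit (m + g) u then carry_prod N \<otimes> a u = \<zero>
    else carry_prod N \<otimes> (a u \<otimes> a u) = \<zero>"
proof -
  define E where "E = carry_prod u"
  define A where "A = a u"
  have [simp]: "E \<in> carrier R" "A \<in> carrier R" by (simp_all add: E_def A_def a)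
  obtain x where x [simp]: "x \<in> carrier R" and N: "carry_prod N = carry_prod (Suc u) \<otimes> x"
    using carry_prod_absorb[of "Suc u" N] assms by auto
  have EAA: "E \<otimes> (A \<otimes> A) = (if carry m g u \<noteq> bit m u then E \<otimes> A else \<zero>)"
    using carry_prod_D_add carry_prod_idem by (simp add: E_def A_def)
  have bit: "bit (m + g) u \<longleftrightarrow> ((bit m u \<noteq> bit g u) \<noteq> carry m g u)"
    by (rule bit_add_carry)
  have E': "carry_prod (Suc u) = E \<otimes> carry_factor u"
    by (simp add: carry_prod_Suc E_def)
  consider (g) "bit g u" "\<not> bit (m + g) u" | (mg) "\<not> bit g u" "bit (m + g) u"
    | (none) "\<not> bit g u" "\<not> bit (m + g) u"
    using disjoint by blast
  then show ?thesis
  proof cases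
    case g
    have "carry_prod N \<otimes> A = (E \<otimes> (A \<otimes> A)) \<otimes> x"
      using g by (simp add: N E' carry_factor_def A_def[symmetric] m_ac)
    also have "\<dots> = carry_prod N"
      using g bit EAA by (simp add: N E' carry_factor_def A_def[symmetric])
    finally show ?thesis using g by (simp add: A_def)
  next
    case mg
    have "carry_prod N \<otimes> A = (E \<otimes> (\<one> \<ominus> A) \<otimes> x) \<otimes> A"
      using mg by (simp add: N E' carry_factor_def A_def[symmetric])
    also have "\<dots> = (E \<otimes> (\<one> \<ominus> A) \<otimes> A) \<otimes> x" by (simp add: m_ac)
    also have "E \<otimes> (\<one> \<ominus> A) \<otimes> A = E \<otimes> A \<ominus> E \<otimes> (A \<otimes> A)"
      by (simp add: minus_eq r_distr l_distr r_minus l_minus m_assoc)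
    also have "\<dots> = \<zero>" using mg bit EAA by (simp add: minus_eq r_neg)
    finally show ?thesis using mg by (simp add: A_def)
  next
    case none
    have "carry_prod N \<otimes> (A \<otimes> A) = (E \<otimes> (A \<otimes> A)) \<otimes> x"
      using none by (simp add: N E' carry_factor_def m_ac)
    also have "\<dots> = \<zero>" using none bit EAA by simp
    finally show ?thesis using none by (simp add: A_def)
  qed
qed

lemma carry_prod_stable:
  assumes "\<And>u. bit g u \<or> bit (m + g) u \<Longrightarrow> u < n" and "n \<le> N"
  shows "carry_prod N = carry_prod n"
  using assms(2)
proof (induction N rule: dec_induct)
  case (step k)
  then have "\<not> bit g k \<and> \<not> bit (m + g) k" using assms(1)[of k] by auto
  then show ?case using step by (simp add: carry_prod_Suc carry_factor_def)
qed simp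

text \<open>Removing the top digit of \<open>i\<close> writes \<open>b i\<close> as
  \<open>a u \<otimes> b j\<close>. If both factors are absorbed, so is \<open>b i\<close>;
  otherwise one factor whose square is annihilated suffices.\<close>

lemma carry_prod_mult_power_basis:
  fixes b :: "nat \<Rightarrow> 'a" and i :: nat
  assumes b: "\<And>i. b i \<in> carrier R" "b 0 = \<one>"
    and b_add: "\<And>u j. j < 2 ^ u \<Longrightarrow> b (2 ^ u + j) = a u \<otimes> b j"
    and n: "\<And>u. bit g u \<or> bit (m + g) u \<Longrightarrow> u < n"
  shows "carry_prod n \<otimes> b i = carry_prod n \<or> carry_prod n \<otimes> (b i \<otimes> b i) = \<zero>"
proof (induction i rule: less_induct)
  case (less i)
  show ?case
  proof (cases "i = 0")
    case True
    then show ?thesis by (simp add: b)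
  next
    case False
    then obtain u where u: "2 ^ u \<le> i" "i < 2 ^ Suc u"
      using ex_power_ivl1[of 2 i] by auto
    define j where "j = i - 2 ^ u"
    have j: "i = 2 ^ u + j" "j < 2 ^ u" "j < i" using u by (auto simp: j_def)
    have bi: "b i = a u \<otimes> b j" using b_add[OF j(2)] j(1) by simp
    have sq: "carry_prod n \<otimes> (b i \<otimes> b i) = (carry_prod n \<otimes> (a u \<otimes> a u)) \<otimes> (b j \<otimes> b j)"
      "carry_prod n \<otimes> (b i \<otimes> b i) = (carry_prod n \<otimes> (b j \<otimes> b j)) \<otimes> (a u \<otimes> a u)"
      using b a by (simp_all add: bi m_ac)
    have bi': "carry_prod n \<otimes> b i = (carry_prod n \<otimes> b j) \<otimes> a u" using b a by (simp add: bi m_ac)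
    \<comment> \<open>The digit \<open>u\<close> may lie beyond \<open>n\<close>; enlarging the
      product to cover it only adds factors one.\<close>
    have N: "carry_prod (max n (Suc u)) = carry_prod n"
      by (rule carry_prod_stable) (use n in auto)
    have "carry_prod n \<otimes> a u = carry_prod n \<or> carry_prod n \<otimes> (a u \<otimes> a u) = \<zero>"
    proof -
      have "if bit g u then carry_prod n \<otimes> a u = carry_prod n
          else if bit (m + g) u then carry_prod n \<otimes> a u = \<zero>
          else carry_prod n \<otimes> (a u \<otimes> a u) = \<zero>"
        using carry_prod_mult[of u "max n (Suc u)"] unfolding N by simp
      moreover have "carry_prod n \<otimes> (a u \<otimes> a u) = (carry_prod n \<otimes> a u) \<otimes> a u"
        using a by (simp add: m_assoc)
      ultimately show ?thesis using a by (auto split: if_splits)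
    qed
    then show ?thesis
      using less.IH[OF j(3)] sq bi' b a by auto
  qed
qed

lemma carry_prod_eq:
  assumes n: "\<And>u. bit g u \<or> bit (m + g) u \<Longrightarrow> u < n"
  shows "carry_prod n = (\<Otimes>u\<in>{u. bit g u}. a u) \<otimes> (\<Otimes>u\<in>{u. bit (m + g) u}. \<one> \<ominus> a u)"
proof -
  let ?J = "{u. bit g u}" and ?I = "{u. bit (m + g) u}"
  have fin: "finite ?J" "finite ?I"
    using n by (auto intro: finite_subset[of _ "{..<n}"])
  have dis: "?J \<inter> ?I = {}" using disjoint by auto
  have "carry_prod n = (\<Otimes>u\<in>?J \<union> ?I. carry_factor u)"
    unfolding carry_prod_def
    by (rule finprod_mono_neutral_cong_right) (use n in \<open>auto simp: carry_factor_def a\<close>)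
  also have "\<dots> = (\<Otimes>u\<in>?J. carry_factor u) \<otimes> (\<Otimes>u\<in>?I. carry_factor u)"
    using fin dis by (intro finprod_Un_disjoint) auto
  also have "(\<Otimes>u\<in>?J. carry_factor u) = (\<Otimes>u\<in>?J. a u)"
    by (rule finprod_cong') (auto simp: carry_factor_def a)
  also have "(\<Otimes>u\<in>?I. carry_factor u) = (\<Otimes>u\<in>?I. \<one> \<ominus> a u)"
    by (rule finprod_cong') (use disjoint in \<open>auto simp: carry_factor_def a\<close>)
  finally show ?thesis .
qed

end

end

section \<open>The idempotent \<open>e\<^bsub>m,g\<^esub>\<close>\<close>

lemma schur_corner_ops:
  "x \<otimes>\<^bsub>schur_corner r l1 l2\<^esub> y = x \<circ> y" "x \<oplus>\<^bsub>schur_corner r l1 l2\<^esub> y = x + y"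
  "\<one>\<^bsub>schur_corner r l1 l2\<^esub> = weight_proj r l1 l2" "\<zero>\<^bsub>schur_corner r l1 l2\<^esub> = 0"
  by (simp_all add: schur_corner_def)

lemma schur_corner_additive:
  assumes "\<phi> \<in> carrier (schur_corner r l1 l2)"
  shows "\<phi> (v + w) = \<phi> v + \<phi> w" "\<phi> (scl c v) = scl c (\<phi> v)" "\<phi> 0 = 0"
proof -
  show add: "\<phi> (v + w) = \<phi> v + \<phi> w" "\<phi> (scl c v) = scl c (\<phi> v)" for v w c
    using assms by (simp_all add: schur_corner_carrier_apply)
  show "\<phi> 0 = 0" using add(1)[of 0 0] by simp
qed

lemma schur_corner_sum_comp:
  fixes f :: "'s \<Rightarrow> 'k::field operator"
  assumes "\<phi> \<in> carrier (schur_corner r l1 l2)"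
  shows "\<phi> \<circ> (\<Sum>s\<in>A. f s) = (\<Sum>s\<in>A. \<phi> \<circ> f s)"
proof (induction A rule: infinite_finite_induct)
  case (insert x A)
  have "\<phi> \<circ> (f x + sum f A) = (\<phi> \<circ> f x) + (\<phi> \<circ> sum f A)"
    by (simp add: fun_eq_iff schur_corner_additive(1)[OF assms])
  then show ?case by (simp only: sum.insert[OF insert.hyps] insert.IH)
qed (simp_all add: fun_eq_iff schur_corner_additive(3)[OF assms] flip: zero_fun_def)

lemma sum_b_elem_closed: "(\<Sum>s\<in>A. b_elem r l1 l2 (f s)) \<in> carrier (schur_corner r l1 l2)"
proof -
  interpret S: cring "schur_corner r l1 l2 :: ('a::field operator) ring" by (rule cring_schur_corner)
  show ?thesis
    using S.zero_closed S.a_closed[OF b_elem_closed]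
    by (induction A rule: infinite_finite_induct) (auto simp: schur_corner_ops)
qed

lemma add_self_char_2:
  assumes "CHAR('k::field) = 2"
  shows "x + x = (0 :: 'k operator)"
proof (intro ext)
  fix v w
  have "(2::'k) = 0" using of_nat_CHAR[where 'a = 'k] assms by simp
  then show "(x + x) v w = (0 :: 'k operator) v w" by (simp flip: mult_2)
qed

section \<open>The corner algebra as an instance of the carry setting\<close>

locale carry_setup =
  fixes r l1 l2 m g :: nat and T :: "'k::field itself"
  assumes char: "CHAR('k) = 2" and r: "2 * l2 + m = r" "l1 = l2 + m"
    and odd_choose: "odd ((m + 2 * g) choose g)"
begin

abbreviation S :: "('k operator) ring" where "S \<equiv> schur_corner r l1 l2"
abbreviation b :: "nat \<Rightarrow> 'k operator" where "b \<equiv> b_elem r l1 l2"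

text \<open>Found by taking the factor \<open>b (2 ^ u)\<close> out of
  \<open>b_elem_power_2_square\<close>: for \<open>s < 2 ^ u\<close> the summand
  \<open>b (2 ^ Suc u - s)\<close> is the product of \<open>b (2 ^ u)\<close> and
  \<open>b (2 ^ u - s)\<close>. The term \<open>s = 2 ^ u\<close>, present if and only if
  \<open>m\<close> has the digit \<open>u\<close>, is left out and becomes the summand one in
  \<open>b_power_2_square\<close>.\<close>

definition carry_elem :: "nat \<Rightarrow> 'k operator" where
  "carry_elem u = (\<Sum>s | 1 \<le> s \<and> s < 2 ^ u \<and> odd (m choose s). b (2 ^ u - s))"

sublocale S: cring S by (rule cring_schur_corner)

lemma l12: "l1 + l2 = r" using r by simp

lemma S_char_2: "x \<oplus>\<^bsub>S\<^esub> x = \<zero>\<^bsub>S\<^esub>"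
  by (simp only: schur_corner_ops add_self_char_2[OF char])

lemma carry_elem_closed: "carry_elem u \<in> carrier S"
  unfolding carry_elem_def by (rule sum_b_elem_closed)

lemma carry_elem_0: "carry_elem 0 = \<zero>\<^bsub>S\<^esub>"
proof -
  have "{s. 1 \<le> s \<and> s < 2 ^ 0 \<and> odd (m choose s)} = {}" by auto
  then show ?thesis unfolding carry_elem_def schur_corner_ops by (simp only: sum.empty)
qed

text \<open>Split at \<open>s = 2 ^ u\<close>. The lower part is the sum for the square. In the
  upper part, with index \<open>2 ^ u + s\<close>, Lucas' theorem asks for the digit
  \<open>u\<close> of \<open>m\<close> and leaves the sum for \<open>carry_elem u\<close>.\<close>

lemma carry_elem_Suc:
  "carry_elem (Suc u) = b (2 ^ u) \<otimes>\<^bsub>S\<^esub> b (2 ^ u) \<oplus>\<^bsub>S\<^esub> (if bit m u then carry_elem u else \<zero>\<^bsub>S\<^esub>)"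
proof -
  let ?f = "\<lambda>s. b (2 ^ Suc u - s)"
  let ?A = "{s. 1 \<le> s \<and> s \<le> 2 ^ u \<and> odd (m choose s)}"
  let ?B = "{s. 2 ^ u < s \<and> s < 2 ^ Suc u \<and> odd (m choose s)}"
  have "carry_elem (Suc u) = sum ?f (?A \<union> ?B)"
    unfolding carry_elem_def by (rule sum.cong) (auto intro: le_less_trans)
  also have "\<dots> = sum ?f ?A + sum ?f ?B"
    by (rule sum.union_disjoint) auto
  also have "sum ?f ?A = b (2 ^ u) \<circ> b (2 ^ u)"
    unfolding b_elem_power_2_square[OF char r] ..
  also have "sum ?f ?B = (if bit m u then carry_elem u else 0)"
  proof -
    have odd: "odd (m choose (2 ^ u + s)) \<longleftrightarrow> bit m u \<and> odd (m choose s)" if "s < 2 ^ u" for s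
      by (auto simp: odd_choose_iff_bit bit_add_power_2_nat[OF that])
    have "sum ?f ?B = (\<Sum>s | 1 \<le> s \<and> s < 2 ^ u \<and> odd (m choose (2 ^ u + s)). b (2 ^ u - s))"
      by (rule sum.reindex_bij_witness[where i = "\<lambda>s. 2 ^ u + s" and j = "\<lambda>s. s - 2 ^ u"]) (auto simp: mult_2)
    also have "{s. 1 \<le> s \<and> s < 2 ^ u \<and> odd (m choose (2 ^ u + s))} =
        (if bit m u then {s. 1 \<le> s \<and> s < 2 ^ u \<and> odd (m choose s)} else {})"
      using odd by auto
    finally show ?thesis by (cases "bit m u") (simp_all add: carry_elem_def zero_fun_def)
  qed
  finally show ?thesis by (simp only: schur_corner_ops)
qed

lemma b_power_2_square:
  "b (2 ^ u) \<otimes>\<^bsub>S\<^esub> b (2 ^ u) =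
   b (2 ^ u) \<otimes>\<^bsub>S\<^esub> (carry_elem u \<oplus>\<^bsub>S\<^esub> (if bit m u then \<one>\<^bsub>S\<^esub> else \<zero>\<^bsub>S\<^esub>))"
proof -
  let ?A = "{s. 1 \<le> s \<and> s < 2 ^ u \<and> odd (m choose s)}"
  let ?f = "\<lambda>s. b (2 ^ Suc u - s)"
  have A: "{s. 1 \<le> s \<and> s \<le> 2 ^ u \<and> odd (m choose s)} = ?A \<union> (if bit m u then {2 ^ u} else {})"
  proof (rule Set.set_eqI)
    fix s show "s \<in> {s. 1 \<le> s \<and> s \<le> 2 ^ u \<and> odd (m choose s)} \<longleftrightarrow> s \<in> ?A \<union> (if bit m u then {2 ^ u} else {})"
      by (cases "s = 2 ^ u") (auto simp: odd_choose_power_2)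
  qed
  have "b (2 ^ u) \<circ> b (2 ^ u) = sum ?f (?A \<union> (if bit m u then {2 ^ u} else {}))"
    unfolding b_elem_power_2_square[OF char r] A ..
  also have "\<dots> = sum ?f ?A + sum ?f (if bit m u then {2 ^ u} else {})"
    by (rule sum.union_disjoint) auto
  also have "sum ?f ?A = (\<Sum>s\<in>?A. b (2 ^ u) \<circ> b (2 ^ u - s))"
  proof (rule sum.cong[OF refl])
    fix s assume "s \<in> ?A"
    then have "2 ^ u - s < 2 ^ u" "2 ^ Suc u - s = 2 ^ u + (2 ^ u - s)" by auto
    then show "?f s = b (2 ^ u) \<circ> b (2 ^ u - s)"
      using b_elem_power_2_mult[OF char r] by simp
  qed
  also have "\<dots> = b (2 ^ u) \<circ> carry_elem u"
    unfolding carry_elem_def by (rule schur_corner_sum_comp[OF b_elem_closed, symmetric])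
  also have "sum ?f (if bit m u then {2 ^ u} else {}) = b (2 ^ u) \<circ> (if bit m u then weight_proj r l1 l2 else 0)"
  proof (cases "bit m u")
    case True
    have "b (2 ^ u) \<circ> weight_proj r l1 l2 = b (2 ^ u)"
      using S.r_one[OF b_elem_closed] by (simp add: schur_corner_ops)
    then show ?thesis using True by simp
  next
    case False
    have "b (2 ^ u) \<circ> (0 :: 'k operator) = 0"
      using S.r_null[OF b_elem_closed] by (simp add: schur_corner_ops)
    then show ?thesis using False by simp
  qed
  also have "(b (2 ^ u) \<circ> carry_elem u) + (b (2 ^ u) \<circ> (if bit m u then weight_proj r l1 l2 else 0)) =
      b (2 ^ u) \<circ> (carry_elem u + (if bit m u then weight_proj r l1 l2 else 0))"
    by (simp add: fun_eq_iff schur_corner_additive(1)[OF b_elem_closed])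
  finally show ?thesis by (simp only: schur_corner_ops)
qed

lemma g_disjoint: "\<not> (bit (m + g) u \<and> bit g u)"
  using odd_choose_disjoint[of "m + g" g u] odd_choose by (simp add: mult_2 add.assoc)

text \<open>Listed in the order of the hypotheses of the carry context, with
  \<open>b (2 ^ u)\<close> for \<open>a u\<close>, so that its results can be instantiated by
  \<open>OF\<close>.\<close>

lemmas carry_hyps =
  S_char_2 b_elem_closed carry_elem_closed carry_elem_0 carry_elem_Suc b_power_2_square g_disjoint

abbreviation e :: "'k operator" where "e \<equiv> e_elem r l1 l2 m g"

text \<open>A generous bound: a digit \<open>u\<close> of a number \<open>n\<close> satisfies
  \<open>u < 2 ^ u \<le> n\<close>.\<close>

definition digit_bound :: nat where "digit_bound = m + 2 * g"

lemma less_digit_bound: "bit g u \<or> bit (m + g) u \<Longrightarrow> u < digit_bound"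
proof -
  assume "bit g u \<or> bit (m + g) u"
  then have "2 ^ u \<le> g \<or> 2 ^ u \<le> m + g" by (auto simp: bit_iff_odd intro: ccontr)
  then have "2 ^ u \<le> m + 2 * g" by auto
  then show ?thesis using less_le_trans[OF less_exp[of u]] by (simp add: digit_bound_def)
qed

text \<open>\<open>m + 2 * g\<close> is \<open>(m + g) + g\<close>, added without carries. So its
  digits shared with \<open>g\<close> are those of \<open>g\<close>, and the rest are those of
  \<open>m + g\<close>.\<close>

lemma e_eq: "e = S.carry_prod (\<lambda>u. b (2 ^ u)) m g digit_bound"
proof -
  have "bit (m + 2 * g) u \<longleftrightarrow> bit (m + g) u \<or> bit g u" for u
    using bit_add_disjoint[of "m + g" g u] g_disjoint by (simp add: mult_2 add.assoc)
  then have "J_set m g = {u. bit g u}" "I_set m g = {u. bit (m + g) u}"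
    using g_disjoint by (auto simp: J_set_def I_set_def)
  then show ?thesis
    unfolding e_elem_def Let_def
    using S.carry_prod_eq[OF carry_hyps, of digit_bound] less_digit_bound by simp
qed

lemma e_closed: "e \<in> carrier S"
  unfolding e_eq by (rule S.carry_prod_closed[OF carry_hyps])

lemma e_idem: "e \<otimes>\<^bsub>S\<^esub> e = e"
  unfolding e_eq using S.carry_prod_idem[OF carry_hyps] by blast

lemma e_b: "e \<otimes>\<^bsub>S\<^esub> b i = e \<or> e \<otimes>\<^bsub>S\<^esub> (b i \<otimes>\<^bsub>S\<^esub> b i) = \<zero>\<^bsub>S\<^esub>"
  unfolding e_eq
proof (rule S.carry_prod_mult_power_basis[OF carry_hyps])
  show "b 0 = \<one>\<^bsub>S\<^esub>" using b_elem_0[OF l12] by (simp add: schur_corner_ops)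
  show "b (2 ^ u + j) = b (2 ^ u) \<otimes>\<^bsub>S\<^esub> b j" if "j < 2 ^ u" for u j
    using b_elem_power_2_mult[OF char r that] by (simp add: schur_corner_ops)
qed (use b_elem_closed less_digit_bound in auto)

lemma e_eigenvector:
  assumes z: "weight_proj r l1 l2 z = z"
    and 1: "\<And>u. bit g u \<Longrightarrow> b (2 ^ u) z = z" and 0: "\<And>u. bit (m + g) u \<Longrightarrow> b (2 ^ u) z = 0"
  shows "e z = z"
proof -
  have "S.carry_factor (\<lambda>u. b (2 ^ u)) m g u z = z" for u
  proof -
    have "(\<one>\<^bsub>S\<^esub> \<ominus>\<^bsub>S\<^esub> b (2 ^ u)) = \<one>\<^bsub>S\<^esub> \<oplus>\<^bsub>S\<^esub> b (2 ^ u)"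
      using S.minus_equality[OF S_char_2] by (simp add: S.minus_eq b_elem_closed)
    then show ?thesis
      using 1 0 z by (simp add: S.carry_factor_def[OF carry_hyps] schur_corner_ops)
  qed
  then have "S.carry_prod (\<lambda>u. b (2 ^ u)) m g n z = z" for n
  proof (induction n)
    case 0
    show ?case using z by (simp add: S.carry_prod_def[OF carry_hyps] schur_corner_ops)
  next
    case (Suc n)
    then show ?case by (simp add: S.carry_prod_Suc[OF carry_hyps] schur_corner_ops)
  qed
  then show ?thesis unfolding e_eq .
qed

end

section \<open>The elements \<open>b(i)\<close> span the corner algebra\<close>

lemma binomial_expansion:
  fixes h :: "nat \<Rightarrow> 'a::comm_ring_1"
  shows "\<exists>c. \<forall>x. h x = (\<Sum>y\<le>x. c y * of_nat (x choose y))"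
proof -
  \<comment> \<open>Newton interpolation on an initial segment. The matrix \<open>x choose y\<close>
    is unitriangular, so over any commutative ring the value at the new point determines the new
    coefficient.\<close>
  have "\<exists>c. \<forall>x<n. h x = (\<Sum>y\<le>x. c y * of_nat (x choose y))" for n
  proof (induction n)
    case (Suc n)
    then obtain c where c: "\<And>x. x < n \<Longrightarrow> h x = (\<Sum>y\<le>x. c y * of_nat (x choose y))" by blast
    define c' where "c' = c(n := h n - (\<Sum>y<n. c y * of_nat (n choose y)))"
    have "h x = (\<Sum>y\<le>x. c' y * of_nat (x choose y))" if "x < Suc n" for x
    proof (cases "x = n")
      case True
      have "(\<Sum>y\<le>n. c' y * of_nat (n choose y)) = (\<Sum>y<n. c' y * of_nat (n choose y)) + c' n"
        by (simp flip: lessThan_Suc_atMost)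
      also have "(\<Sum>y<n. c' y * of_nat (n choose y)) = (\<Sum>y<n. c y * of_nat (n choose y))"
        by (intro sum.cong) (auto simp: c'_def)
      finally show ?thesis using True by (simp add: c'_def)
    next
      case False
      then have "(\<Sum>y\<le>x. c' y * of_nat (x choose y)) = (\<Sum>y\<le>x. c y * of_nat (x choose y))"
        using that by (intro sum.cong) (auto simp: c'_def)
      then show ?thesis using c[of x] False that by simp
    qed
    then show ?case by blast
  qed simp
  then obtain C where C: "\<And>n x. x < n \<Longrightarrow> h x = (\<Sum>y\<le>x. C n y * of_nat (x choose y))" by metis
  \<comment> \<open>The coefficients do not depend on the segment, so the finite expansions fit
    together into one sequence.\<close>
  have C_eq: "C n x = C (Suc x) x" if "x < n" for n x
    using that
  proof (induction x arbitrary: n rule: less_induct)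
    case (less x)
    have "C n y = C (Suc x) y" if "y < x" for y
      using less.IH[OF that, of n] less.IH[OF that, of "Suc x"] less.prems that by simp
    then have "(\<Sum>y<x. C n y * of_nat (x choose y)) = (\<Sum>y<x. C (Suc x) y * of_nat (x choose y))"
      by (intro sum.cong) auto
    moreover have "(\<Sum>y\<le>x. C n y * of_nat (x choose y)) = (\<Sum>y\<le>x. C (Suc x) y * of_nat (x choose y))"
      using C[of x n] C[of x "Suc x"] less.prems by simp
    ultimately show ?case by (simp flip: lessThan_Suc_atMost)
  qed
  have "h x = (\<Sum>y\<le>x. C (Suc y) y * of_nat (x choose y))" for x
  proof -
    have "C (Suc x) y = C (Suc y) y" if "y \<le> x" for y
      using that by (intro C_eq) simp
    then have "(\<Sum>y\<le>x. C (Suc x) y * of_nat (x choose y)) = (\<Sum>y\<le>x. C (Suc y) y * of_nat (x choose y))"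
      by (intro sum.cong) auto
    then show ?thesis using C[of x "Suc x"] by simp
  qed
  then show ?thesis by (intro exI[of _ "\<lambda>y. C (Suc y) y"]) simp
qed

text \<open>Equal fibre sizes mean that both maps yield the same multiset of values.\<close>

lemma permutes_of_equal_fibres:
  assumes A: "finite A" and fibres: "\<And>c. card {x \<in> A. f x = c} = card {x \<in> A. f' x = c}"
  obtains p where "p permutes A" "\<And>x. x \<in> A \<Longrightarrow> f x = f' (p x)"
proof -
  have count: "count (image_mset h (mset_set A)) c = card {x \<in> A. h x = c}" for h c
  proof -
    have "{x \<in> A. h x = c} = h -` {c} \<inter> A" by auto
    then show ?thesis using A by (simp add: count_image_mset)
  qed
  have "image_mset f (mset_set A) = image_mset f' (mset_set A)"
    by (rule multiset_eqI) (simp only: count fibres)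
  from image_mset_eq_implies_permutes[OF A this]
  obtain p where "p permutes A" "\<forall>x\<in>A. f x = f' (p x)" .
  then show thesis by (intro that) auto
qed

text \<open>The number of common twos determines how often each of the four pairs of letters occurs,
  so it is a complete invariant for place permutations acting on pairs of words of this
  weight.\<close>

lemma pair_transitive:
  assumes r: "l1 + l2 = r"
    and u: "u \<in> weight_words r l1 l2" "u' \<in> weight_words r l1 l2"
    and w: "w \<in> weight_words r l1 l2" "w' \<in> weight_words r l1 l2"
    and eq: "card (twos r u \<inter> twos r w) = card (twos r u' \<inter> twos r w')"
  obtains p where "p permutes {..<r}" "u' \<circ> p = u" "w' \<circ> p = w"
proof -
  have fibre: "card {q \<in> {..<r}. (v q, x q) = c} =
      (if c = (2, 2) then n else if c = (2, 1) \<or> c = (1, 2) then l2 - n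
       else if c = (1, 1) then r - (2 * l2 - n) else 0)"
    if "v \<in> weight_words r l1 l2" "x \<in> weight_words r l1 l2"
      and n: "n = card (twos r v \<inter> twos r x)" for v x n c
  proof -
    let ?V = "twos r v" and ?X = "twos r x"
    have vals: "v q = 1 \<or> v q = 2" "x q = 1 \<or> x q = 2" if "q < r" for q
      using that \<open>v \<in> _\<close> \<open>x \<in> _\<close> by (auto simp: weight_words_def words_def PiE_iff)
    have V: "card ?V = l2" "card ?X = l2" using that(1,2) by (auto simp: weight_words_iff[OF r])
    have "card (?V \<union> ?X) + n = 2 * l2"
      using card_Un_Int[of ?V ?X] n V by simp
    moreover have "card ({..<r} - (?V \<union> ?X)) = r - card (?V \<union> ?X)"
      using twos_subset[of r v] twos_subset[of r x] by (subst card_Diff_subset) auto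
    ultimately have 11: "card ({..<r} - (?V \<union> ?X)) = r - (2 * l2 - n)" by (simp add: algebra_simps)
    have 21: "card (?V - ?X) = l2 - n" "card (?X - ?V) = l2 - n"
      using V n card_Diff_subset_Int[of ?V ?X] card_Diff_subset_Int[of ?X ?V] by (auto simp: Int_commute)
    have "{q \<in> {..<r}. (v q, x q) = (2, 2)} = ?V \<inter> ?X"
      "{q \<in> {..<r}. (v q, x q) = (2, 1)} = ?V - ?X"
      "{q \<in> {..<r}. (v q, x q) = (1, 2)} = ?X - ?V"
      "{q \<in> {..<r}. (v q, x q) = (1, 1)} = {..<r} - (?V \<union> ?X)"
      using vals by (force simp: twos_def)+
    moreover have "{q \<in> {..<r}. (v q, x q) = c} = {}" if "c \<notin> {(2, 2), (2, 1), (1, 2), (1, 1)}"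
      using vals that by (cases c) force
    ultimately show ?thesis using 11 21 n by auto
  qed
  have "card {q \<in> {..<r}. (u q, w q) = c} = card {q \<in> {..<r}. (u' q, w' q) = c}" for c
    unfolding fibre[OF u(1) w(1) refl] fibre[OF u(2) w(2) refl] eq ..
  from permutes_of_equal_fibres[OF finite_lessThan this]
  obtain p where p: "p permutes {..<r}" "\<And>q. q \<in> {..<r} \<Longrightarrow> (u q, w q) = (u' (p q), w' (p q))"
    by blast
  have "(u' \<circ> p) q = u q \<and> (w' \<circ> p) q = w q" for q
  proof (cases "q < r")
    case False
    then have pq: "p q = q" using p(1) by (auto simp: permutes_def)
    have out: "v q = undefined" if "v \<in> weight_words r l1 l2" for v
      using that False by (auto simp: weight_words_def words_def PiE_iff extensional_def)
    show ?thesis using pq out[OF u(1)] out[OF u(2)] out[OF w(1)] out[OF w(2)] by simp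
  qed (use p(2) in auto)
  then show thesis using p(1) by (intro that) auto
qed

text \<open>By \<open>pair_transitive\<close> a matrix entry depends only on the number
  \<open>x\<close> of common twos. The entries of \<open>b(i)\<close> are
  \<open>x choose (l2 - i)\<close>, and these binomials expand every function of
  \<open>x \<le> l2\<close>.\<close>

lemma schur_corner_span:
  fixes \<phi> :: "'k::field operator"
  assumes r: "l1 + l2 = r" and \<phi>: "\<phi> \<in> carrier (schur_corner r l1 l2)"
  obtains c where "\<And>v u. \<phi> v u = (\<Sum>i\<le>l2. c i * b_elem r l1 l2 i v u)"
proof -
  let ?B = "weight_words r l1 l2"
  have orbit: "\<phi> (bvec w) u = \<phi> (bvec w') u'"
    if uw: "u \<in> ?B" "u' \<in> ?B" "w \<in> ?B" "w' \<in> ?B"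
      "card (twos r u \<inter> twos r w) = card (twos r u' \<inter> twos r w')" for u u' w w'
  proof -
    obtain p where p: "p permutes {..<r}" "u' \<circ> p = u" "w' \<circ> p = w"
      using pair_transitive[OF r uw] by blast
    have "w' = w \<circ> inv_into UNIV p"
      using p(3) permutes_inv_o(1)[OF p(1)] by (auto simp: comp_assoc)
    then have "\<phi> (bvec w') = \<phi> (perm_act p (bvec w))" by (simp add: perm_act_bvec[OF p(1)])
    also have "\<dots> = perm_act p (\<phi> (bvec w))"
      using \<phi> p(1) unfolding schur_corner_carrier_apply by blast
    finally show ?thesis using p(2) by (simp only: perm_act_def)
  qed
  \<comment> \<open>The common value of the entries with \<open>n\<close> common twos. The default
    zero for sizes that do not occur makes \<open>h\<close> total, as the expansion
    requires.\<close>
  define h where "h n = (if \<exists>u\<in>?B. \<exists>w\<in>?B. card (twos r u \<inter> twos r w) = n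
    then (SOME x. \<exists>u\<in>?B. \<exists>w\<in>?B. card (twos r u \<inter> twos r w) = n \<and> x = \<phi> (bvec w) u) else 0)" for n
  have h: "\<phi> (bvec w) u = h (card (twos r u \<inter> twos r w))" if uw: "u \<in> ?B" "w \<in> ?B" for u w
  proof -
    let ?P = "\<lambda>x. \<exists>u'\<in>?B. \<exists>w'\<in>?B. card (twos r u' \<inter> twos r w') = card (twos r u \<inter> twos r w) \<and> x = \<phi> (bvec w') u'"
    have "?P (SOME x. ?P x)" by (rule someI[of ?P "\<phi> (bvec w) u"]) (use uw in blast)
    then have "?P (h (card (twos r u \<inter> twos r w)))" using uw by (auto simp: h_def)
    then show ?thesis using orbit uw by metis
  qed
  obtain c where c: "\<And>x. h x = (\<Sum>y\<le>x. c y * of_nat (x choose y))"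
    using binomial_expansion[of h] by blast
  have "\<phi> v u = (\<Sum>i\<le>l2. c (l2 - i) * b_elem r l1 l2 i v u)" for v u
  proof (cases "u \<in> ?B")
    case True
    have hm: "\<phi> (bvec w) u = (\<Sum>i\<le>l2. c (l2 - i) * of_nat (meet_count l2 i (twos r u) (twos r w)))"
      if w: "w \<in> ?B" for w
    proof -
      let ?x = "card (twos r u \<inter> twos r w)"
      have "?x \<le> l2" using True card_mono[of "twos r u" "twos r u \<inter> twos r w"]
        by (auto simp: weight_words_iff[OF r])
      then have "\<phi> (bvec w) u = (\<Sum>y\<le>l2. c y * of_nat (?x choose y))"
        unfolding h[OF True w] c by (intro sum.mono_neutral_left) (auto simp: binomial_eq_0)
      also have "\<dots> = (\<Sum>i\<le>l2. c (l2 - i) * of_nat (?x choose (l2 - i)))"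
        by (rule sum.reindex_bij_witness[where i = "\<lambda>i. l2 - i" and j = "\<lambda>i. l2 - i"]) auto
      also have "\<dots> = (\<Sum>i\<le>l2. c (l2 - i) * of_nat (meet_count l2 i (twos r u) (twos r w)))"
        by (intro sum.cong) (auto simp: meet_count_choose)
      finally show ?thesis .
    qed
    have "\<phi> v u = (\<Sum>w\<in>?B. \<Sum>i\<le>l2. c (l2 - i) * (v w * of_nat (meet_count l2 i (twos r u) (twos r w))))"
      unfolding schur_corner_apply[OF \<phi>, of v] using hm by (simp add: sum_distrib_left mult_ac)
    also have "\<dots> = (\<Sum>i\<le>l2. c (l2 - i) * b_elem r l1 l2 i v u)"
      using True by (subst sum.swap) (simp add: b_elem_meet_count[OF r] sum_distrib_left)
    finally show ?thesis .
  next
    case False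
    have "\<phi> v u = weight_proj r l1 l2 (\<phi> v) u"
      using \<phi> by (simp add: schur_corner_carrier_apply)
    then show ?thesis using False by (simp add: weight_proj_def b_elem_meet_count[OF r])
  qed
  then show thesis by (rule that)
qed

lemma schur_corner_scale:
  assumes \<phi>: "\<phi> \<in> carrier (schur_corner r l1 l2)"
  shows "(\<lambda>v. scl c (\<phi> v)) \<in> carrier (schur_corner r l1 l2)"
proof -
  have "scl c (scl d x) = scl d (scl c x)" "scl c (x + y) = scl c x + scl c y" for d and x y :: "'a tensor"
    by (simp_all add: scl_def fun_eq_iff algebra_simps)
  moreover have "perm_act p (scl c x) = scl c (perm_act p x)" for p and x :: "'a tensor"
    by (simp add: perm_act_def scl_def)
  ultimately show ?thesis
    using \<phi> unfolding schur_corner_carrier_apply by (auto simp: linear_weight_proj(2))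
qed

section \<open>Squares of elements under the idempotent\<close>

context carry_setup
begin

text \<open>Squaring is additive in a commutative ring of characteristic two, so the square of a
  combination of the \<open>b(i)\<close> is the combination of their squares with squared
  coefficients. Multiplication by \<open>e\<close> turns the square of each \<open>b(i)\<close> into
  \<open>e\<close> or zero.\<close>

lemma e_square:
  assumes "\<phi> \<in> carrier S"
  shows "\<exists>c. \<forall>v. e (\<phi> (\<phi> v)) = scl c (e v)"
proof -
  note e_add = schur_corner_additive[OF e_closed]
  note b_add = schur_corner_additive[OF b_elem_closed]
  have scl_0: "scl a 0 = (0 :: 'k tensor)" for a by (simp add: scl_def zero_fun_def)
  obtain c where c: "\<And>v u. \<phi> v u = (\<Sum>i\<le>l2. c i * b i v u)"
    using schur_corner_span[OF l12 assms] by blast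
  \<comment> \<open>Partial sums of the expansion; they stay in the corner, so each commutes with
    the next \<open>b n\<close> and the mixed terms cancel.\<close>
  define \<psi> where "\<psi> n v = (\<Sum>i<n. scl (c i) (b i v))" for n v
  have \<psi>0: "\<psi> 0 v = 0" and \<psi>Suc: "\<psi> (Suc n) v = \<psi> n v + scl (c n) (b n v)" for n v
    by (simp_all add: \<psi>_def)
  have scl: "scl a (x + y) = scl a x + scl a y" "scl (a + d) x = scl a x + scl d x"
    "scl a (scl d x) = scl (a * d) x" for a d and x y :: "'k tensor"
    by (simp_all add: scl_def fun_eq_iff algebra_simps)
  have \<psi>_closed: "\<psi> n \<in> carrier S" for n
  proof (induction n)
    case 0
    have "\<psi> 0 = \<zero>\<^bsub>S\<^esub>" by (simp add: fun_eq_iff \<psi>0 schur_corner_ops)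
    then show ?case by simp
  next
    case (Suc n)
    have "\<psi> (Suc n) = \<psi> n \<oplus>\<^bsub>S\<^esub> (\<lambda>v. scl (c n) (b n v))"
      by (simp add: fun_eq_iff \<psi>Suc schur_corner_ops)
    then show ?case using S.a_closed[OF Suc schur_corner_scale[OF b_elem_closed]] by simp
  qed
  have "\<exists>d. \<forall>v. e (\<psi> n (\<psi> n v)) = scl d (e v)" for n
  proof (induction n)
    case 0
    have "scl 0 v = 0" for v :: "'k tensor" by (simp add: scl_def zero_fun_def)
    then show ?case by (intro exI[of _ 0]) (simp only: \<psi>0 e_add(3) simp_thms)
  next
    case (Suc n)
    then obtain d where d: "\<And>v. e (\<psi> n (\<psi> n v)) = scl d (e v)" by blast
    have comm: "b n (\<psi> n v) = \<psi> n (b n v)" for v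
      using schur_corner_comm[OF b_elem_closed \<psi>_closed] by (metis comp_apply)
    have two: "x + x = 0" for x :: "'k tensor"
      using add_self_char_2[OF char, of "\<lambda>_. x"] by (simp add: fun_eq_iff)
    have "\<psi> (Suc n) (\<psi> (Suc n) v) = \<psi> n (\<psi> n v) + scl (c n * c n) (b n (b n v))" for v
    proof -
      let ?x = "scl (c n) (b n (\<psi> n v))"
      have "\<psi> (Suc n) (\<psi> (Suc n) v) =
          \<psi> n (\<psi> n v) + ?x + (?x + scl (c n * c n) (b n (b n v)))"
        by (simp only: \<psi>Suc schur_corner_additive[OF \<psi>_closed] b_add comm scl)
      also have "\<dots> = \<psi> n (\<psi> n v) + (?x + ?x) + scl (c n * c n) (b n (b n v))"
        by (simp only: add.assoc)
      finally show ?thesis by (simp only: two add_0_right)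
    qed
    then have eq: "e (\<psi> (Suc n) (\<psi> (Suc n) v)) = scl d (e v) + scl (c n * c n) (e (b n (b n v)))" for v
      by (simp only: e_add d)
    from e_b[of n] show ?case
    proof
      assume "e \<otimes>\<^bsub>S\<^esub> b n = e"
      then have "e (b n v) = e v" for v by (simp only: schur_corner_ops) (metis comp_apply)
      then show ?thesis by (intro exI[of _ "d + c n * c n"]) (simp only: eq scl simp_thms)
    next
      assume "e \<otimes>\<^bsub>S\<^esub> (b n \<otimes>\<^bsub>S\<^esub> b n) = \<zero>\<^bsub>S\<^esub>"
      then have "e (b n (b n v)) = 0" for v
        by (simp only: schur_corner_ops) (metis comp_apply zero_fun_apply)
      then show ?thesis by (intro exI[of _ d] allI) (simp only: eq scl_0 add_0_right)
    qed
  qed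
  moreover have "\<phi> = \<psi> (Suc l2)"
    by (simp add: fun_eq_iff c \<psi>_def fun_sum_apply scl_def lessThan_Suc_atMost)
  ultimately show ?thesis by simp
qed

lemma e_idempotent_scalar:
  assumes "\<pi> \<in> carrier S" "\<And>v. \<pi> (\<pi> v) = \<pi> v"
  shows "\<exists>c. \<forall>v. e (\<pi> v) = scl c (e v)"
  using e_square[OF assms(1)] assms(2) by simp

end

section \<open>Polytabloids in characteristic two\<close>

text \<open>The involution pairs off the summands, and each pair contributes twice the same
  value.\<close>

lemma sum_involution_char_2:
  fixes f :: "'a \<Rightarrow> 'k::field"
  assumes char: "CHAR('k) = 2" and "finite A"
    and "\<And>x. x \<in> A \<Longrightarrow> i x \<in> A" "\<And>x. x \<in> A \<Longrightarrow> i (i x) = x" "\<And>x. x \<in> A \<Longrightarrow> i x \<noteq> x"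
    and "\<And>x. x \<in> A \<Longrightarrow> f (i x) = f x"
  shows "sum f A = 0"
  using assms(2-)
proof (induction "card A" arbitrary: A rule: less_induct)
  case less
  note fin = less.prems(1) and inv = less.prems(2-5)
  show ?case
  proof (cases "A = {}")
    case False
    then obtain x where x: "x \<in> A" by blast
    let ?B = "A - {x, i x}"
    have A: "A = insert x (insert (i x) ?B)" using x inv(1) by auto
    have "sum f ?B = 0"
    proof (rule less.hyps)
      show "card ?B < card A" using fin x by (intro psubset_card_mono) auto
      fix y assume y: "y \<in> ?B"
      then have "i y \<noteq> x" "i y \<noteq> i x" using inv(2) x by (metis Diff_iff insertCI)+
      then show "i y \<in> ?B" using y inv(1) by auto
    qed (use fin inv in auto)
    have "sum f A = sum f (insert x (insert (i x) ?B))" using A by simp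
    also have "\<dots> = f x + (f (i x) + sum f ?B)"
      using fin inv(3)[OF x] by (subst sum.insert; simp)+
    also have "\<dots> = 2 * f x" using \<open>sum f ?B = 0\<close> inv(4)[OF x] by simp
    also have "(2::'k) = 0" using of_nat_CHAR[where 'a = 'k] char by simp
    finally show ?thesis by simp
  qed simp
qed

text \<open>Equivariance on all coordinate functions rather than on a submodule; a homomorphism
  defined on a submodule is brought to this form by composing it with a projection.\<close>

definition sym_hom :: "nat \<Rightarrow> 'k::field operator \<Rightarrow> bool" where
  "sym_hom r f \<longleftrightarrow> (\<forall>v w. f (v + w) = f v + f w) \<and> (\<forall>c v. f (scl c v) = scl c (f v)) \<and>
     (\<forall>p v. p permutes {..<r} \<longrightarrow> f (perm_act p v) = perm_act p (f v))"

lemma sym_hom_sum: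
  assumes "sym_hom r f"
  shows "f (\<Sum>x\<in>A. h x) = (\<Sum>x\<in>A. f (h x))"
proof -
  have add: "f (v + w) = f v + f w" for v w using assms by (simp add: sym_hom_def)
  have "f 0 = 0" using add[of 0 0] by simp
  then show ?thesis
    by (induction A rule: infinite_finite_induct) (simp_all add: add)
qed

lemma sym_hom_corner: "\<phi> \<in> carrier (schur_corner r l1 l2) \<Longrightarrow> sym_hom r \<phi>"
  unfolding schur_corner_carrier_apply sym_hom_def by blast

section \<open>The column group of a two-row tableau\<close>

locale two_rows =
  fixes r m1 m2 :: nat and T :: "'k::field itself"
  assumes char: "CHAR('k) = 2" and m: "m2 \<le> m1" "m1 + m2 = r"
begin

text \<open>The rows are filled in order, so column \<open>j\<close> holds the positions
  \<open>j\<close> and, if it has length two, \<open>m1 + j\<close>.\<close>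

definition tab :: "nat \<times> nat \<Rightarrow> nat" where
  "tab = (\<lambda>(i, j). if i = 1 then j else m1 + j)"

text \<open>The other position in the same column; positions in columns of length one and those
  outside the tableau are fixed.\<close>

definition partner :: "nat \<Rightarrow> nat" where
  "partner q = (if q < m2 then m1 + q else if m1 \<le> q \<and> q < r then q - m1 else q)"

lemma partner_partner [simp]: "partner (partner q) = q"
  using m by (auto simp: partner_def)

lemma partner_less_iff [simp]: "partner q < r \<longleftrightarrow> q < r"
  using m by (auto simp: partner_def)

abbreviation columns :: "(nat \<Rightarrow> nat) set" where
  "columns \<equiv> column_stabilizer r m1 m2 tab"

lemma columns_iff: "p \<in> columns \<longleftrightarrow> p permutes {..<r} \<and> (\<forall>q. p q = q \<or> p q = partner q)"
proof -
  have "(\<forall>(i, j)\<in>diagram m1 m2. \<exists>i'. (i', j) \<in> diagram m1 m2 \<and> p (tab (i, j)) = tab (i', j)) \<longleftrightarrow>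
      (\<forall>q<r. p q = q \<or> p q = partner q)" (is "?L \<longleftrightarrow> ?R")
  proof
    assume L: ?L
    show ?R
    proof (intro allI impI)
      fix q assume q: "q < r"
      define i j where "i = (if q < m1 then 1 else 2 :: nat)" and "j = (if q < m1 then q else q - m1)"
      have "(i, j) \<in> diagram m1 m2" "tab (i, j) = q"
        using q m by (auto simp: i_def j_def diagram_def tab_def)
      then obtain i' where "(i', j) \<in> diagram m1 m2" "p q = tab (i', j)" using L by fastforce
      then show "p q = q \<or> p q = partner q"
        using q m by (auto simp: i_def j_def diagram_def tab_def partner_def split: if_splits)
    qed
  next
    assume R: ?R
    show ?L
    proof (clarify)
      fix i j assume ij: "(i, j) \<in> diagram m1 m2"
      then have "tab (i, j) < r" using m by (auto simp: diagram_def tab_def)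
      with R consider "p (tab (i, j)) = tab (i, j)" | "p (tab (i, j)) = partner (tab (i, j))" by blast
      then show "\<exists>i'. (i', j) \<in> diagram m1 m2 \<and> p (tab (i, j)) = tab (i', j)"
      proof cases
        case 1 then show ?thesis using ij by blast
      next
        case 2
        then show ?thesis using ij m
          \<comment> \<open>The index \<open>3 - i\<close> is that of the other row.\<close>
          by (intro exI[of _ "if j < m2 then 3 - i else i"])
            (auto simp: diagram_def tab_def partner_def)
      qed
    qed
  qed
  moreover have "p q = q" if "p permutes {..<r}" "\<not> q < r" for q
    using that by (auto simp: permutes_def)
  ultimately show ?thesis unfolding column_stabilizer_def by blast
qed

lemma columns_permutes: "p \<in> columns \<Longrightarrow> p permutes {..<r}"
  by (simp add: columns_iff)

lemma finite_columns [simp]: "finite columns"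
  by (rule finite_subset[OF _ finite_permutations[of "{..<r}"]]) (auto simp: columns_iff)

text \<open>A column has at most two entries, so a position that moves is exchanged with its
  partner.\<close>

lemma columns_involution:
  assumes "p \<in> columns" shows "p (p q) = q"
proof (cases "p q = q")
  case False
  then have "p q = partner q" "p (partner q) = partner q \<or> p (partner q) = q"
    using assms unfolding columns_iff by (metis partner_partner)+
  moreover have "inj p" using assms by (auto simp: columns_iff permutes_inj)
  ultimately show ?thesis using False by (metis injD)
qed simp

lemma columns_comp:
  assumes "c \<in> columns" "p \<in> columns" shows "c \<circ> p \<in> columns"
  using assms permutes_compose[of p "{..<r}" c] unfolding columns_iff comp_apply
  by (metis partner_partner)

lemma columns_comp_cancel:
  assumes "c \<in> columns" shows "c \<circ> (c \<circ> p) = p"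
  using columns_involution[OF assms] by (simp add: fun_eq_iff)

definition column_swap :: "nat \<Rightarrow> nat \<Rightarrow> nat" where
  "column_swap j = transpose j (m1 + j)"

lemma column_swap: "j < m2 \<Longrightarrow> column_swap j \<in> columns"
  unfolding columns_iff column_swap_def using m
  by (intro conjI permutes_swap_id) (auto simp: transpose_def partner_def)

text \<open>The signed column sum from the construction of Specht modules; the signs disappear in
  characteristic two.\<close>

definition column_sum :: "'k tensor \<Rightarrow> 'k tensor" where
  "column_sum v = (\<Sum>p\<in>columns. perm_act p v)"

lemma column_sum_apply: "column_sum v u = (\<Sum>p\<in>columns. v (u \<circ> p))"
  by (simp add: column_sum_def fun_sum_apply perm_act_def)

lemma column_sum_comp:
  assumes c: "c \<in> columns" shows "column_sum v (u \<circ> c) = column_sum v u"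
  unfolding column_sum_apply
  by (rule sum.reindex_bij_witness[where i = "\<lambda>p. c \<circ> p" and j = "\<lambda>p. c \<circ> p"])
    (simp_all add: columns_comp c columns_comp_cancel comp_assoc)

text \<open>Swapping column \<open>j\<close> fixes \<open>u\<close>, and composition with this swap
  is an involution without fixed points on the column group, so the terms cancel in pairs.\<close>

lemma column_sum_eq_0:
  assumes j: "j < m2" and u: "u j = u (m1 + j)"
  shows "column_sum v u = 0"
  unfolding column_sum_apply
proof (rule sum_involution_char_2[OF char finite_columns, where i = "\<lambda>p. column_swap j \<circ> p"])
  fix p assume p: "p \<in> columns"
  note c = column_swap[OF j]
  show "column_swap j \<circ> p \<in> columns" "column_swap j \<circ> (column_swap j \<circ> p) = p"
    using columns_comp[OF c p] columns_comp_cancel[OF c] by auto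
  show "column_swap j \<circ> p \<noteq> p"
  proof
    assume "column_swap j \<circ> p = p"
    then have "column_swap j (p (p j)) = p (p j)" by (metis comp_apply)
    then show False using columns_involution[OF p] j m by (simp add: column_swap_def)
  qed
  have "u \<circ> column_swap j = u"
    using u by (auto simp: fun_eq_iff column_swap_def transpose_def)
  then show "v (u \<circ> (column_swap j \<circ> p)) = v (u \<circ> p)" by (metis comp_assoc)
qed

section \<open>Words with exactly one two in every column of length two\<close>

definition transversal_words :: "nat \<Rightarrow> nat \<Rightarrow> word set" where
  "transversal_words l1 l2 = {u \<in> weight_words r l1 l2. \<forall>j<m2. u j \<noteq> u (m1 + j)}"

text \<open>Representatives of the orbits of the column group on the transversal words, one for each
  orbit.\<close>

definition standard_words :: "nat \<Rightarrow> nat \<Rightarrow> word set" where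
  "standard_words l1 l2 = {u \<in> weight_words r l1 l2. \<forall>j<m2. u j = 1 \<and> u (m1 + j) = 2}"

text \<open>The vector \<open>z\<close> of the overview; for \<open>l1 = m1\<close> and
  \<open>l2 = m2\<close> it is the polytabloid of \<open>tab\<close>.\<close>

definition column_vec :: "nat \<Rightarrow> nat \<Rightarrow> 'k tensor" where
  "column_vec l1 l2 = (\<lambda>u. of_bool (u \<in> transversal_words l1 l2))"

lemma standard_transversal: "u \<in> standard_words l1 l2 \<Longrightarrow> u \<in> transversal_words l1 l2"
  by (simp add: standard_words_def transversal_words_def)

lemma transversal_neq_partner:
  assumes "\<And>j. j < m2 \<Longrightarrow> u j \<noteq> u (m1 + j)" and "partner q \<noteq> q"
  shows "u (partner q) \<noteq> u q"
proof (cases "q < m2")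
  case True
  then show ?thesis using assms(1)[of q] by (simp add: partner_def)
next
  case False
  then have q: "m1 \<le> q" "q < r" using assms(2) by (auto simp: partner_def split: if_splits)
  then have "q - m1 < m2" using m by linarith
  then show ?thesis using assms(1)[of "q - m1"] q False by (simp add: partner_def)
qed

text \<open>\<open>c\<close> swaps exactly the columns of length two in which the words disagree; in
  each such column both words use both letters.\<close>

lemma align_columns:
  assumes u: "\<And>j. j < m2 \<Longrightarrow> u j \<noteq> u (m1 + j)" and w: "\<And>j. j < m2 \<Longrightarrow> w j \<noteq> w (m1 + j)"
    and vals: "\<And>q. q < r \<Longrightarrow> u q \<in> {1, 2} \<and> w q \<in> {1, 2 :: nat}"
  obtains c where "c \<in> columns" "\<And>q. partner q \<noteq> q \<Longrightarrow> u (c q) = w q"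
proof -
  define c where "c q = (if u q = w q then q else partner q)" for q
  have lt: "q < r" if "partner q \<noteq> q" for q using that m by (auto simp: partner_def split: if_splits)
  have same: "u (partner q) = w (partner q) \<longleftrightarrow> u q = w q" "u (partner q) = w q \<longleftrightarrow> u q \<noteq> w q"
    if q: "partner q \<noteq> q" for q
  proof -
    have "u (partner q) \<noteq> u q" "w (partner q) \<noteq> w q"
      using transversal_neq_partner[of u] transversal_neq_partner[of w] u w q by auto
    moreover have "u q \<in> {1, 2}" "w q \<in> {1, 2}" "u (partner q) \<in> {1, 2}" "w (partner q) \<in> {1, 2}"
      using vals[of q] vals[of "partner q"] lt[OF q] by auto
    ultimately show "u (partner q) = w (partner q) \<longleftrightarrow> u q = w q" "u (partner q) = w q \<longleftrightarrow> u q \<noteq> w q"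
      by auto
  qed
  have cc: "c (c q) = q" for q
    using same[of q] by (cases "partner q = q") (auto simp: c_def)
  have "c permutes {..<r}"
    unfolding permutes_def
  proof (intro conjI allI impI)
    fix q :: nat assume "q \<notin> {..<r}"
    then show "c q = q" using lt[of q] by (auto simp: c_def)
  next
    fix q show "\<exists>!x. c x = q" using cc by metis
  qed
  then have "c \<in> columns" by (auto simp: columns_iff c_def)
  moreover have "u (c q) = w q" if "partner q \<noteq> q" for q
    using same[OF that] by (auto simp: c_def)
  ultimately show thesis by (rule that)
qed

abbreviation singles :: "nat set" where "singles \<equiv> {m2..<m1}"

lemma single_iff: "q \<in> singles \<longleftrightarrow> q < r \<and> partner q = q"
  using m by (auto simp: partner_def)

lemma singles_permutes:
  assumes "s permutes singles"
  shows "s permutes {..<r}"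
  by (rule permutes_subset[OF assms]) (use m in auto)

lemma weight_words_values: "u \<in> weight_words r l1 l2 \<Longrightarrow> q < r \<Longrightarrow> u q \<in> {1, 2}"
  by (auto simp: weight_words_def words_def PiE_iff)

lemma card_twos_singles:
  assumes l: "l1 + l2 = r" and u: "u \<in> transversal_words l1 l2"
  shows "card {q \<in> singles. u q = 2} + m2 = l2"
proof -
  have uw: "u \<in> weight_words r l1 l2" and ne: "\<And>j. j < m2 \<Longrightarrow> u j \<noteq> u (m1 + j)"
    using u by (auto simp: transversal_words_def)
  let ?P = "twos r u - singles"
  have "bij_betw (\<lambda>j. if u j = 2 then j else m1 + j) {..<m2} ?P"
  proof (rule bij_betwI[where g = "\<lambda>q. if q < m2 then q else q - m1"])
    show "(\<lambda>j. if u j = 2 then j else m1 + j) \<in> {..<m2} \<rightarrow> ?P"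
    proof
      fix j assume j: "j \<in> {..<m2}"
      then have "u j \<in> {1, 2}" "u (m1 + j) \<in> {1, 2}" "u j \<noteq> u (m1 + j)"
        using weight_words_values[OF uw] ne m by auto
      then show "(if u j = 2 then j else m1 + j) \<in> ?P" using j m by (auto simp: twos_def)
    qed
    fix q assume q: "q \<in> ?P"
    then have c: "q < m2 \<or> m1 \<le> q \<and> q < r \<and> \<not> q < m2" using m by (auto simp: twos_def)
    have "u (q - m1) \<noteq> 2" if q1: "m1 \<le> q"
    proof -
      have "q - m1 < m2" using q q1 m by (auto simp: twos_def)
      then show ?thesis using ne[of "q - m1"] q q1 by (auto simp: twos_def)
    qed
    then show "(if u (if q < m2 then q else q - m1) = 2 then if q < m2 then q else q - m1
        else m1 + (if q < m2 then q else q - m1)) = q"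
      using c q by (auto simp: twos_def)
  qed (use m in \<open>auto simp: twos_def split: if_splits\<close>)
  then have "card ?P = m2" using bij_betw_same_card by fastforce
  moreover have "twos r u = {q \<in> singles. u q = 2} \<union> ?P"
    using m by (auto simp: twos_def)
  moreover have "card ({q \<in> singles. u q = 2} \<union> ?P) = card {q \<in> singles. u q = 2} + card ?P"
    by (rule card_Un_disjoint) auto
  ultimately show ?thesis using uw by (simp add: weight_words_iff[OF l])
qed

text \<open>A column sum vanishes on words with equal letters in a column of length two. On the
  other words of this weight, column swaps and permutations of the single positions together act
  transitively, so the value is constant.\<close>

lemma column_sum_proportional:
  assumes l: "l1 + l2 = r" and v: "column_sum v \<in> perm_module r l1 l2"
    and sym: "\<And>s u. s permutes singles \<Longrightarrow> column_sum v (u \<circ> s) = column_sum v u"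
  shows "\<exists>c. column_sum v = scl c (column_vec l1 l2)"
proof -
  let ?v = "column_sum v"
  have eq: "?v u = ?v w" if uw: "u \<in> transversal_words l1 l2" "w \<in> transversal_words l1 l2" for u w
  proof -
    have W: "u \<in> weight_words r l1 l2" "w \<in> weight_words r l1 l2"
      and ne: "\<And>j. j < m2 \<Longrightarrow> u j \<noteq> u (m1 + j)" "\<And>j. j < m2 \<Longrightarrow> w j \<noteq> w (m1 + j)"
      using uw by (auto simp: transversal_words_def)
    \<comment> \<open>First the columns are aligned, then the single positions are permuted; there
      both words have equally many twos.\<close>
    obtain c where c: "c \<in> columns" "\<And>q. partner q \<noteq> q \<Longrightarrow> u (c q) = w q"
      by (rule align_columns[of u w, OF ne]) (use W weight_words_values in auto)
    have cs: "c q = q" if "q \<in> singles" for q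
      using c(1) that[unfolded single_iff] unfolding columns_iff by metis
    have card2: "card {q \<in> singles. w q = 2} = card {q \<in> singles. u q = 2}"
      using card_twos_singles[OF l uw(1)] card_twos_singles[OF l uw(2)] by simp
    have "card {q \<in> singles. w q = a} = card {q \<in> singles. u q = a}" for a
    proof -
      have one: "{q \<in> singles. x q = 1} = singles - {q \<in> singles. x q = 2}"
        and other: "a \<notin> {1, 2} \<Longrightarrow> {q \<in> singles. x q = a} = {}"
        if "x \<in> weight_words r l1 l2" for x
      proof -
        have val: "x q = 1 \<or> x q = 2" if "q \<in> singles" for q
          using weight_words_values[OF \<open>x \<in> _\<close>, of q] that m by auto
        show "{q \<in> singles. x q = 1} = singles - {q \<in> singles. x q = 2}"
        proof (rule Set.set_eqI)
          fix q show "q \<in> {q \<in> singles. x q = 1} \<longleftrightarrow> q \<in> singles - {q \<in> singles. x q = 2}"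
            using val[of q] by auto
        qed
        show "a \<notin> {1, 2} \<Longrightarrow> {q \<in> singles. x q = a} = {}"
          using val by blast
      qed
      have card1: "card {q \<in> singles. x q = 1} = card singles - card {q \<in> singles. x q = 2}"
        if "x \<in> weight_words r l1 l2" for x
        unfolding one[OF that] by (rule card_Diff_subset) auto
      consider (1) "a = 1" | (2) "a = 2" | (3) "a \<notin> {1, 2}" by blast
      then show ?thesis
      proof cases
        case 1
        show ?thesis unfolding 1 card1[OF W(1)] card1[OF W(2)] card2 ..
      next
        case 2
        show ?thesis unfolding 2 by (rule card2)
      next
        case 3
        show ?thesis unfolding other[OF W(1) 3] other[OF W(2) 3] ..
      qed
    qed
    from permutes_of_equal_fibres[OF _ this]
    obtain s where s: "s permutes singles" "\<And>q. q \<in> singles \<Longrightarrow> w q = u (s q)" by blast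
    have "(u \<circ> c) \<circ> s = w"
    proof
      fix q
      show "((u \<circ> c) \<circ> s) q = w q"
      proof (cases "q \<in> singles")
        case True
        then have "s q \<in> singles" using permutes_in_image[OF s(1)] by blast
        then show ?thesis using s(2)[OF True] cs by simp
      next
        case False
        then have sq: "s q = q" using s(1) by (auto simp: permutes_def)
        show ?thesis
        proof (cases "q < r")
          case True
          then show ?thesis using sq False[unfolded single_iff] c(2)[of q] by auto
        next
          case nl: False
          then have "c q = q" using columns_permutes[OF c(1)] by (auto simp: permutes_def)
          then show ?thesis using sq nl W
            by (auto simp: weight_words_def words_def PiE_iff extensional_def)
        qed
      qed
    qed
    then have "?v w = ?v ((u \<circ> c) \<circ> s)" by simp
    also have "\<dots> = ?v (u \<circ> c)" by (rule sym[OF s(1)])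
    also have "\<dots> = ?v u" by (rule column_sum_comp[OF c(1)])
    finally show ?thesis by simp
  qed
  have zero: "?v u = 0" if nt: "u \<notin> transversal_words l1 l2" for u
  proof (cases "u \<in> weight_words r l1 l2")
    case True
    then obtain j where "j < m2" "u j = u (m1 + j)" using nt by (auto simp: transversal_words_def)
    then show ?thesis by (rule column_sum_eq_0)
  next
    case False
    then show ?thesis using v by (simp add: perm_module_def)
  qed
  show ?thesis
  proof (cases "transversal_words l1 l2 = {}")
    case True
    then show ?thesis using zero by (intro exI[of _ 0]) (auto simp: scl_def fun_eq_iff)
  next
    case False
    then obtain w where w: "w \<in> transversal_words l1 l2" by blast
    have "?v u = scl (?v w) (column_vec l1 l2) u" for u
      using eq[OF _ w, of u] zero[of u] by (cases "u \<in> transversal_words l1 l2") (auto simp: scl_def column_vec_def)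
    then show ?thesis by (intro exI[of _ "?v w"] ext)
  qed
qed

section \<open>Standard words: their number and their column sum\<close>

lemma standard_words_iff:
  assumes l: "l1 + l2 = r"
  shows "u \<in> standard_words l1 l2 \<longleftrightarrow>
    u \<in> words r \<and> {m1..<r} \<subseteq> twos r u \<and> twos r u \<subseteq> {m2..<r} \<and> card (twos r u) = l2"
proof -
  have "(\<forall>j<m2. u j = 1 \<and> u (m1 + j) = 2) \<longleftrightarrow> {m1..<r} \<subseteq> twos r u \<and> twos r u \<subseteq> {m2..<r}"
    if u: "u \<in> words r"
  proof
    assume L: "\<forall>j<m2. u j = 1 \<and> u (m1 + j) = 2"
    have "u q = 2" if "q \<in> {m1..<r}" for q
      using L[rule_format, of "q - m1"] that m by auto
    moreover have "q \<ge> m2" if "u q = 2" for q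
      using L[rule_format, of q] that by (cases "q < m2") auto
    ultimately show "{m1..<r} \<subseteq> twos r u \<and> twos r u \<subseteq> {m2..<r}"
      by (auto simp: twos_def)
  next
    assume R: "{m1..<r} \<subseteq> twos r u \<and> twos r u \<subseteq> {m2..<r}"
    show "\<forall>j<m2. u j = 1 \<and> u (m1 + j) = 2"
    proof (intro allI impI)
      fix j assume j: "j < m2"
      then have "u j \<in> {1, 2}" "j \<notin> twos r u" "m1 + j \<in> twos r u"
        using u R m by (auto simp: words_def PiE_iff)
      then show "u j = 1 \<and> u (m1 + j) = 2" using j m by (auto simp: twos_def)
    qed
  qed
  then show ?thesis unfolding standard_words_def weight_words_iff[OF l] by auto
qed

lemma bij_betw_twos_standard:
  assumes l: "l1 + l2 = r"
  shows "bij_betw (twos r) (standard_words l1 l2) {X. {m1..<r} \<subseteq> X \<and> X \<subseteq> {m2..<r} \<and> card X = l2}"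
proof (rule bij_betwI[where g = "word_of r"])
  have "twos r (word_of r X) = X" if "X \<subseteq> {m2..<r}" for X
    using that by (intro twos_word_of) auto
  then show "word_of r \<in> {X. {m1..<r} \<subseteq> X \<and> X \<subseteq> {m2..<r} \<and> card X = l2} \<rightarrow> standard_words l1 l2"
    "\<And>X. X \<in> {X. {m1..<r} \<subseteq> X \<and> X \<subseteq> {m2..<r} \<and> card X = l2} \<Longrightarrow> twos r (word_of r X) = X"
    by (auto simp: standard_words_iff[OF l])
qed (auto simp: standard_words_iff[OF l] word_of_twos)

lemma finite_standard_words [simp]: "finite (standard_words l1 l2)"
  by (rule finite_subset[OF _ finite_weight_words]) (auto simp: standard_words_def)

text \<open>The columns of length two are prescribed; the remaining \<open>l2 - m2\<close> twos are
  placed freely in the \<open>m1 - m2\<close> columns of length one.\<close>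

lemma card_standard_words:
  assumes l: "l1 + l2 = r" and "m2 \<le> l2"
  shows "card (standard_words l1 l2) = (m1 - m2) choose (l2 - m2)"
proof -
  have "card (standard_words l1 l2) = card {X. {m1..<r} \<subseteq> X \<and> X \<subseteq> {m2..<r} \<and> card X = l2}"
    by (rule bij_betw_same_card[OF bij_betw_twos_standard[OF l]])
  also have "\<dots> = (m1 - m2) choose (l2 - m2)"
  proof (subst card_subsets_between)
    have "card {m1..<r} = m2" "card {m2..<r} - m2 = m1 - m2" using m by auto
    then show "(if card {m1..<r} \<le> l2 then (card {m2..<r} - card {m1..<r}) choose (l2 - card {m1..<r}) else 0) =
        (m1 - m2) choose (l2 - m2)"
      using assms by simp
  qed (use m in auto)
  finally show ?thesis .
qed

lemma standard_words_self: "standard_words m1 m2 = {word_of r {m1..<r}}"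
proof -
  have "{X. {m1..<r} \<subseteq> X \<and> X \<subseteq> {m2..<r} \<and> card X = m2} = {{m1..<r}}"
  proof -
    have "X = {m1..<r}" if "{m1..<r} \<subseteq> X" "X \<subseteq> {m2..<r}" "card X = m2" for X
      using that m card_subset_eq[of X "{m1..<r}"] finite_subset[of X "{m2..<r}"] by auto
    then show ?thesis using m by auto
  qed
  then have "word_of r ` twos r ` standard_words m1 m2 = {word_of r {m1..<r}}"
    using bij_betw_imp_surj_on[OF bij_betw_twos_standard[OF m(2)]] by simp
  moreover have "word_of r ` twos r ` standard_words m1 m2 = standard_words m1 m2"
    by (force simp: standard_words_iff[OF m(2)] word_of_twos image_image)
  ultimately show ?thesis by simp
qed

text \<open>Exactly one column permutation brings a transversal word into standard form; at all
  other words the column sum is zero.\<close>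

lemma column_vec_column_sum:
  "column_vec l1 l2 = column_sum (\<lambda>u. of_bool (u \<in> standard_words l1 l2))"
proof
  fix u
  show "column_vec l1 l2 u = column_sum (\<lambda>u. of_bool (u \<in> standard_words l1 l2)) u"
  proof (cases "u \<in> transversal_words l1 l2")
    case True
    then have W: "u \<in> weight_words r l1 l2" and ne: "\<And>j. j < m2 \<Longrightarrow> u j \<noteq> u (m1 + j)"
      by (auto simp: transversal_words_def)
    \<comment> \<open>Only the letters of \<open>w\<close> in columns of length two matter: they
      form the pattern common to all standard words.\<close>
    define w where "w = word_of r {m1..<r}"
    have w: "w j = 1" "w (m1 + j) = 2" if "j < m2" for j
      using that m by (auto simp: w_def word_of_def)
    obtain c where c: "c \<in> columns" "\<And>q. partner q \<noteq> q \<Longrightarrow> u (c q) = w q"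
    proof (rule align_columns[of u w, OF ne])
      show "u q \<in> {1, 2} \<and> w q \<in> {1, 2}" if "q < r" for q
        using weight_words_values[OF W that] that by (simp add: w_def word_of_def)
    qed (use w in auto)
    have pn: "partner j \<noteq> j" "partner (m1 + j) \<noteq> m1 + j" if "j < m2" for j
      using that m by (auto simp: partner_def)
    have "u \<circ> p \<in> standard_words l1 l2 \<longleftrightarrow> p = c" if p: "p \<in> columns" for p
    proof
      assume std: "u \<circ> p \<in> standard_words l1 l2"
      show "p = c"
      proof
        fix q
        show "p q = c q"
        proof (cases "partner q = q")
          case True
          then show ?thesis using p c(1) unfolding columns_iff by metis
        next
          case False
          then have "q < m2 \<or> m1 \<le> q \<and> q - m1 < m2 \<and> q = m1 + (q - m1)"
            using m by (auto simp: partner_def split: if_splits)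
          moreover have "u (p j) = 1" "u (p (m1 + j)) = 2" if "j < m2" for j
            using std that by (auto simp: standard_words_def)
          ultimately have "u (p q) = w q" using w by metis
          then have "u (p q) = u (c q)" using c(2)[OF False] by simp
          moreover have "u (partner q) \<noteq> u q" by (rule transversal_neq_partner[of u q, OF ne False])
          ultimately show ?thesis using p c(1) unfolding columns_iff by metis
        qed
      qed
    next
      assume "p = c"
      then show "u \<circ> p \<in> standard_words l1 l2"
        using W c w pn weight_words_comp_iff[OF columns_permutes[OF p]]
        by (auto simp: standard_words_def)
    qed
    then have "column_sum (\<lambda>u. of_bool (u \<in> standard_words l1 l2)) u = (\<Sum>p\<in>columns. if p = c then 1 else 0)"
      unfolding column_sum_apply by (intro sum.cong) auto
    then show ?thesis using True c(1) by (simp add: column_vec_def)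
  next
    case False
    have "column_sum (\<lambda>u. of_bool (u \<in> standard_words l1 l2)) u = 0"
    proof (cases "u \<in> weight_words r l1 l2")
      case True
      then obtain j where "j < m2" "u j = u (m1 + j)" using False by (auto simp: transversal_words_def)
      then show ?thesis by (rule column_sum_eq_0)
    next
      case nw: False
      then have "u \<circ> p \<notin> standard_words l1 l2" if "p \<in> columns" for p
        using weight_words_comp_iff[OF columns_permutes[OF that]] by (auto simp: standard_words_def)
      then show ?thesis unfolding column_sum_apply by (intro sum.neutral) auto
    qed
    then show ?thesis using False by (simp add: column_vec_def)
  qed
qed

section \<open>Equivariant images of the column vector\<close>

lemma column_sum_sym_hom:
  assumes "sym_hom r f" shows "f (column_sum v) = column_sum (f v)"
  unfolding column_sum_def sym_hom_sum[OF assms]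
  using assms by (intro sum.cong) (auto simp: sym_hom_def columns_permutes)

lemma singles_fix:
  assumes "s permutes singles" "j < m2" shows "s j = j" "s (m1 + j) = m1 + j"
  using assms by (auto simp: permutes_def)

lemma column_vec_singles:
  assumes s: "s permutes singles" shows "perm_act s (column_vec l1 l2) = column_vec l1 l2"
  using weight_words_comp_iff[OF singles_permutes[OF s]] singles_fix[OF s]
  by (auto simp: fun_eq_iff perm_act_def column_vec_def transversal_words_def)

text \<open>An equivariant map commutes with column sums and preserves invariance under permutations
  of the single positions, so \<open>column_sum_proportional\<close> applies to the image.\<close>

lemma sym_hom_column_vec:
  assumes f: "sym_hom r f" and l: "l1 + l2 = r" and "f (column_vec a1 a2) \<in> perm_module r l1 l2"
  shows "\<exists>c. f (column_vec a1 a2) = scl c (column_vec l1 l2)"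
proof -
  have eq: "f (column_vec a1 a2) = column_sum (f (\<lambda>u. of_bool (u \<in> standard_words a1 a2)))"
    unfolding column_vec_column_sum by (rule column_sum_sym_hom[OF f])
  have "f (column_vec a1 a2) (u \<circ> s) = f (column_vec a1 a2) u" if s: "s permutes singles" for s u
  proof -
    have "f (column_vec a1 a2) = f (perm_act s (column_vec a1 a2))" by (simp only: column_vec_singles[OF s])
    also have "\<dots> = perm_act s (f (column_vec a1 a2))"
      using f singles_permutes[OF s] by (simp add: sym_hom_def)
    finally show ?thesis unfolding perm_act_def by metis
  qed
  then show ?thesis
    using column_sum_proportional[OF l] assms(3) unfolding eq by blast
qed

text \<open>Each of the \<open>m2\<close> columns of length two would need a two.\<close>

lemma transversal_words_empty:
  assumes "l1 + l2 = r" "l2 < m2" shows "column_vec l1 l2 = 0"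
  using card_twos_singles[OF assms(1)] assms(2) by (fastforce simp: column_vec_def fun_eq_iff)

section \<open>The polytabloid\<close>

lemma tab_tableau: "tableau r m1 m2 tab"
  unfolding tableau_def
  by (rule bij_betwI[where g = "\<lambda>q. if q < m1 then (1, q) else (2, q - m1)"])
    (use m in \<open>auto simp: tab_def diagram_def split: if_splits\<close>)

lemma tabloid_tab: "tabloid r m1 m2 tab = word_of r {m1..<r}"
proof -
  have inj: "inj_on tab (diagram m1 m2)" using tab_tableau by (auto simp: tableau_def bij_betw_def)
  have "the_inv_into (diagram m1 m2) tab q = (if q < m1 then (1, q) else (2, q - m1))" if "q < r" for q
    by (rule the_inv_into_f_eq[OF inj]) (use that m in \<open>auto simp: tab_def diagram_def\<close>)
  then show ?thesis by (auto simp: tabloid_def word_of_def fun_eq_iff)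
qed

text \<open>The signs are one in characteristic two, and the tabloid of \<open>tab\<close> is the
  only standard word of its own weight.\<close>

lemma polytabloid_tab: "polytabloid r m1 m2 tab = column_vec m1 m2"
proof -
  have "(2::'k) = 0" using of_nat_CHAR[where 'a = 'k] char by simp
  then have "a + a = 0" for a :: 'k by (simp flip: mult_2)
  then have neg: "- a = a" for a :: 'k by (rule minus_unique)
  have "scl (of_int (sign p)) v = (v :: 'k tensor)" for p :: "nat \<Rightarrow> nat" and v
    by (simp add: scl_def sign_def neg fun_eq_iff)
  then have "polytabloid r m1 m2 tab = column_sum (bvec (word_of r {m1..<r}))"
    unfolding polytabloid_def column_sum_def tabloid_tab by simp
  also have "bvec (word_of r {m1..<r}) = (\<lambda>u. of_bool (u \<in> standard_words m1 m2))"
    by (auto simp: standard_words_self bvec_def)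
  finally show ?thesis by (simp add: column_vec_column_sum)
qed

lemma column_vec_specht: "column_vec m1 m2 \<in> specht_module r m1 m2"
  unfolding specht_module_def polytabloid_tab[symmetric]
  by (rule tensor.span_base) (use tab_tableau in blast)

lemma word_of_transversal: "word_of r {m1..<r} \<in> transversal_words m1 m2"
  using standard_words_self standard_transversal by blast

lemma column_vec_neq_0: "column_vec m1 m2 \<noteq> 0"
proof
  assume "column_vec m1 m2 = 0"
  then have "column_vec m1 m2 (word_of r {m1..<r}) = 0" by simp
  then show False using word_of_transversal by (simp add: column_vec_def)
qed

end

section \<open>Scalars by which equivariant maps act on the column vector\<close>

context two_rows
begin

lemma columns_singles_commute:
  assumes p: "p \<in> columns" and s: "s permutes singles"
  shows "s \<circ> p = p \<circ> s"
proof
  fix q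
  have fix_p: "p x = x" if "x \<in> singles" for x
    using p that[unfolded single_iff] unfolding columns_iff by metis
  show "(s \<circ> p) q = (p \<circ> s) q"
  proof (cases "q \<in> singles")
    case True
    then have "s q \<in> singles" using permutes_in_image[OF s] by blast
    then show ?thesis using fix_p True by simp
  next
    case False
    have "p q \<notin> singles"
    proof
      assume pq: "p q \<in> singles"
      then have "p (p q) = p q" by (rule fix_p)
      then show False using False pq columns_involution[OF p, of q] by simp
    qed
    then show ?thesis using False s by (simp add: permutes_def)
  qed
qed

text \<open>The scalar is read off at \<open>w0\<close>. With the column vector written as the
  column sum of the standard words, equivariance moves the column sum to \<open>y\<close>, the row
  \<open>w0\<close> of the matrix of \<open>x\<close>. There it is \<open>c\<close> times the column
  vector, so every standard word contributes the same \<open>c\<close>, and the binomial coefficient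
  is their number.\<close>

lemma sym_hom_column_vec_self:
  assumes x: "sym_hom r x" and xm: "\<And>v. x v \<in> perm_module r m1 m2"
    and l: "l1 + l2 = r" and le: "m2 \<le> l2"
  shows "\<exists>c. x (column_vec l1 l2) = scl (c * of_nat ((m1 - m2) choose (l2 - m2))) (column_vec m1 m2)"
proof -
  define w0 where "w0 = word_of r {m1..<r}"
  let ?R = "standard_words l1 l2"
  \<comment> \<open>the image of \<open>w0\<close> under the transpose of \<open>x\<close>\<close>
  define y :: "'k tensor" where "y u = (if u \<in> weight_words r l1 l2 then x (bvec u) w0 else 0)" for u
  have xp: "x (bvec (u \<circ> p)) w = x (bvec u) (w \<circ> inv_into UNIV p)" if p: "p permutes {..<r}" for p u w
  proof -
    have "bvec (u \<circ> p) = perm_act (inv_into UNIV p) (bvec u :: 'k tensor)"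
      by (simp add: perm_act_bvec[OF permutes_inv[OF p]] permutes_inv_inv[OF p])
    then have "x (bvec (u \<circ> p)) = perm_act (inv_into UNIV p) (x (bvec u))"
      using x permutes_inv[OF p] by (simp add: sym_hom_def)
    then show ?thesis by (simp add: perm_act_def)
  qed
  \<comment> \<open>The word \<open>w0\<close> is constantly one on the single positions.\<close>
  have ys: "y (u \<circ> s) = y u" if s: "s permutes singles" for s u
  proof -
    have "w0 \<circ> inv_into UNIV s = w0"
    proof
      fix q
      note si = permutes_inv[OF s]
      show "(w0 \<circ> inv_into UNIV s) q = w0 q"
      proof (cases "q \<in> singles")
        case True
        then have "inv_into UNIV s q \<in> singles" using permutes_in_image[OF si] by blast
        then show ?thesis using True m by (auto simp: w0_def word_of_def)
      next
        case False
        then show ?thesis using si by (simp add: permutes_def)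
      qed
    qed
    then show ?thesis
      using xp[OF singles_permutes[OF s]] weight_words_comp_iff[OF singles_permutes[OF s]]
      by (simp add: y_def)
  qed
  have "column_sum y (u \<circ> s) = column_sum y u" if s: "s permutes singles" for s u
    unfolding column_sum_apply
    by (intro sum.cong refl) (metis columns_singles_commute[OF _ s] comp_assoc ys[OF s])
  moreover have "column_sum y \<in> perm_module r l1 l2"
    unfolding perm_module_def column_sum_apply
    using weight_words_comp_iff[OF columns_permutes] by (auto simp: y_def intro!: sum.neutral)
  ultimately obtain c where c: "column_sum y = scl c (column_vec l1 l2)"
    using column_sum_proportional[OF l] by blast
  obtain c' where c': "x (column_vec l1 l2) = scl c' (column_vec m1 m2)"
    using sym_hom_column_vec[OF x m(2) xm] by blast
  have "c' = x (column_vec l1 l2) w0"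
    unfolding c' using word_of_transversal by (simp add: scl_def column_vec_def w0_def)
  also have "column_vec l1 l2 = column_sum (\<Sum>u\<in>?R. bvec u)"
  proof -
    have "(\<lambda>u. of_bool (u \<in> ?R)) = (\<Sum>u\<in>?R. bvec u :: 'k tensor)"
      by (rule ext) (simp add: fun_sum_apply bvec_def)
    then show ?thesis by (simp only: column_vec_column_sum)
  qed
  also have "x (column_sum (\<Sum>u\<in>?R. bvec u)) w0 = (\<Sum>p\<in>columns. \<Sum>u\<in>?R. x (bvec u) (w0 \<circ> p))"
    by (simp add: column_sum_sym_hom[OF x] sym_hom_sum[OF x] column_sum_apply fun_sum_apply)
  also have "\<dots> = (\<Sum>p\<in>columns. \<Sum>u\<in>?R. y (u \<circ> p))"
  proof (intro sum.cong refl)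
    fix p u assume p: "p \<in> columns" and u: "u \<in> ?R"
    \<comment> \<open>Column permutations are their own inverses, so \<open>p\<close> can be moved
      unchanged from \<open>w0\<close> to \<open>u\<close>.\<close>
    have "p \<circ> p = id" using columns_involution[OF p] by (simp add: fun_eq_iff)
    then have "inv_into UNIV p = p" by (rule inv_unique_comp) (use \<open>p \<circ> p = id\<close> in simp)
    moreover have "u \<circ> p \<in> weight_words r l1 l2"
      using u weight_words_comp_iff[OF columns_permutes[OF p]] by (simp add: standard_words_def)
    ultimately show "x (bvec u) (w0 \<circ> p) = y (u \<circ> p)"
      using xp[OF columns_permutes[OF p], of u w0] by (simp add: y_def)
  qed
  also have "\<dots> = (\<Sum>u\<in>?R. column_sum y u)"
    unfolding column_sum_apply by (rule sum.swap)
  also have "\<dots> = (\<Sum>u\<in>?R. c)"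
    unfolding c by (intro sum.cong) (auto simp: scl_def column_vec_def standard_transversal)
  also have "\<dots> = c * of_nat ((m1 - m2) choose (l2 - m2))"
    by (simp add: card_standard_words[OF l le] mult.commute)
  finally show ?thesis using c' by blast
qed

lemma transversal_swap:
  assumes "w \<in> transversal_words l1 l2" "j < m2"
  shows "w \<circ> column_swap j \<in> transversal_words l1 l2"
proof -
  have "w (column_swap j i) \<noteq> w (column_swap j (m1 + i))" if "i < m2" for i
    using assms that m by (cases "i = j") (auto simp: column_swap_def transversal_words_def transpose_def)
  then show ?thesis
    using assms weight_words_comp_iff[OF columns_permutes[OF column_swap[OF assms(2)]]]
    by (simp add: transversal_words_def)
qed

text \<open>By equivariance only a scalar is to be found; it is read off at a standard word
  \<open>u\<close>. A subset \<open>P\<close> of its twos that misses part of the second row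
  contributes zero, by swapping a missed column. Any other \<open>P\<close> lies in the twos of
  \<open>(l1 - m2 + i) choose i\<close> transversal words, all standard, and there are
  \<open>(l2 - m2) choose i\<close> such \<open>P\<close>.\<close>

lemma b_elem_column_vec:
  assumes l: "l1 + l2 = r" "l2 \<le> l1" and le: "m2 \<le> l2"
  shows "b_elem r l1 l2 i (column_vec l1 l2) =
    scl (of_nat (((l2 - m2) choose i) * ((l1 - m2 + i) choose i))) (column_vec l1 l2)"
proof -
  let ?z = "column_vec l1 l2 :: 'k tensor"
  let ?W = "weight_words r l1 l2" and ?T = "transversal_words l1 l2"
  have "b_elem r l1 l2 i ?z \<in> perm_module r l1 l2"
    by (simp add: perm_module_def b_elem_meet_count[OF l(1)])
  then obtain c where c: "b_elem r l1 l2 i ?z = scl c ?z"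
    using sym_hom_column_vec[OF sym_hom_corner[OF b_elem_closed] l(1)] by blast
  have "card (standard_words l1 l2) \<noteq> 0"
    unfolding card_standard_words[OF l(1) le] using l le m by (simp add: binomial_eq_0_iff)
  then obtain u where u: "u \<in> standard_words l1 l2" by (metis card.empty ex_in_conv)
  define U where "U = twos r u"
  have uW: "u \<in> ?W" using u by (simp add: standard_words_def)
  have U: "{m1..<r} \<subseteq> U" "U \<subseteq> {m2..<r}" "card U = l2"
    using u by (auto simp: standard_words_iff[OF l(1)] U_def)
  have finU: "finite U" by (simp add: U_def)
  define \<P> where "\<P> = {P. P \<subseteq> U \<and> card P + i = l2}"
  have finP: "finite \<P>" using finU by (simp add: \<P>_def)
  have T_W: "?T \<subseteq> ?W" by (auto simp: transversal_words_def)
  have finT: "finite ?T" by (rule finite_subset[OF T_W]) simp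
  have inner: "(\<Sum>w\<in>?T. of_bool (P \<subseteq> twos r w)) =
      (if {m1..<r} \<subseteq> P then of_nat ((l1 - m2 + i) choose i) else (0::'k))" if P: "P \<in> \<P>" for P
  proof (cases "{m1..<r} \<subseteq> P")
    case True
    have P': "P \<subseteq> {m2..<r}" "card P + i = l2" using P U by (auto simp: \<P>_def)
    have "(\<Sum>w\<in>?T. of_bool (P \<subseteq> twos r w)) = (of_nat (card (?T \<inter> {w. P \<subseteq> twos r w})) :: 'k)"
      using finT by simp
    also have "?T \<inter> {w. P \<subseteq> twos r w} = {w \<in> standard_words l1 l2. P \<subseteq> twos r w}"
    proof -
      have "w \<in> standard_words l1 l2" if w: "w \<in> ?T" "P \<subseteq> twos r w" for w
      proof -
        have "w j = 1 \<and> w (m1 + j) = 2" if j: "j < m2" for j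
        proof -
          have "m1 + j \<in> {m1..<r}" using j m by auto
          then have "m1 + j \<in> twos r w" using True w(2) by blast
          moreover have "w j \<noteq> w (m1 + j)" "w j \<in> {1, 2}"
            using w(1) j m weight_words_values[of w l1 l2 j] by (auto simp: transversal_words_def)
          ultimately show ?thesis by (auto simp: twos_def)
        qed
        then show ?thesis using w(1) by (simp add: transversal_words_def standard_words_def)
      qed
      then show ?thesis using standard_transversal by auto
    qed
    also have "card {w \<in> standard_words l1 l2. P \<subseteq> twos r w} = card {X. P \<subseteq> X \<and> X \<subseteq> {m2..<r} \<and> card X = l2}"
    proof (rule bij_betw_same_card[of "twos r"], rule bij_betw_imageI)
      note bij = bij_betw_twos_standard[OF l(1)]
      show "inj_on (twos r) {w \<in> standard_words l1 l2. P \<subseteq> twos r w}"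
        using bij_betw_imp_inj_on[OF bij] by (rule inj_on_subset) auto
      have "X \<in> twos r ` {w \<in> standard_words l1 l2. P \<subseteq> twos r w}"
        if X: "P \<subseteq> X" "X \<subseteq> {m2..<r}" "card X = l2" for X
      proof -
        have "X \<in> twos r ` standard_words l1 l2"
          using bij_betw_imp_surj_on[OF bij] X True by auto
        then show ?thesis using X by auto
      qed
      then show "twos r ` {w \<in> standard_words l1 l2. P \<subseteq> twos r w} = {X. P \<subseteq> X \<and> X \<subseteq> {m2..<r} \<and> card X = l2}"
        by (auto simp: standard_words_iff[OF l(1)])
    qed
    also have "\<dots> = (l1 - m2 + i) choose i"
    proof -
      have "card {m2..<r} - card P = l1 - m2 + i" "l2 - card P = i" using P' l le m by auto
      then show ?thesis using card_subsets_between[of "{m2..<r}" P l2] P' by simp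
    qed
    finally show ?thesis using True by simp
  next
    case False
    then obtain q where q: "q \<in> {m1..<r}" "q \<notin> P" by blast
    define j where "j = q - m1"
    have j: "j < m2" "q = m1 + j" using q m by (auto simp: j_def)
    \<comment> \<open>As \<open>u\<close> is standard, \<open>P\<close> contains neither entry of
      column \<open>j\<close>, so swapping this column does not affect the condition on
      \<open>w\<close>.\<close>
    have jP: "j \<notin> P" using P U j by (auto simp: \<P>_def)
    have swap_P: "column_swap j x = x" if "x \<in> P" for x
      using that jP q j by (auto simp: column_swap_def transpose_def)
    have sub: "P \<subseteq> twos r w \<longleftrightarrow> (\<forall>x\<in>P. x < r \<and> w x = 2)" for w by (auto simp: twos_def)
    have "(\<Sum>w\<in>?T. of_bool (P \<subseteq> twos r w)) = (0::'k)"
    proof (rule sum_involution_char_2[OF char finT, where i = "\<lambda>w. w \<circ> column_swap j"])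
      fix w assume w: "w \<in> ?T"
      show "w \<circ> column_swap j \<in> ?T" by (rule transversal_swap[OF w j(1)])
      show "w \<circ> column_swap j \<circ> column_swap j = w"
        by (simp add: fun_eq_iff column_swap_def)
      show "w \<circ> column_swap j \<noteq> w"
      proof
        assume "w \<circ> column_swap j = w"
        then have "w (column_swap j j) = w j" by (metis comp_apply)
        then have "w (m1 + j) = w j" by (simp add: column_swap_def)
        moreover have "w j \<noteq> w (m1 + j)" using w j(1) unfolding transversal_words_def by blast
        ultimately show False by simp
      qed
      show "of_bool (P \<subseteq> twos r (w \<circ> column_swap j)) = (of_bool (P \<subseteq> twos r w) :: 'k)"
        unfolding sub using swap_P by auto
    qed
    then show ?thesis using False by simp
  qed
  \<comment> \<open>Such a \<open>P\<close> arises by deleting \<open>i\<close> of the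
    \<open>l2 - m2\<close> twos of \<open>u\<close> in columns of length one.\<close>
  have number: "card {P \<in> \<P>. {m1..<r} \<subseteq> P} = (l2 - m2) choose i"
  proof (cases "i \<le> l2")
    case True
    then have "{P \<in> \<P>. {m1..<r} \<subseteq> P} = {P. {m1..<r} \<subseteq> P \<and> P \<subseteq> U \<and> card P = l2 - i}"
      by (auto simp: \<P>_def)
    moreover have "card {m1..<r} = m2" using m by simp
    ultimately have "card {P \<in> \<P>. {m1..<r} \<subseteq> P} =
        (if m2 \<le> l2 - i then (l2 - m2) choose (l2 - i - m2) else 0)"
      using card_subsets_between[OF finU U(1), of "l2 - i"] U(3) by simp
    moreover have "l2 - i - m2 = l2 - m2 - i" by simp
    ultimately show ?thesis
      using True le binomial_symmetric[of i "l2 - m2"] by (auto simp: binomial_eq_0)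
  next
    case False
    then have "\<P> = {}" by (auto simp: \<P>_def)
    then show ?thesis using False by (simp add: binomial_eq_0)
  qed
  have "c = b_elem r l1 l2 i ?z u"
    unfolding c using standard_transversal[OF u] by (simp add: scl_def column_vec_def)
  also have "\<dots> = (\<Sum>w\<in>?W. ?z w * of_nat (meet_count l2 i U (twos r w)))"
    using uW by (simp add: b_elem_meet_count[OF l(1)] U_def)
  also have "\<dots> = (\<Sum>w\<in>?T. of_nat (meet_count l2 i U (twos r w)))"
    by (rule sum.mono_neutral_cong_right) (use T_W in \<open>auto simp: column_vec_def\<close>)
  also have "\<dots> = (\<Sum>w\<in>?T. \<Sum>P\<in>\<P>. of_bool (P \<subseteq> twos r w))"
    by (intro sum.cong refl) (simp add: meet_count_sum finU \<P>_def del: sum_of_bool_eq)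
  also have "\<dots> = (\<Sum>P\<in>\<P>. \<Sum>w\<in>?T. of_bool (P \<subseteq> twos r w))"
    by (rule sum.swap)
  also have "\<dots> = (\<Sum>P\<in>\<P>. if {m1..<r} \<subseteq> P then of_nat ((l1 - m2 + i) choose i) else 0)"
    by (rule sum.cong[OF refl inner])
  also have "\<dots> = (\<Sum>P | P \<in> \<P> \<and> {m1..<r} \<subseteq> P. of_nat ((l1 - m2 + i) choose i))"
    using finP by (intro sum.mono_neutral_cong_right) auto
  also have "\<dots> = of_nat (((l2 - m2) choose i) * ((l1 - m2 + i) choose i))"
    by (simp add: number)
  finally show ?thesis using c by simp
qed

end

section \<open>The projection onto the Young module\<close>

lemma sym_submoduleD:
  assumes "sym_submodule r A"
  shows "0 \<in> A" "\<And>v w. v \<in> A \<Longrightarrow> w \<in> A \<Longrightarrow> v + w \<in> A" "\<And>v w. v \<in> A \<Longrightarrow> w \<in> A \<Longrightarrow> v - w \<in> A"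
    "\<And>c v. v \<in> A \<Longrightarrow> scl c v \<in> A" "\<And>p v. p permutes {..<r} \<Longrightarrow> v \<in> A \<Longrightarrow> perm_act p v \<in> A"
    "A \<subseteq> tensor_space r"
proof -
  have sub: "tensor.subspace A" using assms by (simp add: sym_submodule_def)
  show "0 \<in> A" by (rule tensor.subspace_0[OF sub])
  show "v + w \<in> A" if "v \<in> A" "w \<in> A" for v w by (rule tensor.subspace_add[OF sub that])
  show "v - w \<in> A" if "v \<in> A" "w \<in> A" for v w by (rule tensor.subspace_diff[OF sub that])
  show "scl c v \<in> A" if "v \<in> A" for c v by (rule tensor.subspace_scale[OF sub that])
  show "perm_act p v \<in> A" if "p permutes {..<r}" "v \<in> A" for p v
    using assms that unfolding sym_submodule_def by blast
  show "A \<subseteq> tensor_space r" using assms by (simp add: sym_submodule_def)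
qed

text \<open>Elements of the corner act on all coordinate functions. So a function is first sent to
  \<open>perm_module\<close> by the weight projection and then to its component in \<open>A\<close>;
  uniqueness of components gives linearity and equivariance.\<close>

lemma direct_decomp_projection:
  fixes A B :: "'k::field tensor set"
  assumes D: "direct_decomp r (perm_module r l1 l2) A B"
  obtains \<pi> where "\<pi> \<in> carrier (schur_corner r l1 l2)" "\<And>v. \<pi> v \<in> A"
    "\<And>a b. a \<in> A \<Longrightarrow> b \<in> B \<Longrightarrow> \<pi> (a + b) = a"
proof -
  let ?M = "perm_module r l1 l2 :: 'k tensor set"
  let ?W = "weight_proj r l1 l2 :: 'k operator"
  have M: "?M = {a + b | a b. a \<in> A \<and> b \<in> B}" and AB: "A \<inter> B = {0}"
    using D by (auto simp: direct_decomp_def)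
  have sub: "sym_submodule r A" "sym_submodule r B"
    using D by (simp_all add: direct_decomp_def)
  note AD = sym_submoduleD[OF sub(1)] and BD = sym_submoduleD[OF sub(2)]
  have uniq: "a = a'" if "a \<in> A" "a' \<in> A" "b \<in> B" "b' \<in> B" "a + b = a' + b'" for a a' b b'
  proof -
    have "a - a' = b' - b" using that(5) by (simp add: algebra_simps)
    moreover have "a - a' \<in> A" "b' - b \<in> B" using that AD(3) BD(3) by blast+
    ultimately have "a - a' \<in> A \<inter> B" by simp
    then show ?thesis using AB by simp
  qed
  have W_M: "?W v \<in> ?M" for v by (simp add: perm_module_def weight_proj_def)
  have W_id: "?W v = v" if "v \<in> ?M" for v
    using that by (auto simp: perm_module_def weight_proj_def fun_eq_iff)
  have "\<exists>a b. a \<in> A \<and> b \<in> B \<and> ?W v = a + b" for v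
    using W_M[of v] unfolding M by blast
  then obtain \<pi> \<rho> where \<pi>: "\<And>v. \<pi> v \<in> A" "\<And>v. \<rho> v \<in> B" "\<And>v. ?W v = \<pi> v + \<rho> v"
    by metis
  have \<pi>_eq: "\<pi> v = a" if "a \<in> A" "b \<in> B" "?W v = a + b" for v a b
    using uniq[of "\<pi> v" a "\<rho> v" b] that \<pi> by metis
  have scl: "scl c (x + y) = scl c x + scl c y" for c and x y :: "'k tensor"
    by (simp add: scl_def fun_eq_iff algebra_simps)
  have perm_add: "perm_act p (x + y) = perm_act p x + perm_act p y" for p and x y :: "'k tensor"
    by (simp add: perm_act_def fun_eq_iff)
  have on: "\<pi> (a + b) = a" if "a \<in> A" "b \<in> B" for a b
  proof (rule \<pi>_eq[OF that])
    have "a + b \<in> ?M" using that unfolding M by blast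
    then show "?W (a + b) = a + b" by (rule W_id)
  qed
  have "\<pi> \<in> carrier (schur_corner r l1 l2)"
    unfolding schur_corner_carrier_apply
  proof (intro conjI allI impI)
    fix v w
    have "?W (v + w) = (\<pi> v + \<pi> w) + (\<rho> v + \<rho> w)"
      unfolding linear_weight_proj \<pi>(3) by (simp only: add.assoc add.left_commute add.commute)
    then show "\<pi> (v + w) = \<pi> v + \<pi> w"
      using \<pi> AD BD by (intro \<pi>_eq) auto
  next
    fix c v
    have "?W (scl c v) = scl c (\<pi> v) + scl c (\<rho> v)"
      unfolding linear_weight_proj \<pi>(3) scl ..
    then show "\<pi> (scl c v) = scl c (\<pi> v)"
      using \<pi> AD BD by (intro \<pi>_eq) auto
  next
    fix v
    have "\<pi> v + 0 \<in> ?M" using \<pi>(1) BD(1) unfolding M by blast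
    then show "?W (\<pi> v) = \<pi> v" using W_id by simp
    have "?W (?W v) = ?W v" using W_id W_M by blast
    then show "\<pi> (?W v) = \<pi> v" using \<pi>(3)[of v] \<pi>(1,2) by (intro \<pi>_eq) auto
  next
    fix p v assume p: "p permutes {..<r}"
    have "?W (perm_act p v) = perm_act p (?W v)"
      using weight_proj_perm_act[OF p] by (metis comp_apply)
    also have "\<dots> = perm_act p (\<pi> v) + perm_act p (\<rho> v)"
      unfolding \<pi>(3) perm_add ..
    finally show "\<pi> (perm_act p v) = perm_act p (\<pi> v)"
      using \<pi> AD(5)[OF p] BD(5)[OF p] by (intro \<pi>_eq) auto
  qed
  then show thesis using \<pi>(1) on by (rule that)
qed

text \<open>Used beside \<open>sym_hom\<close> because \<open>module_iso\<close> constrains its map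
  only on \<open>A\<close>.\<close>

definition hom_on :: "nat \<Rightarrow> 'k::field tensor set \<Rightarrow> 'k operator \<Rightarrow> bool" where
  "hom_on r A f \<longleftrightarrow> (\<forall>v\<in>A. \<forall>w\<in>A. f (v + w) = f v + f w) \<and> (\<forall>c. \<forall>v\<in>A. f (scl c v) = scl c (f v)) \<and>
     (\<forall>p. p permutes {..<r} \<longrightarrow> (\<forall>v\<in>A. f (perm_act p v) = perm_act p (f v)))"

lemma module_iso_hom_on: "module_iso r A B \<longleftrightarrow> (\<exists>f. bij_betw f A B \<and> hom_on r A f)"
  by (simp add: module_iso_def hom_on_def)

lemma hom_on_0:
  assumes "hom_on r A f" "sym_submodule r A" shows "f 0 = 0"
proof -
  have "f (0 + 0) = f 0 + f 0" using assms sym_submoduleD(1) unfolding hom_on_def by blast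
  then show ?thesis by simp
qed

lemma hom_on_inverse:
  assumes f: "bij_betw f A B" "hom_on r A f" and A: "sym_submodule r A"
  shows "hom_on r B (inv_into A f)"
proof -
  let ?g = "inv_into A f"
  note AD = sym_submoduleD[OF A]
  have g: "?g v \<in> A" "f (?g v) = v" if "v \<in> B" for v
    using that f(1) by (auto simp: bij_betw_def inv_into_into f_inv_into_f)
  have gf: "?g (f a) = a" if "a \<in> A" for a using that f(1) by (simp add: bij_betw_inv_into_left)
  have "?g (v + w) = ?g v + ?g w" if "v \<in> B" "w \<in> B" for v w
  proof -
    have "f (?g v + ?g w) = v + w" using f(2) g that by (simp add: hom_on_def)
    then show ?thesis using gf[of "?g v + ?g w"] g that AD(2) by simp
  qed
  moreover have "?g (scl c v) = scl c (?g v)" if "v \<in> B" for c v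
  proof -
    have "f (scl c (?g v)) = scl c v" using f(2) g that by (simp add: hom_on_def)
    then show ?thesis using gf[of "scl c (?g v)"] g that AD(4) by simp
  qed
  moreover have "?g (perm_act p v) = perm_act p (?g v)" if "p permutes {..<r}" "v \<in> B" for p v
  proof -
    have "f (perm_act p (?g v)) = perm_act p v" using f(2) g that by (simp add: hom_on_def)
    then show ?thesis using gf[of "perm_act p (?g v)"] g that AD(5) by simp
  qed
  ultimately show ?thesis by (simp add: hom_on_def)
qed

lemma sym_hom_comp_hom_on:
  assumes "\<pi> \<in> carrier (schur_corner r l1 l2)" "\<And>v. \<pi> v \<in> A" "hom_on r A f"
  shows "sym_hom r (f \<circ> \<pi>)"
  using assms unfolding schur_corner_carrier_apply sym_hom_def hom_on_def by simp

lemma sym_submodule_image: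
  assumes f: "hom_on r A f" and A: "sym_submodule r A" and Y: "sym_submodule r Y" and "f ` A \<subseteq> Y"
  shows "sym_submodule r (f ` A)"
proof -
  note AD = sym_submoduleD[OF A]
  have "0 \<in> f ` A" using hom_on_0[OF f A] AD(1) by force
  moreover have "x + y \<in> f ` A" if "x \<in> f ` A" "y \<in> f ` A" for x y
  proof -
    obtain a b where ab: "a \<in> A" "b \<in> A" "x = f a" "y = f b" using \<open>x \<in> _\<close> \<open>y \<in> _\<close> by blast
    then have "x + y = f (a + b)" using f by (simp add: hom_on_def)
    then show ?thesis using AD(2)[OF ab(1,2)] by (rule image_eqI)
  qed
  moreover have "scl c x \<in> f ` A" if "x \<in> f ` A" for c x
  proof -
    obtain a where a: "a \<in> A" "x = f a" using \<open>x \<in> _\<close> by blast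
    then have "scl c x = f (scl c a)" using f by (simp add: hom_on_def)
    then show ?thesis using AD(4)[OF a(1)] by (rule image_eqI)
  qed
  ultimately have "tensor.subspace (f ` A)" by (simp add: tensor.subspace_def)
  moreover have "perm_act p ` f ` A \<subseteq> f ` A" if p: "p permutes {..<r}" for p
  proof (rule image_subsetI)
    fix x assume "x \<in> f ` A"
    then obtain a where a: "a \<in> A" "x = f a" by blast
    then have "perm_act p x = f (perm_act p a)" using f p by (simp add: hom_on_def)
    then show "perm_act p x \<in> f ` A" using AD(5)[OF p a(1)] by (rule image_eqI)
  qed
  moreover have "f ` A \<subseteq> tensor_space r" using assms(4) sym_submoduleD(6)[OF Y] by (rule subset_trans)
  ultimately show ?thesis by (simp add: sym_submodule_def)
qed

text \<open>\<open>e\<close> and its complement split \<open>A\<close>. As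
  \<open>indecomposable\<close> is stated for \<open>Y\<close>, both images are carried over by the
  isomorphism \<open>f\<close>. The image of \<open>e\<close> is not zero because of
  \<open>z\<close>, so the complement vanishes.\<close>

lemma indecomposable_idempotent:
  fixes e :: "'k::field operator"
  assumes Y: "indecomposable r Y" and A: "sym_submodule r A" and iso: "module_iso r A Y"
    and e: "hom_on r A e" "\<And>a. a \<in> A \<Longrightarrow> e a \<in> A" "\<And>a. a \<in> A \<Longrightarrow> e (e a) = e a"
    and z: "z \<in> A" "e z \<noteq> 0" and a: "a \<in> A"
  shows "e a = a"
proof -
  obtain f where f: "bij_betw f A Y" "hom_on r A f"
    using iso by (auto simp: module_iso_hom_on)
  note AD = sym_submoduleD[OF A]
  have Ysub: "sym_submodule r Y" using Y by (simp add: indecomposable_def)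
  have fY: "f a \<in> Y" if "a \<in> A" for a using that f(1) by (auto simp: bij_betw_def)
  have f_inj: "f a = f b \<longleftrightarrow> a = b" if "a \<in> A" "b \<in> A" for a b
    using that f(1) by (auto simp: bij_betw_def inj_on_def)
  have f0: "f 0 = 0" by (rule hom_on_0[OF f(2) A])
  let ?h = "\<lambda>a. a - e a"
  have scl_diff: "scl c (x - y) = scl c x - scl c y" for c and x y :: "'k tensor"
    by (simp add: scl_def fun_eq_iff algebra_simps)
  have perm_diff: "perm_act p (x - y) = perm_act p x - perm_act p y" for p and x y :: "'k tensor"
    by (simp add: perm_act_def fun_eq_iff)
  have h: "hom_on r A ?h"
    using e(1) unfolding hom_on_def by (simp add: scl_diff perm_diff)
  have hA: "?h a \<in> A" if "a \<in> A" for a using that e(2) AD(3) by simp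
  have comp: "hom_on r A (\<lambda>a. f (k a))" if "hom_on r A k" "\<And>a. a \<in> A \<Longrightarrow> k a \<in> A" for k
    using that f(2) by (simp add: hom_on_def)
  let ?Y1 = "(\<lambda>a. f (e a)) ` A" and ?Y2 = "(\<lambda>a. f (?h a)) ` A"
  have "direct_decomp r Y ?Y1 ?Y2"
    unfolding direct_decomp_def
  proof (intro conjI)
    show "sym_submodule r ?Y1"
      by (rule sym_submodule_image[OF comp[OF e(1,2)] A Ysub]) (use fY e(2) in auto)
    show "sym_submodule r ?Y2"
      by (rule sym_submodule_image[OF comp[OF h hA] A Ysub]) (use fY hA in auto)
    show "Y = {a + b | a b. a \<in> ?Y1 \<and> b \<in> ?Y2}"
    proof (intro Set.equalityI subsetI)
      fix y assume "y \<in> Y"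
      then obtain a where a: "a \<in> A" "y = f a" using f(1) by (auto simp: bij_betw_def)
      have "f (e a + ?h a) = f (e a) + f (?h a)"
        using f(2) e(2)[OF a(1)] hA[OF a(1)] unfolding hom_on_def by blast
      then have "y = f (e a) + f (?h a)" using a(2) by simp
      then show "y \<in> {a + b | a b. a \<in> ?Y1 \<and> b \<in> ?Y2}" using a(1) by blast
    next
      fix y assume "y \<in> {a + b | a b. a \<in> ?Y1 \<and> b \<in> ?Y2}"
      then show "y \<in> Y" using fY e(2) hA sym_submoduleD(2)[OF Ysub] by auto
    qed
    show "?Y1 \<inter> ?Y2 = {0}"
    proof (intro Set.equalityI subsetI)
      fix y assume "y \<in> ?Y1 \<inter> ?Y2"
      then obtain a b where ab: "a \<in> A" "b \<in> A" "y = f (e a)" "f (e a) = f (?h b)" by auto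
      then have eq: "e a = ?h b" using f_inj e(2) hA by blast
      have "e (?h b + e b) = e (?h b) + e (e b)"
        using e(1) hA[OF ab(2)] e(2)[OF ab(2)] unfolding hom_on_def by blast
      then have "e (?h b) = 0" using e(3)[OF ab(2)] by simp
      then have "e a = 0" using eq e(3)[OF ab(1)] by simp
      then show "y \<in> {0}" using ab(3) f0 by simp
    next
      fix y :: "'k tensor" assume "y \<in> {0}"
      moreover have "e 0 = 0" by (rule hom_on_0[OF e(1) A])
      then have "f (e 0) = 0" "f (?h 0) = 0" using f0 by simp_all
      then have "0 \<in> ?Y1" "0 \<in> ?Y2" using AD(1) by (metis (no_types, lifting) image_eqI)+
      ultimately show "y \<in> ?Y1 \<inter> ?Y2" by simp
    qed
  qed
  then have "?Y1 = {0} \<or> ?Y2 = {0}" using Y unfolding indecomposable_def by blast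
  moreover have "f (e z) \<noteq> 0" using f_inj[OF e(2)[OF z(1)] AD(1)] f0 z(2) by simp
  then have "?Y1 \<noteq> {0}" using z(1) by blast
  ultimately have "f (?h a) = 0" using a by blast
  then have "?h a = 0" using f_inj[OF hA[OF a] AD(1)] f0 by simp
  then show ?thesis by simp
qed

text \<open>The claims are proved in this order because oddness must be known before
  \<open>carry_setup\<close>, and with it every fact on the idempotent, becomes available.\<close>

lemma e_elem_projection:
  fixes Y :: "'k::field tensor set"
  assumes char: "CHAR('k) = 2" and l: "l1 \<ge> l2" "l1 + l2 = r" and m12: "m1 \<ge> m2" "m1 + m2 = r"
    and Y: "young_module r m1 m2 Y"
    and D: "direct_decomp r (perm_module r l1 l2) A B" and iso: "module_iso r A Y"
  shows "m2 \<le> l2" "odd (((l1 - l2) + 2 * (l2 - m2)) choose (l2 - m2))"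
    "\<And>a b. a \<in> A \<Longrightarrow> b \<in> B \<Longrightarrow> e_elem r l1 l2 (l1 - l2) (l2 - m2) (a + b) = a"
proof -
  interpret C: two_rows r m1 m2 "TYPE('k)" using char m12 by unfold_locales
  define s z :: "'k tensor" where "s = C.column_vec m1 m2" and "z = C.column_vec l1 l2"
  obtain B' where D': "direct_decomp r (perm_module r m1 m2) Y B'"
    using Y by (auto simp: young_module_def direct_summand_def)
  have A_sub: "sym_submodule r A" and B_sub: "sym_submodule r B" and Y_sub: "sym_submodule r Y"
    using D D' by (auto simp: direct_decomp_def)
  note AD = sym_submoduleD[OF A_sub]
  obtain f where f: "bij_betw f A Y" "hom_on r A f"
    using iso by (auto simp: module_iso_hom_on)
  let ?g = "inv_into A f"
  have g: "hom_on r Y ?g" by (rule hom_on_inverse[OF f A_sub])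
  obtain \<pi> where \<pi>: "\<pi> \<in> carrier (schur_corner r l1 l2)" "\<And>v. \<pi> v \<in> A"
    "\<And>a b. a \<in> A \<Longrightarrow> b \<in> B \<Longrightarrow> \<pi> (a + b) = a" using direct_decomp_projection[OF D] by blast
  obtain \<pi>' where \<pi>': "\<pi>' \<in> carrier (schur_corner r m1 m2)" "\<And>v. \<pi>' v \<in> Y"
    "\<And>a b. a \<in> Y \<Longrightarrow> b \<in> B' \<Longrightarrow> \<pi>' (a + b) = a" using direct_decomp_projection[OF D'] by blast
  have \<pi>_A: "\<pi> a = a" if "a \<in> A" for a
    using \<pi>(3)[OF that sym_submoduleD(1)[OF B_sub]] by simp
  have B'0: "0 \<in> B'" using D' sym_submoduleD(1) by (auto simp: direct_decomp_def)
  have \<pi>'_Y: "\<pi>' y = y" if "y \<in> Y" for y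
    using \<pi>'(3)[OF that B'0] by simp
  \<comment> \<open>The isomorphism and its inverse, extended by the projections to all coordinate
    functions.\<close>
  define x y where "x = f \<circ> \<pi>" and "y = ?g \<circ> \<pi>'"
  have x: "sym_hom r x" unfolding x_def by (rule sym_hom_comp_hom_on[OF \<pi>(1,2) f(2)])
  have y: "sym_hom r y" unfolding y_def by (rule sym_hom_comp_hom_on[OF \<pi>'(1,2) g])
  have Y_sub_M: "Y \<subseteq> perm_module r m1 m2"
  proof
    fix v assume "v \<in> Y"
    then have "v + 0 \<in> {a + b | a b. a \<in> Y \<and> b \<in> B'}" using B'0 by blast
    then show "v \<in> perm_module r m1 m2" using D' by (simp add: direct_decomp_def)
  qed
  have A_sub_M: "A \<subseteq> perm_module r l1 l2"
  proof
    fix v assume "v \<in> A"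
    then have "v + 0 \<in> {a + b | a b. a \<in> A \<and> b \<in> B}" using sym_submoduleD(1)[OF B_sub] by blast
    then show "v \<in> perm_module r l1 l2" using D by (simp add: direct_decomp_def)
  qed
  have sY: "s \<in> Y" using Y C.column_vec_specht by (auto simp: young_module_def s_def)
  have ys: "y s \<in> A" "f (y s) = s"
    using sY f(1) \<pi>'_Y[OF sY] by (auto simp: y_def bij_betw_def inv_into_into f_inv_into_f)
  have xy: "x (y s) = s" using ys \<pi>_A by (simp add: x_def)
  have s0: "s \<noteq> 0" unfolding s_def by (rule C.column_vec_neq_0)
  \<comment> \<open>The copy of the polytabloid inside \<open>A\<close> is a multiple of
    \<open>z\<close>; once \<open>c\<close> is known to be non-zero, \<open>z\<close> itself lies in
    \<open>A\<close>.\<close>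
  obtain c where c: "y s = scl c z"
    using C.sym_hom_column_vec[OF y l(2), of m1 m2] ys(1) A_sub_M unfolding s_def z_def by blast
  have x_add: "x (v + w) = x v + x w" and x_scl: "x (scl a v) = scl a (x v)" for a v w
    using x by (auto simp: sym_hom_def)
  have x0: "x 0 = 0" using x_add[of 0 0] by simp
  show le: "m2 \<le> l2"
  proof (rule ccontr)
    assume "\<not> m2 \<le> l2"
    then have "z = 0" unfolding z_def by (intro C.transversal_words_empty[OF l(2)]) simp
    then have "y s = 0" using c by (simp add: scl_def zero_fun_def)
    then show False using xy x0 s0 by simp
  qed
  define m g where "m = l1 - l2" and "g = l2 - m2"
  have mg: "m1 - m2 = m + 2 * g" "l1 - m2 = m + g" "2 * l2 + m = r" "l1 = l2 + m"
    using l m12 le by (auto simp: m_def g_def)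
  have "x v \<in> perm_module r m1 m2" for v
    using \<pi>(2)[of v] f(1) Y_sub_M by (auto simp: x_def bij_betw_def)
  then obtain c' where c': "x z = scl (c' * of_nat ((m + 2 * g) choose g)) s"
    using C.sym_hom_column_vec_self[OF x _ l(2) le] unfolding z_def s_def mg(1) g_def[symmetric] by blast
  \<comment> \<open>Going from \<open>Y\<close> to \<open>A\<close> and back is the identity on
    \<open>s\<close>, so no factor of the resulting scalar can vanish.\<close>
  have "s = scl (c * (c' * of_nat ((m + 2 * g) choose g))) s"
    using xy unfolding c x_scl c' by (simp add: scl_def mult.assoc)
  then have cc: "c \<noteq> 0" "of_nat ((m + 2 * g) choose g) \<noteq> (0::'k)"
    using s0 by (auto simp: scl_def zero_fun_def)
  then have odd: "odd ((m + 2 * g) choose g)"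
    by (simp add: of_nat_char_2[OF char])
  then show "odd (((l1 - l2) + 2 * (l2 - m2)) choose (l2 - m2))" by (simp add: m_def g_def)
  interpret E: carry_setup r l1 l2 m g "TYPE('k)"
    by (rule carry_setup.intro[OF char mg(3,4) odd])
  let ?e = "e_elem r l1 l2 m g :: 'k operator"
  have z_A: "z \<in> A"
  proof -
    have "z = scl (1 / c) (y s)" unfolding c using cc(1) by (simp add: scl_def)
    then show ?thesis using AD(4)[OF ys(1)] by simp
  qed
  have z0: "z \<noteq> 0"
  proof
    assume "z = 0"
    then have "y s = 0" using c by (simp add: scl_def zero_fun_def)
    then show False using xy x0 s0 by simp
  qed
  \<comment> \<open>By Lucas' theorem both binomial coefficients with lower entry
    \<open>2 ^ u\<close> are single binary digits.\<close>
  have b_z: "b_elem r l1 l2 (2 ^ u) z = scl (of_bool (bit g u \<and> bit (m + g + 2 ^ u) u)) z" for u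
    using C.b_elem_column_vec[OF l(2,1) le, of "2 ^ u"]
    unfolding z_def mg(2) g_def[symmetric] of_nat_char_2[OF char]
    by (simp add: odd_choose_power_2)
  have scl1: "scl 1 v = v" and scl0: "scl 0 v = 0" for v :: "'k tensor"
    by (simp_all add: scl_def zero_fun_def)
  have e_z: "?e z = z"
  proof (rule E.e_eigenvector)
    show "weight_proj r l1 l2 z = z"
      using z_A A_sub_M by (auto simp: perm_module_def weight_proj_def fun_eq_iff)
    fix u
    \<comment> \<open>Adding \<open>2 ^ u\<close> flips the digit \<open>u\<close>. A digit of
      \<open>g\<close> is not one of \<open>m + g\<close>, hence the eigenvalue one there; at a
      digit of \<open>m + g\<close> the eigenvalue is zero because \<open>g\<close> lacks
      it.\<close>
    have bits: "bit (m + g + 2 ^ u) u \<longleftrightarrow> \<not> bit (m + g) u"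
    proof -
      have "\<not> carry (m + g) (2 ^ u) u" by (simp add: carry_def not_le)
      then show ?thesis using bit_add_carry[of "m + g" "2 ^ u" u] by (simp add: bit_exp_iff)
    qed
    show "b_elem r l1 l2 (2 ^ u) z = z" if "bit g u"
      using that E.g_disjoint[of u] unfolding b_z bits by (simp add: scl1)
    show "b_elem r l1 l2 (2 ^ u) z = 0" if "bit (m + g) u"
      using that E.g_disjoint[of u] unfolding b_z by (simp add: scl0)
  qed
  obtain d where d: "\<And>v. ?e (\<pi> v) = scl d (?e v)"
    using E.e_idempotent_scalar[OF \<pi>(1) \<pi>_A[OF \<pi>(2)]] by blast
  \<comment> \<open>Both sides are compared at \<open>z\<close>, which is fixed by \<open>e\<close>
    and by \<open>\<pi>\<close>.\<close>
  have "d = 1"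
  proof -
    obtain u where u: "z u \<noteq> 0" using z0 by (auto simp: fun_eq_iff)
    have "scl d z = z" using d[of z] \<pi>_A[OF z_A] e_z by simp
    then have "d * z u = z u" by (metis scl_def)
    then show ?thesis using u by simp
  qed
  then have e\<pi>: "?e (\<pi> v) = ?e v" for v using d[of v] by (simp only: scl1)
  have comm: "?e (\<pi> v) = \<pi> (?e v)" for v
    using schur_corner_comm[OF E.e_closed \<pi>(1)] by (metis comp_apply)
  \<comment> \<open>Since \<open>e\<close> equals \<open>e \<pi>\<close> and commutes with
    \<open>\<pi>\<close>, its values lie in the image of \<open>\<pi>\<close>.\<close>
  have e_A: "?e v \<in> A" for v using \<pi>(2)[of "?e v"] by (simp only: comm[symmetric] e\<pi>)
  note e_hom = sym_hom_corner[OF E.e_closed, unfolded sym_hom_def]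
  have "?e a = a" if "a \<in> A" for a
  proof (rule indecomposable_idempotent[OF _ A_sub iso _ _ _ z_A _ that])
    show "indecomposable r Y" using Y by (simp add: young_module_def)
    show "hom_on r A ?e" using e_hom by (simp add: hom_on_def)
    show "?e (?e a) = ?e a" for a
      using E.e_idem unfolding schur_corner_ops by (metis comp_apply)
    show "?e z \<noteq> 0" using e_z z0 by simp
  qed (rule e_A)
  moreover have "?e b = 0" if "b \<in> B" for b
  proof -
    have "\<pi> (0 + b) = 0" using \<pi>(3)[OF AD(1) that] .
    then have "\<pi> b = 0" by simp
    then show ?thesis using e\<pi>[of b] schur_corner_additive(3)[OF E.e_closed] by simp
  qed
  ultimately show "e_elem r l1 l2 (l1 - l2) (l2 - m2) (a + b) = a" if "a \<in> A" "b \<in> B" for a b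
    using that schur_corner_additive(1)[OF E.e_closed, of a b] by (simp add: m_def g_def)
qed

theorem theorem7p1:
  fixes Y :: "'k::field tensor set"
    and r l1 l2 m1 m2 m g :: nat
  assumes "CHAR('k) = 2"
    and "l1 \<ge> l2" and "l1 + l2 = r"
    and "m1 \<ge> m2" and "m1 + m2 = r"
    and "young_module r m1 m2 Y"
    and "\<exists>A. direct_summand r A (perm_module r l1 l2) \<and> module_iso r A Y"
    and "m = l1 - l2" and "g = l2 - m2"
  shows "let e = e_elem r l1 l2 m g in
     e \<in> carrier (schur_corner r l1 l2) \<and>
     e \<otimes>\<^bsub>schur_corner r l1 l2\<^esub> e = e \<and>
     module_iso r (e ` perm_module r l1 l2) Y \<and>
     (\<forall>A B. direct_decomp r (perm_module r l1 l2) A B \<and> module_iso r A Y \<longrightarrow>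
        (\<forall>a\<in>A. \<forall>b\<in>B. e (a + b) = a))"
proof -
  let ?e = "e_elem r l1 l2 m g :: 'k operator"
  note projection = e_elem_projection[OF assms(1-6), folded assms(8,9)]
  obtain A B where AB: "direct_decomp r (perm_module r l1 l2) A B" "module_iso r A Y"
    using assms(7) by (auto simp: direct_summand_def)
  have "2 * l2 + m = r" "l1 = l2 + m" using assms(2,3,8) by auto
  then interpret carry_setup r l1 l2 m g "TYPE('k)"
    by (rule carry_setup.intro[OF assms(1) _ _ projection(2)[OF AB]])
  \<comment> \<open>\<open>e\<close> is the projection onto \<open>A\<close> along \<open>B\<close>,
    so its image is the given copy of the Young module.\<close>
  have "?e ` perm_module r l1 l2 = A"
  proof (intro Set.equalityI subsetI)
    fix v assume "v \<in> ?e ` perm_module r l1 l2"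
    then obtain a b where "a \<in> A" "b \<in> B" "v = ?e (a + b)"
      using AB(1) by (auto simp: direct_decomp_def)
    then show "v \<in> A" using projection(3)[OF AB] by simp
  next
    fix a assume a: "a \<in> A"
    have 0: "0 \<in> B" using AB(1) sym_submoduleD(1) by (auto simp: direct_decomp_def)
    then have "a + 0 \<in> perm_module r l1 l2" using AB(1) a unfolding direct_decomp_def by blast
    moreover have "?e (a + 0) = a" by (rule projection(3)[OF AB a 0])
    ultimately show "a \<in> ?e ` perm_module r l1 l2" by (metis image_eqI)
  qed
  then show ?thesis
    unfolding Let_def using e_closed e_idem AB(2) by (intro conjI allI impI ballI) (auto intro: projection(3))
qed

end
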